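(* Assume $p\mid n$. For $\alpha,\alpha'\in k$, $$E_\alpha\cong E_{\alpha'}\text{ as Hopf algebras}\quad\Longleftrightarrow\quad \alpha'=u\alpha+v\ \text{ for some }u\in\mathbb F_p^\times,\ v\in\mathbb F_p.$$ Equivalently, the set of Hopf-isomorphism classes of the $E_\alpha$, $\alpha\in k$, is the orbit space $k/\operatorname{AGL}_1(\mathbb F_p)$, where $\operatorname{AGL}_1(\mathbb F_p)$ acts on $k$ by the affine transformations $a\mapsto ua+v$ ($u\in\mathbb F_p^\times$, $v\in\mathbb F_p$).
   Context: $k$ is an algebraically closed field of characteristic $p>0$, and $\mathbb F_p\subseteq k$ is the prime field. Let $n$ be a positive integer divisible by $p$. For $\alpha\in k$, $E_\alpha$ is the Hopf algebra generated as an algebra by $g,h,x$ with relations $g^p=1$, $h^n=1$, $gh=hg$, $x^p=x$, $gx-xg=g(1-g)$, $xh-hx=\alpha h(1-g)$, and coalgebra structure $\Delta(g)=g\otimes g$, $\Delta(h)=h\otimes h$, $\Delta(x)=x\otimes1+g\otimes x$ (so $\varepsilon(g)=\varepsilon(h)=1$, $\varepsilon(x)=0$). It has basis $\{h^ig^jx^l\mid 0\le i<n,\ 0\le j,l<p\}$. (It is the bicrossed product of $k[C_n]$, $C_n=\langle h\rangle$, with the Radford algebra generated by $g,x$, for the matched pair with trivial left action, $g\triangleleft h=g$, $x\triangleleft h=x+\alpha(1-g)$.) *)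

theory Defs
  imports
    "HOL-Library.Poly_Mapping"
    "HOL-Algebra.Module"
    "HOL-Algebra.QuotRing"
    "HOL-Algebra.Group_Action"
    "HOL-Algebra.Algebraic_Closure_Type"
begin

text \<open>
  The ground field is a type \<open>'k\<close>; algebras over it are HOL-Algebra module records (which extend
  ring records) with explicit carriers. The locale \<open>algebra\<close> of HOL-Algebra is restricted to
  commutative algebras, so the noncommutative notion is introduced here.
\<close>

definition k_algebra :: "('k::field, 'a, 'm) module_scheme \<Rightarrow> bool" where
  "k_algebra A \<longleftrightarrow>
     module (ring_of_type_algebra :: 'k ring) A \<and> ring A \<and>
     (\<forall>c. \<forall>a\<in>carrier A. \<forall>b\<in>carrier A.
        (c \<odot>\<^bsub>A\<^esub> a) \<otimes>\<^bsub>A\<^esub> b = c \<odot>\<^bsub>A\<^esub> (a \<otimes>\<^bsub>A\<^esub> b) \<and>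
        a \<otimes>\<^bsub>A\<^esub> (c \<odot>\<^bsub>A\<^esub> b) = c \<odot>\<^bsub>A\<^esub> (a \<otimes>\<^bsub>A\<^esub> b))"

definition k_algebra_hom ::
    "('k, 'a, 'm) module_scheme \<Rightarrow> ('k, 'b, 'n) module_scheme \<Rightarrow> ('a \<Rightarrow> 'b) set" where
  "k_algebra_hom A B =
     {f \<in> ring_hom A B. \<forall>c. \<forall>a\<in>carrier A. f (c \<odot>\<^bsub>A\<^esub> a) = c \<odot>\<^bsub>B\<^esub> f a}"

definition base_algebra :: "('k::field, 'k) module" where
  "base_algebra = ring.extend ring_of_type_algebra (module.fields (*))"

text \<open>The algebra \<open>k[M]\<close> of a monoid \<open>M\<close>: finitely supported functions \<open>M \<rightarrow> k\<close> with convolution.\<close>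

definition monoid_algebra :: "('a, 'm) monoid_scheme \<Rightarrow> ('k::field, 'a \<Rightarrow>\<^sub>0 'k) module" where
  "monoid_algebra M =
     \<lparr>carrier = {x. Poly_Mapping.keys x \<subseteq> carrier M},
      monoid.mult = (\<lambda>x y. \<Sum>a\<in>Poly_Mapping.keys x. \<Sum>b\<in>Poly_Mapping.keys y.
                Poly_Mapping.single (a \<otimes>\<^bsub>M\<^esub> b)
                  (Poly_Mapping.lookup x a * Poly_Mapping.lookup y b)),
      one = Poly_Mapping.single \<one>\<^bsub>M\<^esub> 1,
      zero = 0,
      add = (+),
      module.smult = (\<lambda>c. Poly_Mapping.map ((*) c))\<rparr>"

definition quotient_algebra ::
    "('k, 'a, 'm) module_scheme \<Rightarrow> 'a set \<Rightarrow> ('k, 'a set) module" where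
  "quotient_algebra A I =
     ring.extend (A Quot I) (module.fields (\<lambda>c C. \<Union>x\<in>C. I +>\<^bsub>A\<^esub> (c \<odot>\<^bsub>A\<^esub> x)))"

text \<open>
  The linear map into \<open>M\<close> that is induced by \<open>f\<close> on a quotient of a space of finitely supported
  functions: a class is sent to \<open>\<Sum> x(q) f(q)\<close> for an arbitrary representative \<open>x\<close>. It is only
  meaningful where the value does not depend on the representative.
\<close>

definition induced ::
    "('k::field, 'b, 'm) module_scheme \<Rightarrow> ('q \<Rightarrow> 'b) \<Rightarrow> ('q \<Rightarrow>\<^sub>0 'k) set \<Rightarrow> 'b" where
  "induced M f C =
     (let x = (SOME x. x \<in> C)
      in \<Oplus>\<^bsub>M\<^esub>q\<in>Poly_Mapping.keys x. Poly_Mapping.lookup x q \<odot>\<^bsub>M\<^esub> f q)"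

text \<open>
  The tensor product of algebras, as the quotient of the free vector space on
  \<open>carrier A \<times> carrier B\<close> by the bilinearity relations. The free vector space is the monoid algebra
  of the product of the multiplicative monoids, which gives the usual product
  \<open>(a \<otimes> b)(a' \<otimes> b') = aa' \<otimes> bb'\<close>; multiplying a relation by a pair yields a relation again, so the
  ideal generated by the relations is their linear span.
\<close>

definition tensor_relations ::
    "('k::field, 'a, 'm) module_scheme \<Rightarrow> ('k, 'b, 'n) module_scheme \<Rightarrow> ('a \<times> 'b \<Rightarrow>\<^sub>0 'k) set" where
  "tensor_relations A B =
     {Poly_Mapping.single (a \<oplus>\<^bsub>A\<^esub> a', b) 1 - Poly_Mapping.single (a, b) 1
        - Poly_Mapping.single (a', b) 1
      | a a' b. a \<in> carrier A \<and> a' \<in> carrier A \<and> b \<in> carrier B} \<union>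
     {Poly_Mapping.single (a, b \<oplus>\<^bsub>B\<^esub> b') 1 - Poly_Mapping.single (a, b) 1
        - Poly_Mapping.single (a, b') 1
      | a b b'. a \<in> carrier A \<and> b \<in> carrier B \<and> b' \<in> carrier B} \<union>
     {Poly_Mapping.single (c \<odot>\<^bsub>A\<^esub> a, b) 1 - Poly_Mapping.single (a, b) c
      | c a b. a \<in> carrier A \<and> b \<in> carrier B} \<union>
     {Poly_Mapping.single (a, c \<odot>\<^bsub>B\<^esub> b) 1 - Poly_Mapping.single (a, b) c
      | c a b. a \<in> carrier A \<and> b \<in> carrier B}"

definition tensor_ideal ::
    "('k::field, 'a, 'm) module_scheme \<Rightarrow> ('k, 'b, 'n) module_scheme \<Rightarrow> ('a \<times> 'b \<Rightarrow>\<^sub>0 'k) set" where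
  "tensor_ideal A B =
     Idl\<^bsub>(monoid_algebra (A \<times>\<times> B) :: ('k, _) module)\<^esub> (tensor_relations A B)"

definition tensor ::
    "('k::field, 'a, 'm) module_scheme \<Rightarrow> ('k, 'b, 'n) module_scheme \<Rightarrow>
     ('k, ('a \<times> 'b \<Rightarrow>\<^sub>0 'k) set) module" where
  "tensor A B = quotient_algebra (monoid_algebra (A \<times>\<times> B)) (tensor_ideal A B)"

definition pure_tensor ::
    "('k::field, 'a, 'm) module_scheme \<Rightarrow> ('k, 'b, 'n) module_scheme \<Rightarrow> 'a \<Rightarrow> 'b \<Rightarrow>
     ('a \<times> 'b \<Rightarrow>\<^sub>0 'k) set" where
  "pure_tensor A B a b =
     tensor_ideal A B +>\<^bsub>(monoid_algebra (A \<times>\<times> B) :: ('k, _) module)\<^esub> Poly_Mapping.single (a, b) 1"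

text \<open>\<open>tensor_map C D f g\<close> is \<open>f \<otimes> g\<close> for linear maps \<open>f\<close> into \<open>C\<close> and \<open>g\<close> into \<open>D\<close>.\<close>

definition tensor_map ::
    "('k::field, 'c, 'm) module_scheme \<Rightarrow> ('k, 'd, 'n) module_scheme \<Rightarrow>
     ('a \<Rightarrow> 'c) \<Rightarrow> ('b \<Rightarrow> 'd) \<Rightarrow> ('a \<times> 'b \<Rightarrow>\<^sub>0 'k) set \<Rightarrow> ('c \<times> 'd \<Rightarrow>\<^sub>0 'k) set" where
  "tensor_map C D f g = induced (tensor C D) (\<lambda>(a, b). pure_tensor C D (f a) (g b))"

definition tensor_assoc ::
    "('k::field, 'a, 'l) module_scheme \<Rightarrow> ('k, 'b, 'm) module_scheme \<Rightarrow>
     ('k, 'c, 'n) module_scheme \<Rightarrow>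
     (('a \<times> 'b \<Rightarrow>\<^sub>0 'k) set \<times> 'c \<Rightarrow>\<^sub>0 'k) set \<Rightarrow>
     ('a \<times> ('b \<times> 'c \<Rightarrow>\<^sub>0 'k) set \<Rightarrow>\<^sub>0 'k) set" where
  "tensor_assoc A B C =
     induced (tensor A (tensor B C))
       (\<lambda>(t, c). induced (tensor A (tensor B C))
          (\<lambda>(a, b). pure_tensor A (tensor B C) a (pure_tensor B C b c)) t)"

record (overloaded) ('k, 'a) bialgebra = "('k, 'a) module" +
  comult :: "'a \<Rightarrow> ('a \<times> 'a \<Rightarrow>\<^sub>0 'k) set"
  counit :: "'a \<Rightarrow> 'k"

definition bialgebra :: "('k::field, 'a, 'm) bialgebra_scheme \<Rightarrow> bool" where
  "bialgebra H \<longleftrightarrow>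
     k_algebra H \<and>
     comult H \<in> k_algebra_hom H (tensor H H) \<and>
     counit H \<in> k_algebra_hom H base_algebra \<and>
     (\<forall>a\<in>carrier H.
        tensor_assoc H H H (tensor_map (tensor H H) H (comult H) id (comult H a)) =
          tensor_map H (tensor H H) id (comult H) (comult H a) \<and>
        induced H (\<lambda>(b, c). counit H b \<odot>\<^bsub>H\<^esub> c) (comult H a) = a \<and>
        induced H (\<lambda>(b, c). counit H c \<odot>\<^bsub>H\<^esub> b) (comult H a) = a)"

definition is_antipode :: "('k::field, 'a, 'm) bialgebra_scheme \<Rightarrow> ('a \<Rightarrow> 'a) \<Rightarrow> bool" where
  "is_antipode H S \<longleftrightarrow>
     S \<in> carrier H \<rightarrow> carrier H \<and>
     (\<forall>a\<in>carrier H. \<forall>b\<in>carrier H. S (a \<oplus>\<^bsub>H\<^esub> b) = S a \<oplus>\<^bsub>H\<^esub> S b) \<and>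
     (\<forall>c. \<forall>a\<in>carrier H. S (c \<odot>\<^bsub>H\<^esub> a) = c \<odot>\<^bsub>H\<^esub> S a) \<and>
     (\<forall>a\<in>carrier H.
        induced H (\<lambda>(b, c). S b \<otimes>\<^bsub>H\<^esub> c) (comult H a) = counit H a \<odot>\<^bsub>H\<^esub> \<one>\<^bsub>H\<^esub> \<and>
        induced H (\<lambda>(b, c). b \<otimes>\<^bsub>H\<^esub> S c) (comult H a) = counit H a \<odot>\<^bsub>H\<^esub> \<one>\<^bsub>H\<^esub>)"

definition hopf_algebra :: "('k::field, 'a, 'm) bialgebra_scheme \<Rightarrow> bool" where
  "hopf_algebra H \<longleftrightarrow> bialgebra H \<and> (\<exists>S. is_antipode H S)"

text \<open>As usual, Hopf algebra maps are bialgebra maps; these commute with the antipodes.\<close>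

definition bialgebra_hom ::
    "('k::field, 'a, 'm) bialgebra_scheme \<Rightarrow> ('k, 'b, 'n) bialgebra_scheme \<Rightarrow> ('a \<Rightarrow> 'b) set" where
  "bialgebra_hom A B =
     {f \<in> k_algebra_hom A B.
        \<forall>a\<in>carrier A. comult B (f a) = tensor_map B B f f (comult A a) \<and>
                      counit B (f a) = counit A a}"

definition hopf_isomorphic ::
    "('k::field, 'a, 'm) bialgebra_scheme \<Rightarrow> ('k, 'b, 'n) bialgebra_scheme \<Rightarrow> bool" where
  "hopf_isomorphic A B \<longleftrightarrow>
     hopf_algebra A \<and> hopf_algebra B \<and>
     (\<exists>f \<in> bialgebra_hom A B. bij_betw f (carrier A) (carrier B))"

text \<open>Free algebras and the evaluation of words, used to present the algebras \<open>E\<^sub>\<alpha>\<close>.\<close>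

definition free_algebra :: "('k::field, 's list \<Rightarrow>\<^sub>0 'k) module" where
  "free_algebra = monoid_algebra \<lparr>carrier = UNIV, monoid.mult = (@), one = []\<rparr>"

definition free_gen :: "'s \<Rightarrow> ('s list \<Rightarrow>\<^sub>0 'k::field)" where
  "free_gen s = Poly_Mapping.single [s] 1"

definition eval_word :: "('k, 'b, 'm) module_scheme \<Rightarrow> ('s \<Rightarrow> 'b) \<Rightarrow> 's list \<Rightarrow> 'b" where
  "eval_word B f w = foldr (\<lambda>s y. f s \<otimes>\<^bsub>B\<^esub> y) w \<one>\<^bsub>B\<^esub>"

datatype generator = Gen_g | Gen_h | Gen_x

definition E_relations ::
    "nat \<Rightarrow> nat \<Rightarrow> 'k::field \<Rightarrow> (generator list \<Rightarrow>\<^sub>0 'k) set" where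
  "E_relations p n \<alpha> =
     (let F = free_algebra; g = free_gen Gen_g; h = free_gen Gen_h; x = free_gen Gen_x in
      {g [^]\<^bsub>F\<^esub> p \<ominus>\<^bsub>F\<^esub> \<one>\<^bsub>F\<^esub>,
       h [^]\<^bsub>F\<^esub> n \<ominus>\<^bsub>F\<^esub> \<one>\<^bsub>F\<^esub>,
       g \<otimes>\<^bsub>F\<^esub> h \<ominus>\<^bsub>F\<^esub> h \<otimes>\<^bsub>F\<^esub> g,
       x [^]\<^bsub>F\<^esub> p \<ominus>\<^bsub>F\<^esub> x,
       (g \<otimes>\<^bsub>F\<^esub> x \<ominus>\<^bsub>F\<^esub> x \<otimes>\<^bsub>F\<^esub> g) \<ominus>\<^bsub>F\<^esub> g \<otimes>\<^bsub>F\<^esub> (\<one>\<^bsub>F\<^esub> \<ominus>\<^bsub>F\<^esub> g),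
       (x \<otimes>\<^bsub>F\<^esub> h \<ominus>\<^bsub>F\<^esub> h \<otimes>\<^bsub>F\<^esub> x) \<ominus>\<^bsub>F\<^esub> \<alpha> \<odot>\<^bsub>F\<^esub> (h \<otimes>\<^bsub>F\<^esub> (\<one>\<^bsub>F\<^esub> \<ominus>\<^bsub>F\<^esub> g))})"

definition E_ideal :: "nat \<Rightarrow> nat \<Rightarrow> 'k::field \<Rightarrow> (generator list \<Rightarrow>\<^sub>0 'k) set" where
  "E_ideal p n \<alpha> = Idl\<^bsub>(free_algebra :: ('k, _) module)\<^esub> (E_relations p n \<alpha>)"

definition E_algebra ::
    "nat \<Rightarrow> nat \<Rightarrow> 'k::field \<Rightarrow> ('k, (generator list \<Rightarrow>\<^sub>0 'k) set) module" where
  "E_algebra p n \<alpha> = quotient_algebra free_algebra (E_ideal p n \<alpha>)"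

definition E_gen :: "nat \<Rightarrow> nat \<Rightarrow> 'k::field \<Rightarrow> generator \<Rightarrow> (generator list \<Rightarrow>\<^sub>0 'k) set" where
  "E_gen p n \<alpha> s = E_ideal p n \<alpha> +>\<^bsub>(free_algebra :: ('k, _) module)\<^esub> free_gen s"

definition E_comult_gen ::
    "nat \<Rightarrow> nat \<Rightarrow> 'k::field \<Rightarrow> generator \<Rightarrow>
     ((generator list \<Rightarrow>\<^sub>0 'k) set \<times> (generator list \<Rightarrow>\<^sub>0 'k) set \<Rightarrow>\<^sub>0 'k) set" where
  "E_comult_gen p n \<alpha> s =
     (let A = E_algebra p n \<alpha>; g = E_gen p n \<alpha> Gen_g; h = E_gen p n \<alpha> Gen_h; x = E_gen p n \<alpha> Gen_x
      in case s of
           Gen_g \<Rightarrow> pure_tensor A A g g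
         | Gen_h \<Rightarrow> pure_tensor A A h h
         | Gen_x \<Rightarrow> pure_tensor A A x \<one>\<^bsub>A\<^esub> \<oplus>\<^bsub>tensor A A\<^esub> pure_tensor A A g x)"

definition E_counit_gen :: "generator \<Rightarrow> 'k::field" where
  "E_counit_gen s = (case s of Gen_g \<Rightarrow> 1 | Gen_h \<Rightarrow> 1 | Gen_x \<Rightarrow> 0)"

text \<open>
  The Hopf algebra \<open>E\<^sub>\<alpha>\<close>: comultiplication and counit are the algebra maps with the values above on
  the generators.
\<close>

definition E_hopf ::
    "nat \<Rightarrow> nat \<Rightarrow> 'k::field \<Rightarrow> ('k, (generator list \<Rightarrow>\<^sub>0 'k) set) bialgebra" where
  "E_hopf p n \<alpha> =
     (let A = E_algebra p n \<alpha> in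
      module.extend A
        (bialgebra.fields
          (induced (tensor A A) (eval_word (tensor A A) (E_comult_gen p n \<alpha>)))
          (induced base_algebra (eval_word base_algebra E_counit_gen))))"

text \<open>The prime field of \<open>'k\<close>, in characteristic \<open>p > 0\<close>, is the image of the integers.\<close>

definition prime_field :: "'k::field set" where
  "prime_field = range of_int"

text \<open>\<open>(u, v)\<close> stands for the affine transformation \<open>a \<mapsto> u a + v\<close>.\<close>

definition affine_group :: "('k::field \<times> 'k) monoid" where
  "affine_group =
     \<lparr>carrier = (prime_field - {0}) \<times> prime_field,
      monoid.mult = (\<lambda>(u, v) (u', v'). (u * u', u * v' + v)),
      one = (1, 0)\<rparr>"

definition affine_action :: "'k::field \<times> 'k \<Rightarrow> 'k \<Rightarrow> 'k" where
  "affine_action = (\<lambda>(u, v) a. u * a + v)"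

definition E_family ::
    "nat \<Rightarrow> nat \<Rightarrow> ('k::field, (generator list \<Rightarrow>\<^sub>0 'k) set) bialgebra set" where
  "E_family p n = range (E_hopf p n)"

definition E_iso_rel ::
    "nat \<Rightarrow> nat \<Rightarrow> ('k::field, (generator list \<Rightarrow>\<^sub>0 'k) set) bialgebra rel" where
  "E_iso_rel p n = {(A, B) \<in> E_family p n \<times> E_family p n. hopf_isomorphic A B}"

end

theory Submission
  imports Defs
begin

text \<open>
  Everything is decided by the grouplike and the skew primitive elements of \<open>E\<^sub>\<alpha>\<close>.

  Commuting \<open>x\<close> past a monomial gives \<open>x m - m x = (i \<alpha> - j) m (1 - g)\<close> for \<open>m = h\<^sup>i g\<^sup>j\<close>
  (\<open>commutator_grouplike\<close>). So \<open>g\<close>, \<open>h\<^sup>i g\<^sup>j\<close> and \<open>x\<close> in \<open>E\<^sub>\<beta>\<close> satisfy the relations of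
  \<open>E\<^sub>\<alpha>\<close> as soon as \<open>\<alpha> = i \<beta> - j\<close> in \<open>k\<close>; the order of the new \<open>h\<close> divides \<open>n\<close> because \<open>p\<close>
  divides \<open>n\<close>. This defines a Hopf map \<open>E\<^sub>\<alpha> \<rightarrow> E\<^sub>\<beta>\<close>. The scalar sees \<open>i\<close> only modulo \<open>p\<close>,
  so \<open>i\<close> can be chosen coprime to \<open>n\<close> whenever it is nonzero in \<open>k\<close>, and then the map is invertible by
  a map of the same kind (\<open>hopf_isomorphicI\<close>).

  Conversely, the grouplike elements of \<open>E\<^sub>\<beta>\<close> are exactly the monomials \<open>h\<^sup>i g\<^sup>j\<close>
  (\<open>grouplike_is_monomial\<close>), and for a nontrivial grouplike \<open>\<gamma>\<close> every \<open>y\<close> with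
  \<open>\<Delta> y = y \<otimes> 1 + \<gamma> \<otimes> y\<close> is \<open>c x + d (1 - \<gamma>)\<close> (\<open>skew_primitive_form\<close>). An injective Hopf map
  from \<open>E\<^sub>\<alpha>\<close> to \<open>E\<^sub>\<beta>\<close> therefore sends \<open>h\<close> to some \<open>h\<^sup>i g\<^sup>j\<close> and \<open>x\<close> to
  \<open>c x + d (1 - \<gamma>)\<close>, where \<open>\<gamma>\<close> is the image of \<open>g\<close>. The relation between \<open>g\<close> and \<open>x\<close> forces
  \<open>\<gamma> = g\<close> and \<open>c = 1\<close>; the relation between \<open>x\<close> and \<open>h\<close> then reads \<open>\<alpha> = i \<beta> - j\<close>. If \<open>p\<close> divided
  \<open>i\<close>, the element \<open>h\<^sup>n\<^sup>/\<^sup>p\<close> would go to a power of \<open>g\<close>, against injectivity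
  (\<open>injective_hom_parameters\<close>). Hence isomorphism of \<open>E\<^sub>\<alpha>\<close> and \<open>E\<^sub>\<beta>\<close> is the orbit
  relation of the affine group, and the statement on orbits is a reformulation.

  Two points carry the work behind this. A map out of an algebra given by generators and relations
  exists once the images satisfy the relations, and for the comultiplication, the antipode and the
  model below the only relation that is not formal is \<open>x\<^sup>p = x\<close>. It is checked by
  exhibiting a unipotent \<open>u\<close> with \<open>z u = u x\<close>, which makes \<open>z\<^sup>p = z\<close> follow from
  \<open>x\<^sup>p = x\<close> (\<open>unipotent_conjugate_power\<close>); this replaces computations with Jacobson's
  formula for \<open>(a + b)\<^sup>p\<close>.

  The classification of grouplikes needs to know that \<open>E\<^sub>\<beta>\<close> is large enough. The monomials
  \<open>h\<^sup>i g\<^sup>j x\<^sup>l\<close> span it by rewriting. A representation on sequences of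
  polynomials yields linear forms that read off the coefficients of the \<open>h\<^sup>i g\<^sup>j\<close> and
  vanish on \<open>E\<^sub>\<beta> x\<close>. The coefficients with \<open>l > 0\<close> are reached by first applying, for \<open>a\<close>
  in the prime field, the automorphism that fixes \<open>g\<close> and \<open>h\<close> and sends \<open>x\<close> to \<open>x + a\<close>: for
  given \<open>i, j\<close> this produces the values of a polynomial of degree below \<open>p\<close> at \<open>p\<close> points
  (\<open>coords_determine\<close>). These automorphisms are convolutions with characters, hence they act on
  grouplike and skew primitive elements in an obvious way.
\<close>

section \<open>Algebras over a field and linear maps\<close>

text \<open>
  Noncommutative algebras as a locale on top of \<open>ring\<close>, so that ring reasoning applies directly.
\<close>

locale k_alg =
  fixes A :: "('k::field, 'a, 'm) module_scheme" (structure)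
  assumes k_algebra: "k_algebra A"

sublocale k_alg \<subseteq> ring A
  using k_algebra by (simp add: k_algebra_def)

context k_alg
begin

lemma module_axioms': "module (ring_of_type_algebra :: 'k ring) A"
  using k_algebra by (simp add: k_algebra_def)

lemma smult_closed [simp, intro]: "a \<in> carrier A \<Longrightarrow> c \<odot> a \<in> carrier A"
  using module.smult_closed[OF module_axioms'] by (simp add: ring_of_type_algebra_def)

lemma smult_add_left: "a \<in> carrier A \<Longrightarrow> (c + d) \<odot> a = c \<odot> a \<oplus> d \<odot> a"
  using module.smult_l_distr[OF module_axioms'] by (simp add: ring_of_type_algebra_def)

lemma smult_add_right:
  "a \<in> carrier A \<Longrightarrow> b \<in> carrier A \<Longrightarrow> c \<odot> (a \<oplus> b) = c \<odot> a \<oplus> c \<odot> b"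
  using module.smult_r_distr[OF module_axioms'] by (simp add: ring_of_type_algebra_def)

lemma smult_smult: "a \<in> carrier A \<Longrightarrow> c \<odot> (d \<odot> a) = (c * d) \<odot> a"
  using module.smult_assoc1[OF module_axioms'] by (simp add: ring_of_type_algebra_def)

lemma smult_one [simp]: "a \<in> carrier A \<Longrightarrow> 1 \<odot> a = a"
  using module.smult_one[OF module_axioms'] by (simp add: ring_of_type_algebra_def)

lemma smult_zero_left [simp]: "a \<in> carrier A \<Longrightarrow> 0 \<odot> a = \<zero>"
  using module.smult_l_null[OF module_axioms'] by (simp add: ring_of_type_algebra_def)

lemma smult_zero_right [simp]: "c \<odot> \<zero> = \<zero>"
  using module.smult_r_null[OF module_axioms'] by (simp add: ring_of_type_algebra_def)

lemma smult_mult_left: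
  "a \<in> carrier A \<Longrightarrow> b \<in> carrier A \<Longrightarrow> (c \<odot> a) \<otimes> b = c \<odot> (a \<otimes> b)"
  using k_algebra by (simp add: k_algebra_def)

lemma smult_mult_right:
  "a \<in> carrier A \<Longrightarrow> b \<in> carrier A \<Longrightarrow> a \<otimes> (c \<odot> b) = c \<odot> (a \<otimes> b)"
  using k_algebra by (simp add: k_algebra_def)

lemma smult_minus_one: "a \<in> carrier A \<Longrightarrow> (- 1) \<odot> a = \<ominus> a"
  by (metis add.inv_equality add.inv_closed smult_add_left smult_closed smult_one smult_zero_left
      ab_left_minus)

lemma smult_minus: "a \<in> carrier A \<Longrightarrow> b \<in> carrier A \<Longrightarrow> c \<odot> (a \<ominus> b) = c \<odot> a \<ominus> c \<odot> b"
  using smult_minus_one[of "c \<odot> b"] smult_minus_one[of b]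
  by (metis (no_types) minus_eq smult_add_right smult_smult smult_closed add.inv_closed mult.commute)

end

lemma (in ring) add_diff_diff_self: "a \<in> carrier R \<Longrightarrow> b \<in> carrier R \<Longrightarrow> a \<oplus> b \<ominus> a \<ominus> b = \<zero>"
  using r_neg1[of a b] by (simp add: minus_eq a_assoc a_comm[of b] r_neg r_neg2 r_neg1)

lemma (in ring) diff_self: "a \<in> carrier R \<Longrightarrow> a \<ominus> a = \<zero>"
  by (simp add: minus_eq r_neg)

lemma k_algebraI:
  assumes "ring A"
    and "\<And>c a. a \<in> carrier A \<Longrightarrow> c \<odot>\<^bsub>A\<^esub> a \<in> carrier A"
    and "\<And>c d a. a \<in> carrier A \<Longrightarrow> (c + d) \<odot>\<^bsub>A\<^esub> a = c \<odot>\<^bsub>A\<^esub> a \<oplus>\<^bsub>A\<^esub> d \<odot>\<^bsub>A\<^esub> a"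
    and "\<And>c a b. a \<in> carrier A \<Longrightarrow> b \<in> carrier A \<Longrightarrow> c \<odot>\<^bsub>A\<^esub> (a \<oplus>\<^bsub>A\<^esub> b) = c \<odot>\<^bsub>A\<^esub> a \<oplus>\<^bsub>A\<^esub> c \<odot>\<^bsub>A\<^esub> b"
    and "\<And>c d a. a \<in> carrier A \<Longrightarrow> (c * d) \<odot>\<^bsub>A\<^esub> a = c \<odot>\<^bsub>A\<^esub> (d \<odot>\<^bsub>A\<^esub> a)"
    and "\<And>a. a \<in> carrier A \<Longrightarrow> (1 :: 'k::field) \<odot>\<^bsub>A\<^esub> a = a"
    and "\<And>c a b. a \<in> carrier A \<Longrightarrow> b \<in> carrier A \<Longrightarrow> (c \<odot>\<^bsub>A\<^esub> a) \<otimes>\<^bsub>A\<^esub> b = c \<odot>\<^bsub>A\<^esub> (a \<otimes>\<^bsub>A\<^esub> b)"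
    and "\<And>c a b. a \<in> carrier A \<Longrightarrow> b \<in> carrier A \<Longrightarrow> a \<otimes>\<^bsub>A\<^esub> (c \<odot>\<^bsub>A\<^esub> b) = c \<odot>\<^bsub>A\<^esub> (a \<otimes>\<^bsub>A\<^esub> b)"
  shows "k_algebra A"
  unfolding k_algebra_def
proof (intro conjI allI ballI)
  show "module (ring_of_type_algebra :: 'k ring) A"
    by (rule moduleI) (use assms cring_from_type_algebra ring.is_abelian_group in \<open>auto simp: ring_of_type_algebra_def\<close>)
qed (use assms in auto)

definition linear_map ::
    "('k, 'a, 'm) module_scheme \<Rightarrow> ('k, 'b, 'n) module_scheme \<Rightarrow> ('a \<Rightarrow> 'b) \<Rightarrow> bool" where
  "linear_map A B f \<longleftrightarrow> f \<in> carrier A \<rightarrow> carrier B \<and>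
     (\<forall>a\<in>carrier A. \<forall>b\<in>carrier A. f (a \<oplus>\<^bsub>A\<^esub> b) = f a \<oplus>\<^bsub>B\<^esub> f b) \<and>
     (\<forall>c. \<forall>a\<in>carrier A. f (c \<odot>\<^bsub>A\<^esub> a) = c \<odot>\<^bsub>B\<^esub> f a)"

lemma linear_mapD:
  assumes "linear_map A B f"
  shows "a \<in> carrier A \<Longrightarrow> f a \<in> carrier B"
    and "a \<in> carrier A \<Longrightarrow> b \<in> carrier A \<Longrightarrow> f (a \<oplus>\<^bsub>A\<^esub> b) = f a \<oplus>\<^bsub>B\<^esub> f b"
    and "a \<in> carrier A \<Longrightarrow> f (c \<odot>\<^bsub>A\<^esub> a) = c \<odot>\<^bsub>B\<^esub> f a"
  using assms by (auto simp: linear_map_def)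

lemma linear_mapI:
  assumes "\<And>a. a \<in> carrier A \<Longrightarrow> f a \<in> carrier B"
    and "\<And>a b. a \<in> carrier A \<Longrightarrow> b \<in> carrier A \<Longrightarrow> f (a \<oplus>\<^bsub>A\<^esub> b) = f a \<oplus>\<^bsub>B\<^esub> f b"
    and "\<And>c a. a \<in> carrier A \<Longrightarrow> f (c \<odot>\<^bsub>A\<^esub> a) = c \<odot>\<^bsub>B\<^esub> f a"
  shows "linear_map A B f"
  using assms by (auto simp: linear_map_def)

lemma linear_map_compose:
  "linear_map A B f \<Longrightarrow> linear_map B C g \<Longrightarrow> linear_map A C (\<lambda>a. g (f a))"
  by (auto simp: linear_map_def Pi_iff)

lemma linear_map_id: "linear_map A A (\<lambda>a. a)"
  by (auto simp: linear_map_def)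

lemma linear_map_zero:
  assumes "k_algebra A" "k_algebra B" "linear_map A B f"
  shows "f \<zero>\<^bsub>A\<^esub> = \<zero>\<^bsub>B\<^esub>"
proof -
  interpret A: k_alg A by (rule k_alg.intro) fact
  interpret B: k_alg B by (rule k_alg.intro) fact
  show ?thesis
    using linear_mapD(3)[OF assms(3), of "\<zero>\<^bsub>A\<^esub>" 0] linear_mapD(1)[OF assms(3), of "\<zero>\<^bsub>A\<^esub>"] by simp
qed

lemma linear_map_minus:
  assumes "k_algebra A" "k_algebra B" "linear_map A B f" "a \<in> carrier A" "b \<in> carrier A"
  shows "f (a \<ominus>\<^bsub>A\<^esub> b) = f a \<ominus>\<^bsub>B\<^esub> f b"
proof -
  interpret A: k_alg A by (rule k_alg.intro) fact
  interpret B: k_alg B by (rule k_alg.intro) fact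
  have "f (a \<oplus>\<^bsub>A\<^esub> (- 1) \<odot>\<^bsub>A\<^esub> b) = f a \<oplus>\<^bsub>B\<^esub> (- 1) \<odot>\<^bsub>B\<^esub> f b"
    using assms by (simp add: linear_mapD[OF assms(3)])
  then show ?thesis
    using assms by (simp add: A.minus_eq B.minus_eq A.smult_minus_one B.smult_minus_one linear_mapD[OF assms(3)])
qed

lemma linear_map_finsum:
  assumes "k_algebra A" "k_algebra B" "linear_map A B f" "finite S" "h \<in> S \<rightarrow> carrier A"
  shows "f (\<Oplus>\<^bsub>A\<^esub>s\<in>S. h s) = (\<Oplus>\<^bsub>B\<^esub>s\<in>S. f (h s))"
proof -
  interpret A: k_alg A by (rule k_alg.intro) fact
  interpret B: k_alg B by (rule k_alg.intro) fact
  show ?thesis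
    using assms(4,5)
  proof (induction S rule: finite_induct)
    case empty
    then show ?case by (simp add: linear_map_zero[OF assms(1-3)])
  next
    case (insert s S)
    have "(\<lambda>s. f (h s)) \<in> S \<rightarrow> carrier B"
      using insert linear_mapD(1)[OF assms(3)] by (auto simp: Pi_iff)
    then show ?case
      using insert linear_mapD(1)[OF assms(3)] by (simp add: Pi_iff linear_mapD[OF assms(3)])
  qed
qed

lemma k_algebra_hom_linear: "f \<in> k_algebra_hom A B \<Longrightarrow> linear_map A B f"
  by (auto simp: k_algebra_hom_def ring_hom_def linear_map_def)

lemma k_algebra_homD:
  assumes "f \<in> k_algebra_hom A B"
  shows "a \<in> carrier A \<Longrightarrow> f a \<in> carrier B"
    and "a \<in> carrier A \<Longrightarrow> b \<in> carrier A \<Longrightarrow> f (a \<oplus>\<^bsub>A\<^esub> b) = f a \<oplus>\<^bsub>B\<^esub> f b"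
    and "a \<in> carrier A \<Longrightarrow> f (c \<odot>\<^bsub>A\<^esub> a) = c \<odot>\<^bsub>B\<^esub> f a"
    and "a \<in> carrier A \<Longrightarrow> b \<in> carrier A \<Longrightarrow> f (a \<otimes>\<^bsub>A\<^esub> b) = f a \<otimes>\<^bsub>B\<^esub> f b"
    and "f \<one>\<^bsub>A\<^esub> = \<one>\<^bsub>B\<^esub>"
  using assms by (auto simp: k_algebra_hom_def ring_hom_def)

lemma k_algebra_homI:
  assumes "linear_map A B f"
    and "\<And>a b. a \<in> carrier A \<Longrightarrow> b \<in> carrier A \<Longrightarrow> f (a \<otimes>\<^bsub>A\<^esub> b) = f a \<otimes>\<^bsub>B\<^esub> f b"
    and "f \<one>\<^bsub>A\<^esub> = \<one>\<^bsub>B\<^esub>"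
  shows "f \<in> k_algebra_hom A B"
  using assms by (auto simp: k_algebra_hom_def ring_hom_def linear_map_def)

lemma k_algebra_hom_compose:
  "f \<in> k_algebra_hom A B \<Longrightarrow> g \<in> k_algebra_hom B C \<Longrightarrow> (\<lambda>a. g (f a)) \<in> k_algebra_hom A C"
  by (auto simp: k_algebra_hom_def ring_hom_def Pi_iff)

lemma k_algebra_hom_id: "(\<lambda>a. a) \<in> k_algebra_hom A A"
  by (auto simp: k_algebra_hom_def ring_hom_def)

lemma k_algebra_hom_pow:
  assumes "k_algebra A" "k_algebra B" "f \<in> k_algebra_hom A B" "a \<in> carrier A"
  shows "f (a [^]\<^bsub>A\<^esub> (m::nat)) = f a [^]\<^bsub>B\<^esub> m"
proof -
  interpret A: k_alg A by (rule k_alg.intro) fact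
  interpret B: k_alg B by (rule k_alg.intro) fact
  show ?thesis
    using assms by (induction m) (simp_all add: k_algebra_homD[OF assms(3)])
qed

section \<open>Linear extension from a basis\<close>

text \<open>
  The extension of \<open>f\<close> to formal combinations. On a quotient of such combinations, \<open>induced\<close> applies
  it to some representative; the two agree once the extension vanishes on what is divided out.
\<close>

definition linear_extension ::
    "('k::field, 'b, 'm) module_scheme \<Rightarrow> ('q \<Rightarrow> 'b) \<Rightarrow> ('q \<Rightarrow>\<^sub>0 'k) \<Rightarrow> 'b" where
  "linear_extension M f x =
     (\<Oplus>\<^bsub>M\<^esub>q\<in>Poly_Mapping.keys x. Poly_Mapping.lookup x q \<odot>\<^bsub>M\<^esub> f q)"

lemma induced_eq: "induced M f C = linear_extension M f (SOME x. x \<in> C)"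
  by (simp add: induced_def linear_extension_def Let_def)

lemma lookup_map_times [simp]:
  "Poly_Mapping.lookup (Poly_Mapping.map ((*) c) x) q = c * Poly_Mapping.lookup x (q :: 'q)" for c :: "'k::field"
  by (simp add: Poly_Mapping.map.rep_eq when_def)

lemma keys_map_times_subset: "Poly_Mapping.keys (Poly_Mapping.map ((*) (c::'k::field)) x) \<subseteq> Poly_Mapping.keys x"
  by (auto simp: in_keys_iff)

lemma keys_add_subset:
  "Poly_Mapping.keys x \<subseteq> Q \<Longrightarrow> Poly_Mapping.keys y \<subseteq> Q \<Longrightarrow> Poly_Mapping.keys (x + y) \<subseteq> Q"
  using keys_add[of x y] by blast

lemma keys_minus_subset:
  fixes x y :: "'q \<Rightarrow>\<^sub>0 'k::ab_group_add"
  shows "Poly_Mapping.keys x \<subseteq> Q \<Longrightarrow> Poly_Mapping.keys y \<subseteq> Q \<Longrightarrow> Poly_Mapping.keys (x - y) \<subseteq> Q"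
  using keys_diff[of x y] by blast

text \<open>
  The induction behind every computation with formal combinations: a statement about them that is
  additive need only be checked on scaled basis elements.
\<close>

lemma finite_support_induct [consumes 1, case_names zero single add]:
  fixes x :: "'q \<Rightarrow>\<^sub>0 'k::ab_group_add"
  assumes "Poly_Mapping.keys x \<subseteq> Q"
    and "P 0"
    and "\<And>q c. q \<in> Q \<Longrightarrow> P (Poly_Mapping.single q c)"
    and "\<And>x y. Poly_Mapping.keys x \<subseteq> Q \<Longrightarrow> Poly_Mapping.keys y \<subseteq> Q \<Longrightarrow> P x \<Longrightarrow> P y \<Longrightarrow> P (x + y)"
  shows "P x"
proof -
  have "P y \<and> Poly_Mapping.keys y \<subseteq> Q"
    if "y = (\<Sum>q\<in>S. Poly_Mapping.single q (Poly_Mapping.lookup x q))" "finite S" "S \<subseteq> Q" for S y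
    using that(2,3,1)
  proof (induction S arbitrary: y rule: finite_induct)
    case empty
    then show ?case using assms(2) by simp
  next
    case (insert q S)
    define u where "u = Poly_Mapping.single q (Poly_Mapping.lookup x q)"
    define z where "z = (\<Sum>q\<in>S. Poly_Mapping.single q (Poly_Mapping.lookup x q))"
    have u: "P u" "Poly_Mapping.keys u \<subseteq> Q"
      using insert.prems assms(3) by (auto simp: u_def)
    have z: "P z" "Poly_Mapping.keys z \<subseteq> Q"
      using insert.IH insert.prems z_def by auto
    have "y = u + z"
      using insert by (simp add: u_def z_def)
    then show ?case
      using assms(4)[OF u(2) z(2) u(1) z(1)] keys_add[of u z] u(2) z(2) by auto
  qed
  moreover have "x = (\<Sum>q\<in>Poly_Mapping.keys x. Poly_Mapping.single q (Poly_Mapping.lookup x q))"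
  proof (rule poly_mapping_eqI)
    fix r
    have "(\<Sum>q\<in>Poly_Mapping.keys x. Poly_Mapping.lookup x q when q = r) =
        (if r \<in> Poly_Mapping.keys x then Poly_Mapping.lookup x r else 0)"
      unfolding when_def by (rule sum.delta) simp
    then show "Poly_Mapping.lookup x r =
        Poly_Mapping.lookup (\<Sum>q\<in>Poly_Mapping.keys x. Poly_Mapping.single q (Poly_Mapping.lookup x q)) r"
      by (simp add: lookup_sum lookup_single not_in_keys_iff_lookup_eq_zero split: if_splits)
  qed
  ultimately show ?thesis
    using assms(1) finite_keys by blast
qed

context k_alg
begin

lemma linear_extension_superset:
  assumes "Poly_Mapping.keys x \<subseteq> S" "finite S" "f \<in> S \<rightarrow> carrier A"
  shows "linear_extension A f x = (\<Oplus>q\<in>S. Poly_Mapping.lookup x q \<odot> f q)"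
  unfolding linear_extension_def
proof (rule add.finprod_mono_neutral_cong_left)
  show "\<And>i. i \<in> S - Poly_Mapping.keys x \<Longrightarrow> Poly_Mapping.lookup x i \<odot> f i = \<zero>"
    using assms by (auto simp: in_keys_iff Pi_iff)
qed (use assms in auto)

lemma linear_extension_closed:
  assumes "f \<in> Poly_Mapping.keys x \<rightarrow> carrier A"
  shows "linear_extension A f x \<in> carrier A"
  unfolding linear_extension_def using assms by (intro finsum_closed) auto

lemma linear_extension_add:
  assumes "f \<in> Poly_Mapping.keys x \<union> Poly_Mapping.keys y \<rightarrow> carrier A"
  shows "linear_extension A f (x + y) = linear_extension A f x \<oplus> linear_extension A f y"
proof -
  let ?S = "Poly_Mapping.keys x \<union> Poly_Mapping.keys y"
  have "linear_extension A f (x + y) = (\<Oplus>q\<in>?S. Poly_Mapping.lookup (x + y) q \<odot> f q)"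
    by (rule linear_extension_superset) (use assms keys_add[of x y] in auto)
  also have "\<dots> = (\<Oplus>q\<in>?S. Poly_Mapping.lookup x q \<odot> f q \<oplus> Poly_Mapping.lookup y q \<odot> f q)"
    using assms by (intro finsum_cong') (auto simp: lookup_add smult_add_left Pi_iff)
  also have "\<dots> = (\<Oplus>q\<in>?S. Poly_Mapping.lookup x q \<odot> f q) \<oplus> (\<Oplus>q\<in>?S. Poly_Mapping.lookup y q \<odot> f q)"
    using assms by (intro finsum_addf) auto
  also have "\<dots> = linear_extension A f x \<oplus> linear_extension A f y"
    using assms by (simp add: linear_extension_superset[of _ ?S])
  finally show ?thesis .
qed

lemma linear_extension_single [simp]:
  assumes "f q \<in> carrier A"
  shows "linear_extension A f (Poly_Mapping.single q c) = c \<odot> f q"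
proof -
  have "linear_extension A f (Poly_Mapping.single q c) =
      (\<Oplus>r\<in>{q}. Poly_Mapping.lookup (Poly_Mapping.single q c) r \<odot> f r)"
    by (rule linear_extension_superset) (use assms in auto)
  then show ?thesis
    using assms by (simp add: Pi_iff)
qed

lemma linear_extension_zero [simp]: "linear_extension A f 0 = \<zero>"
  by (simp add: linear_extension_def)

lemma linear_extension_scale:
  assumes "f \<in> Poly_Mapping.keys x \<rightarrow> carrier A"
  shows "linear_extension A f (Poly_Mapping.map ((*) c) x) = c \<odot> linear_extension A f x"
proof -
  let ?S = "Poly_Mapping.keys x"
  have "linear_extension A f (Poly_Mapping.map ((*) c) x) =
      (\<Oplus>q\<in>?S. Poly_Mapping.lookup (Poly_Mapping.map ((*) c) x) q \<odot> f q)"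
    by (rule linear_extension_superset) (use assms keys_map_times_subset[of c x] in auto)
  also have "\<dots> = (\<Oplus>q\<in>?S. c \<odot> (Poly_Mapping.lookup x q \<odot> f q))"
    using assms by (intro finsum_cong') (auto simp: smult_smult Pi_iff)
  also have "\<dots> = c \<odot> linear_extension A f x"
    unfolding linear_extension_def
    using linear_map_finsum[OF k_algebra k_algebra, of "\<lambda>a. c \<odot> a" ?S "\<lambda>q. Poly_Mapping.lookup x q \<odot> f q"] assms
    by (auto simp: linear_map_def smult_add_right smult_smult mult.commute Pi_iff)
  finally show ?thesis .
qed

end

section \<open>Monoid algebras\<close>

lemma monoid_algebra_simps [simp]:
  "carrier (monoid_algebra M) = {x. Poly_Mapping.keys x \<subseteq> carrier M}"
  "\<one>\<^bsub>monoid_algebra M\<^esub> = Poly_Mapping.single \<one>\<^bsub>M\<^esub> 1"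
  "\<zero>\<^bsub>monoid_algebra M\<^esub> = 0"
  "x \<oplus>\<^bsub>monoid_algebra M\<^esub> y = x + y"
  "c \<odot>\<^bsub>monoid_algebra M\<^esub> x = Poly_Mapping.map ((*) c) x"
  by (simp_all add: monoid_algebra_def)

lemma monoid_algebra_mult_superset:
  assumes "Poly_Mapping.keys x \<subseteq> S" "Poly_Mapping.keys y \<subseteq> T" "finite S" "finite T"
  shows "x \<otimes>\<^bsub>monoid_algebra M\<^esub> y =
    (\<Sum>a\<in>S. \<Sum>b\<in>T. Poly_Mapping.single (a \<otimes>\<^bsub>M\<^esub> b) (Poly_Mapping.lookup x a * Poly_Mapping.lookup y b))"
proof -
  have "(\<Sum>b\<in>Poly_Mapping.keys y. Poly_Mapping.single (a \<otimes>\<^bsub>M\<^esub> b) (Poly_Mapping.lookup x a * Poly_Mapping.lookup y b)) =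
        (\<Sum>b\<in>T. Poly_Mapping.single (a \<otimes>\<^bsub>M\<^esub> b) (Poly_Mapping.lookup x a * Poly_Mapping.lookup y b))" for a
    using assms by (intro sum.mono_neutral_left) (auto simp: in_keys_iff)
  then have "x \<otimes>\<^bsub>monoid_algebra M\<^esub> y = (\<Sum>a\<in>Poly_Mapping.keys x. \<Sum>b\<in>T.
      Poly_Mapping.single (a \<otimes>\<^bsub>M\<^esub> b) (Poly_Mapping.lookup x a * Poly_Mapping.lookup y b))"
    by (simp add: monoid_algebra_def)
  also have "\<dots> = (\<Sum>a\<in>S. \<Sum>b\<in>T. Poly_Mapping.single (a \<otimes>\<^bsub>M\<^esub> b) (Poly_Mapping.lookup x a * Poly_Mapping.lookup y b))"
    using assms by (intro sum.mono_neutral_left) (auto simp: in_keys_iff intro!: sum.neutral)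
  finally show ?thesis .
qed

lemma monoid_algebra_mult_add_left:
  "(x + y) \<otimes>\<^bsub>monoid_algebra M\<^esub> z = x \<otimes>\<^bsub>monoid_algebra M\<^esub> z + y \<otimes>\<^bsub>monoid_algebra M\<^esub> z"
proof -
  let ?S = "Poly_Mapping.keys x \<union> Poly_Mapping.keys y"
  have "Poly_Mapping.keys (x + y) \<subseteq> ?S" by (rule keys_add)
  then show ?thesis
    by (simp add: monoid_algebra_mult_superset[of _ ?S _ "Poly_Mapping.keys z"] lookup_add
        distrib_right single_add sum.distrib)
qed

lemma monoid_algebra_mult_add_right:
  "z \<otimes>\<^bsub>monoid_algebra M\<^esub> (x + y) = z \<otimes>\<^bsub>monoid_algebra M\<^esub> x + z \<otimes>\<^bsub>monoid_algebra M\<^esub> y"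
proof -
  let ?S = "Poly_Mapping.keys x \<union> Poly_Mapping.keys y"
  have "Poly_Mapping.keys (x + y) \<subseteq> ?S" by (rule keys_add)
  then show ?thesis
    by (simp add: monoid_algebra_mult_superset[of _ "Poly_Mapping.keys z" _ ?S] lookup_add
        distrib_left single_add sum.distrib)
qed

lemma monoid_algebra_mult_zero [simp]:
  "0 \<otimes>\<^bsub>monoid_algebra M\<^esub> x = 0" "x \<otimes>\<^bsub>monoid_algebra M\<^esub> 0 = 0"
  by (simp_all add: monoid_algebra_def)

lemma monoid_algebra_mult_single [simp]:
  "Poly_Mapping.single a c \<otimes>\<^bsub>monoid_algebra M\<^esub> Poly_Mapping.single b d =
     Poly_Mapping.single (a \<otimes>\<^bsub>M\<^esub> b) (c * d)"
  by (simp add: monoid_algebra_mult_superset[of _ "{a}" _ "{b}"])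

lemma map_times_add: "Poly_Mapping.map ((*) (c::'k::field)) (x + y) = Poly_Mapping.map ((*) c) x + Poly_Mapping.map ((*) c) y"
  by (rule poly_mapping_eqI) (simp add: lookup_add distrib_left)

lemma map_times_single: "Poly_Mapping.map ((*) (c::'k::field)) (Poly_Mapping.single q d) = Poly_Mapping.single q (c * d)"
  by (rule poly_mapping_eqI) (simp add: lookup_single when_def)

lemma map_times_zero: "Poly_Mapping.map ((*) (c::'k::field)) 0 = 0"
  by (rule poly_mapping_eqI) simp

lemma k_algebra_monoid_algebra:
  assumes "Group.monoid M"
  shows "k_algebra (monoid_algebra M :: ('k::field, _) module)"
proof (rule k_algebraI)
  interpret M: Group.monoid M by fact
  let ?F = "monoid_algebra M :: ('k, _) module"
  have closed: "Poly_Mapping.keys (x \<otimes>\<^bsub>?F\<^esub> y) \<subseteq> carrier M"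
    if "Poly_Mapping.keys x \<subseteq> carrier M" "Poly_Mapping.keys y \<subseteq> carrier M" for x y :: "_ \<Rightarrow>\<^sub>0 'k"
    using that(1)
  proof (induction x rule: finite_support_induct)
    case (single a c)
    show ?case
      using that(2)
    proof (induction y rule: finite_support_induct)
      case (add y z)
      then show ?case by (simp add: monoid_algebra_mult_add_right keys_add_subset)
    qed (use single in auto)
  next
    case (add x z)
    then show ?case by (simp add: monoid_algebra_mult_add_left keys_add_subset)
  qed auto
  have assoc: "(x \<otimes>\<^bsub>?F\<^esub> y) \<otimes>\<^bsub>?F\<^esub> z = x \<otimes>\<^bsub>?F\<^esub> (y \<otimes>\<^bsub>?F\<^esub> z)"
    if "Poly_Mapping.keys x \<subseteq> carrier M" "Poly_Mapping.keys y \<subseteq> carrier M" "Poly_Mapping.keys z \<subseteq> carrier M"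
    for x y z :: "_ \<Rightarrow>\<^sub>0 'k"
    using that(1)
  proof (induction x rule: finite_support_induct)
    case (single a c)
    note a = single
    show ?case
      using that(2)
    proof (induction y rule: finite_support_induct)
      case (single b d)
      show ?case
        using that(3)
        by (induction z rule: finite_support_induct)
           (use a single in \<open>simp_all add: monoid_algebra_mult_add_left monoid_algebra_mult_add_right
               M.m_assoc mult.assoc\<close>)
    qed (simp_all add: monoid_algebra_mult_add_left monoid_algebra_mult_add_right)
  qed (simp_all add: monoid_algebra_mult_add_left monoid_algebra_mult_add_right)
  have one: "Poly_Mapping.single \<one>\<^bsub>M\<^esub> 1 \<otimes>\<^bsub>?F\<^esub> x = x" "x \<otimes>\<^bsub>?F\<^esub> Poly_Mapping.single \<one>\<^bsub>M\<^esub> 1 = x"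
    if "Poly_Mapping.keys x \<subseteq> carrier M" for x :: "_ \<Rightarrow>\<^sub>0 'k"
    using that by (induction x rule: finite_support_induct)
      (simp_all add: monoid_algebra_mult_add_left monoid_algebra_mult_add_right)
  show "ring ?F"
  proof (rule ringI)
    show "abelian_group ?F"
    proof (rule abelian_groupI)
      fix x assume "x \<in> carrier ?F"
      then show "\<exists>y\<in>carrier ?F. y \<oplus>\<^bsub>?F\<^esub> x = \<zero>\<^bsub>?F\<^esub>"
        by (intro bexI[of _ "- x"]) auto
    next
      fix x y assume "x \<in> carrier ?F" "y \<in> carrier ?F"
      then show "x \<oplus>\<^bsub>?F\<^esub> y \<in> carrier ?F"
        using keys_add[of x y] by auto
    qed (auto simp: add_ac)
    show "Group.monoid ?F"
      by (rule monoidI) (use closed assoc one in auto)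
  qed (simp_all add: monoid_algebra_mult_add_left monoid_algebra_mult_add_right)

  fix c d :: 'k
  have scale_left: "Poly_Mapping.map ((*) c) x \<otimes>\<^bsub>?F\<^esub> y = Poly_Mapping.map ((*) c) (x \<otimes>\<^bsub>?F\<^esub> y)"
    if "Poly_Mapping.keys x \<subseteq> carrier M" "Poly_Mapping.keys y \<subseteq> carrier M" for x y :: "_ \<Rightarrow>\<^sub>0 'k"
    using that(1)
  proof (induction x rule: finite_support_induct)
    case (single a d)
    show ?case
      using that(2)
      by (induction y rule: finite_support_induct)
         (simp_all add: monoid_algebra_mult_add_right map_times_single map_times_add map_times_zero mult.assoc)
  qed (simp_all add: monoid_algebra_mult_add_left map_times_add map_times_zero)
  have scale_right: "x \<otimes>\<^bsub>?F\<^esub> Poly_Mapping.map ((*) c) y = Poly_Mapping.map ((*) c) (x \<otimes>\<^bsub>?F\<^esub> y)"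
    if "Poly_Mapping.keys x \<subseteq> carrier M" "Poly_Mapping.keys y \<subseteq> carrier M" for x y :: "_ \<Rightarrow>\<^sub>0 'k"
    using that(1)
  proof (induction x rule: finite_support_induct)
    case (single a d)
    show ?case
      using that(2)
      by (induction y rule: finite_support_induct)
         (simp_all add: monoid_algebra_mult_add_right map_times_single map_times_add map_times_zero
           mult.assoc mult.left_commute)
  qed (simp_all add: monoid_algebra_mult_add_left map_times_add map_times_zero)
  fix a b assume a: "a \<in> carrier ?F"
  show "c \<odot>\<^bsub>?F\<^esub> a \<in> carrier ?F"
    using a order_trans[OF keys_map_times_subset[of c a]] by simp
  show "(c + d) \<odot>\<^bsub>?F\<^esub> a = c \<odot>\<^bsub>?F\<^esub> a \<oplus>\<^bsub>?F\<^esub> d \<odot>\<^bsub>?F\<^esub> a"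
    by (simp, rule poly_mapping_eqI) (simp add: lookup_add distrib_right)
  show "(c * d) \<odot>\<^bsub>?F\<^esub> a = c \<odot>\<^bsub>?F\<^esub> (d \<odot>\<^bsub>?F\<^esub> a)"
    by (simp, rule poly_mapping_eqI) (simp add: mult.assoc)
  show "1 \<odot>\<^bsub>?F\<^esub> a = a"
    by (simp, rule poly_mapping_eqI) simp
  assume b: "b \<in> carrier ?F"
  show "c \<odot>\<^bsub>?F\<^esub> (a \<oplus>\<^bsub>?F\<^esub> b) = c \<odot>\<^bsub>?F\<^esub> a \<oplus>\<^bsub>?F\<^esub> c \<odot>\<^bsub>?F\<^esub> b"
    by (simp add: map_times_add)
  show "(c \<odot>\<^bsub>?F\<^esub> a) \<otimes>\<^bsub>?F\<^esub> b = c \<odot>\<^bsub>?F\<^esub> (a \<otimes>\<^bsub>?F\<^esub> b)"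
    using scale_left a b by simp
  show "a \<otimes>\<^bsub>?F\<^esub> (c \<odot>\<^bsub>?F\<^esub> b) = c \<odot>\<^bsub>?F\<^esub> (a \<otimes>\<^bsub>?F\<^esub> b)"
    using scale_right a b by simp
qed

lemma monoid_algebra_mult_diff:
  "(x - y) \<otimes>\<^bsub>monoid_algebra M\<^esub> z = x \<otimes>\<^bsub>monoid_algebra M\<^esub> z - y \<otimes>\<^bsub>monoid_algebra M\<^esub> z"
  "z \<otimes>\<^bsub>monoid_algebra M\<^esub> (x - y) = z \<otimes>\<^bsub>monoid_algebra M\<^esub> x - z \<otimes>\<^bsub>monoid_algebra M\<^esub> y"
  using monoid_algebra_mult_add_left[where x="x - y" and y=y and z=z and M=M] monoid_algebra_mult_add_right[where x="x - y" and y=y and z=z and M=M]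
  by (simp_all add: algebra_simps)

lemma linear_extension_linear:
  fixes M :: "('k::field, 'b, 'm) module_scheme"
  assumes "k_algebra M" "f \<in> carrier N \<rightarrow> carrier M"
  shows "linear_map (monoid_algebra N) M (linear_extension M f)"
proof -
  interpret M: k_alg M by (rule k_alg.intro) fact
  show ?thesis
    by (rule linear_mapI)
       (use assms(2) in \<open>auto simp: Pi_iff intro!: M.linear_extension_closed M.linear_extension_add
          M.linear_extension_scale\<close>)
qed

text \<open>
  Multiplicativity on the basis suffices, since both sides of the product rule are bilinear.
\<close>

lemma linear_extension_hom:
  fixes M :: "('k::field, 'b, 'm) module_scheme"
  assumes "k_algebra M" "Group.monoid N" "f \<in> carrier N \<rightarrow> carrier M"
    and mult: "\<And>a b. a \<in> carrier N \<Longrightarrow> b \<in> carrier N \<Longrightarrow> f (a \<otimes>\<^bsub>N\<^esub> b) = f a \<otimes>\<^bsub>M\<^esub> f b"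
    and one: "f \<one>\<^bsub>N\<^esub> = \<one>\<^bsub>M\<^esub>"
  shows "linear_extension M f \<in> k_algebra_hom (monoid_algebra N) M"
proof (rule k_algebra_homI)
  interpret M: k_alg M by (rule k_alg.intro) fact
  interpret N: Group.monoid N by fact
  have F: "k_algebra (monoid_algebra N :: ('k, _) module)"
    by (rule k_algebra_monoid_algebra) fact
  interpret F: k_alg "monoid_algebra N :: ('k, _) module" by (rule k_alg.intro) fact
  show lin: "linear_map (monoid_algebra N) M (linear_extension M f)"
    by (rule linear_extension_linear) fact+
  note [simp] = linear_mapD[OF lin, simplified] F.m_closed[simplified]
  have f: "\<And>a. a \<in> carrier N \<Longrightarrow> f a \<in> carrier M" using assms(3) by auto
  fix x y :: "_ \<Rightarrow>\<^sub>0 'k"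
  assume "x \<in> carrier (monoid_algebra N)" and y: "y \<in> carrier (monoid_algebra N)"
  then have "Poly_Mapping.keys x \<subseteq> carrier N" by simp
  then show "linear_extension M f (x \<otimes>\<^bsub>monoid_algebra N\<^esub> y) = linear_extension M f x \<otimes>\<^bsub>M\<^esub> linear_extension M f y"
  proof (induction x rule: finite_support_induct)
    case (single a c)
    have "Poly_Mapping.keys y \<subseteq> carrier N" using y by simp
    then show ?case
    proof (induction y rule: finite_support_induct)
      case (single b d)
      then show ?case
        using \<open>a \<in> carrier N\<close>
        by (simp add: f mult M.smult_mult_left M.smult_mult_right M.smult_smult mult.commute)
    next
      case (add y z)
      have "Poly_Mapping.keys (Poly_Mapping.single a c) \<subseteq> carrier N"
        using \<open>a \<in> carrier N\<close> by simp
      then show ?case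
        using add \<open>a \<in> carrier N\<close> by (simp add: monoid_algebra_mult_add_right f M.r_distr)
    qed (use \<open>a \<in> carrier N\<close> in \<open>simp add: f\<close>)
  next
    case (add x z)
    then show ?case
      using y by (simp add: monoid_algebra_mult_add_left M.l_distr)
  qed (use y in simp)
qed (use assms in \<open>simp add: k_alg.intro k_alg.linear_extension_single Group.monoid.one_closed Pi_iff
      ring.ring_simprules(6) k_algebra_def k_alg.smult_one\<close>)

section \<open>Quotient algebras\<close>

text \<open>
  Quotient algebras are records that extend the ring record, and being a ring only concerns the
  ring operations; this moves the ring axioms between such records.
\<close>

lemma ring_cong:
  assumes "ring R" "carrier S = carrier R" "monoid.mult S = monoid.mult R" "\<one>\<^bsub>S\<^esub> = \<one>\<^bsub>R\<^esub>" "\<zero>\<^bsub>S\<^esub> = \<zero>\<^bsub>R\<^esub>" "add S = add R"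
  shows "ring S"
proof -
  interpret R: ring R by fact
  show ?thesis
    by (intro ringI abelian_groupI monoidI)
       (use assms(2-) in \<open>auto simp: R.a_ac R.m_assoc R.l_distr R.r_distr intro: R.add.l_inv_ex\<close>)
qed

lemma quotient_algebra_simps:
  "carrier (quotient_algebra A I) = a_rcosets\<^bsub>A\<^esub> I"
  "\<one>\<^bsub>quotient_algebra A I\<^esub> = I +>\<^bsub>A\<^esub> \<one>\<^bsub>A\<^esub>"
  "\<zero>\<^bsub>quotient_algebra A I\<^esub> = I"
  "monoid.mult (quotient_algebra A I) = rcoset_mult A I"
  "add (quotient_algebra A I) = set_add A"
  "module.smult (quotient_algebra A I) = (\<lambda>c C. \<Union>x\<in>C. I +>\<^bsub>A\<^esub> (c \<odot>\<^bsub>A\<^esub> x))"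
  by (simp_all add: quotient_algebra_def FactRing_def ring.defs module.defs)

locale k_quotient = k_alg A + ideal I A for A :: "('k::field, 'a, 'm) module_scheme" (structure) and I
begin

lemma quotient_carrier: "carrier (quotient_algebra A I) = (\<lambda>a. I +> a) ` carrier A"
  by (auto simp: quotient_algebra_simps A_RCOSETS_def')

lemma coset_eq_iff: "a \<in> carrier A \<Longrightarrow> b \<in> carrier A \<Longrightarrow> I +> a = I +> b \<longleftrightarrow> a \<ominus> b \<in> I"
proof -
  assume ab: "a \<in> carrier A" "b \<in> carrier A"
  have "I +> a = I +> b \<longleftrightarrow> a \<in> I +> b"
  proof
    assume "I +> a = I +> b"
    then show "a \<in> I +> b" using a_rcos_self[OF ab(1)] by (rule subst)
  next
    assume "a \<in> I +> b"
    from a_repr_independence[OF this ab(2) a_subgroup] show "I +> a = I +> b" by (rule sym)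
  qed
  then show ?thesis
    using a_rcos_module_minus[OF ring_axioms ab(2,1)] by (rule trans)
qed

lemma ideal_smult: "a \<in> I \<Longrightarrow> c \<odot> a \<in> I"
  using I_l_closed[of a "c \<odot> \<one>"] a_Hcarr[of a] by (simp add: smult_mult_left)

lemma coset_smult: "a \<in> carrier A \<Longrightarrow> c \<odot>\<^bsub>quotient_algebra A I\<^esub> (I +> a) = I +> (c \<odot> a)"
proof -
  assume a: "a \<in> carrier A"
  have "I +> c \<odot> x = I +> c \<odot> a" if x: "x \<in> I +> a" for x
  proof -
    have xc: "x \<in> carrier A" using x a a_elemrcos_carrier by blast
    have "x \<ominus> a \<in> I" using x a xc a_rcos_module_minus[OF ring_axioms] by blast
    then have "c \<odot> x \<ominus> c \<odot> a \<in> I"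
      using ideal_smult[of "x \<ominus> a" c] a xc by (simp add: smult_minus)
    then show ?thesis using a xc by (simp add: coset_eq_iff)
  qed
  then have "(\<Union>x\<in>I +> a. I +> c \<odot> x) = (\<Union>x\<in>I +> a. I +> c \<odot> a)"
    by (intro SUP_cong refl)
  also have "\<dots> = I +> c \<odot> a"
    using a_rcos_self[OF a] by (intro cSUP_const) blast
  finally show ?thesis by (simp add: quotient_algebra_simps)
qed

lemma coset_add: "a \<in> carrier A \<Longrightarrow> b \<in> carrier A \<Longrightarrow>
    (I +> a) \<oplus>\<^bsub>quotient_algebra A I\<^esub> (I +> b) = I +> (a \<oplus> b)"
  by (simp add: quotient_algebra_simps a_rcos_sum)

lemma coset_mult: "a \<in> carrier A \<Longrightarrow> b \<in> carrier A \<Longrightarrow>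
    (I +> a) \<otimes>\<^bsub>quotient_algebra A I\<^esub> (I +> b) = I +> (a \<otimes> b)"
  by (simp add: quotient_algebra_simps rcoset_mult_add)

lemma coset_one: "\<one>\<^bsub>quotient_algebra A I\<^esub> = I +> \<one>"
  by (simp add: quotient_algebra_simps)

lemma k_algebra_quotient: "k_algebra (quotient_algebra A I)"
proof (rule k_algebraI)
  show "ring (quotient_algebra A I)"
    by (rule ring_cong[OF quotient_is_ring]) (simp_all add: quotient_algebra_simps FactRing_def)
qed (auto simp: quotient_carrier coset_smult coset_add coset_mult smult_add_left smult_add_right
       smult_smult smult_mult_left smult_mult_right)

lemma coset_hom: "(\<lambda>a. I +> a) \<in> k_algebra_hom A (quotient_algebra A I)"
  by (auto simp: k_algebra_hom_def ring_hom_def quotient_carrier coset_smult coset_add coset_mult coset_one)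

end

text \<open>
  Two representatives of a class differ by an element of \<open>I\<close>, on which the extension vanishes; so the
  choice that is built into \<open>induced\<close> is harmless.
\<close>

lemma induced_coset:
  fixes M :: "('k::field, 'b, 'm) module_scheme"
  assumes "k_algebra M" "Group.monoid N" "ideal I (monoid_algebra N)" "f \<in> carrier N \<rightarrow> carrier M"
    and zero: "\<And>i. i \<in> I \<Longrightarrow> linear_extension M f i = \<zero>\<^bsub>M\<^esub>"
    and x: "x \<in> carrier (monoid_algebra N)"
  shows "induced M f (I +>\<^bsub>monoid_algebra N\<^esub> x) = linear_extension M f x"
proof -
  interpret M: k_alg M by (rule k_alg.intro) fact
  interpret F: k_alg "monoid_algebra N :: ('k, _) module"
    by (rule k_alg.intro, rule k_algebra_monoid_algebra) fact
  interpret ideal I "monoid_algebra N" by fact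
  define y where "y = (SOME y. y \<in> I +>\<^bsub>monoid_algebra N\<^esub> x)"
  have "y \<in> I +>\<^bsub>monoid_algebra N\<^esub> x"
    unfolding y_def using a_rcos_self[OF x] by (rule someI)
  then obtain i where i: "i \<in> I" "y = i + x"
    by (auto simp: a_r_coset_def')
  have "linear_extension M f y = linear_extension M f i \<oplus>\<^bsub>M\<^esub> linear_extension M f x"
    using linear_mapD(2)[OF linear_extension_linear[OF assms(1,4)], of i x] i a_Hcarr[OF i(1)] x by simp
  also have "\<dots> = linear_extension M f x"
    using zero[OF i(1)] linear_mapD(1)[OF linear_extension_linear[OF assms(1,4)], of x] x by simp
  finally show ?thesis by (simp add: induced_eq y_def)
qed

lemma
  fixes M :: "('k::field, 'b, 'm) module_scheme"
  assumes "k_algebra M" "Group.monoid N" "ideal I (monoid_algebra N)" "f \<in> carrier N \<rightarrow> carrier M"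
    and "\<And>i. i \<in> I \<Longrightarrow> linear_extension M f i = \<zero>\<^bsub>M\<^esub>"
  shows induced_linear: "linear_map (quotient_algebra (monoid_algebra N) I) M (induced M f)"
    and induced_hom: "linear_extension M f \<in> k_algebra_hom (monoid_algebra N) M \<Longrightarrow>
          induced M f \<in> k_algebra_hom (quotient_algebra (monoid_algebra N) I) M"
proof -
  interpret M: k_alg M by (rule k_alg.intro) fact
  interpret F: k_alg "monoid_algebra N :: ('k, _) module"
    by (rule k_alg.intro, rule k_algebra_monoid_algebra) fact
  interpret ideal I "monoid_algebra N" by fact
  interpret k_quotient "monoid_algebra N :: ('k, _) module" I ..
  note eq = induced_coset[OF assms]
  note lin = linear_extension_linear[OF assms(1,4)]
  show 1: "linear_map (quotient_algebra (monoid_algebra N) I) M (induced M f)"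
    by (rule linear_mapI)
       (auto simp: quotient_carrier coset_add coset_smult eq linear_mapD[OF lin] simp del: monoid_algebra_simps)
  show "induced M f \<in> k_algebra_hom (quotient_algebra (monoid_algebra N) I) M"
    if hom: "linear_extension M f \<in> k_algebra_hom (monoid_algebra N) M"
    by (rule k_algebra_homI[OF 1])
       (auto simp: quotient_carrier coset_mult coset_one eq k_algebra_homD[OF hom] simp del: monoid_algebra_simps)
qed

section \<open>Tensor products of algebras\<close>

text \<open>
  The tensor product inherits its ring structure from the quotient construction; what has to be
  established is the universal property for bilinear maps, which is the subject of this section.
\<close>

locale tensor_pair = A: k_alg A + B: k_alg B
  for A :: "('k::field, 'a, 'm) module_scheme" and B :: "('k, 'b, 'n) module_scheme"
begin

abbreviation F :: "('k, 'a \<times> 'b \<Rightarrow>\<^sub>0 'k) module" where "F \<equiv> monoid_algebra (A \<times>\<times> B)"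

lemma monoid_prod: "Group.monoid (A \<times>\<times> B)"
  by (intro DirProd_monoid A.is_monoid B.is_monoid)

sublocale F: k_alg F
  by (rule k_alg.intro, rule k_algebra_monoid_algebra, rule monoid_prod)

lemma single_carrier [simp]:
  "a \<in> carrier A \<Longrightarrow> b \<in> carrier B \<Longrightarrow> Poly_Mapping.single (a, b) c \<in> carrier F"
  by simp

lemma diff_carrier: "x \<in> carrier F \<Longrightarrow> y \<in> carrier F \<Longrightarrow> x - y \<in> carrier F"
  using keys_minus_subset[of x _ y] by simp

lemma relations_carrier: "tensor_relations A B \<subseteq> carrier F"
  unfolding tensor_relations_def
  by (auto simp del: monoid_algebra_simps intro!: diff_carrier single_carrier)

sublocale k_quotient F "tensor_ideal A B"
proof -
  have "ideal (tensor_ideal A B) F"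
    unfolding tensor_ideal_def by (rule F.genideal_ideal[OF relations_carrier])
  then show "k_quotient F (tensor_ideal A B)"
    by (intro k_quotient.intro F.k_alg_axioms)
qed

lemma k_algebra_tensor: "k_algebra (tensor A B)"
  unfolding tensor_def by (rule k_algebra_quotient)

lemma relation_in_ideal: "r \<in> tensor_relations A B \<Longrightarrow> r \<in> tensor_ideal A B"
  unfolding tensor_ideal_def using F.genideal_self[OF relations_carrier] by blast

lemma F_minus: "x \<in> carrier F \<Longrightarrow> y \<in> carrier F \<Longrightarrow> x \<ominus>\<^bsub>F\<^esub> y = x - y"
proof -
  assume xy: "x \<in> carrier F" "y \<in> carrier F"
  have "- y \<in> carrier F" "y \<oplus>\<^bsub>F\<^esub> - y = \<zero>\<^bsub>F\<^esub>" using xy by auto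
  then have "\<ominus>\<^bsub>F\<^esub> y = - y" using xy F.add.inv_equality[of "-y" y] by simp
  then show ?thesis by (simp add: F.minus_eq)
qed

lemma pure_tensor_closed [simp, intro]:
  "a \<in> carrier A \<Longrightarrow> b \<in> carrier B \<Longrightarrow> pure_tensor A B a b \<in> carrier (tensor A B)"
  using single_carrier[of a b 1] by (auto simp del: monoid_algebra_simps simp: pure_tensor_def tensor_def quotient_carrier)

lemma tensor_smult_single:
  "a \<in> carrier A \<Longrightarrow> b \<in> carrier B \<Longrightarrow>
     c \<odot>\<^bsub>tensor A B\<^esub> pure_tensor A B a b = tensor_ideal A B +>\<^bsub>F\<^esub> Poly_Mapping.single (a, b) c"
  using coset_smult[of "Poly_Mapping.single (a, b) 1" c]
  by (simp add: tensor_def pure_tensor_def map_times_single)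

lemma pure_tensor_smult_left:
  assumes "a \<in> carrier A" "b \<in> carrier B"
  shows "pure_tensor A B (c \<odot>\<^bsub>A\<^esub> a) b = c \<odot>\<^bsub>tensor A B\<^esub> pure_tensor A B a b"
proof -
  have "Poly_Mapping.single (c \<odot>\<^bsub>A\<^esub> a, b) 1 \<ominus>\<^bsub>F\<^esub> Poly_Mapping.single (a, b) c \<in> tensor_ideal A B"
    using assms
    by (subst F_minus) (simp_all del: monoid_algebra_simps, rule relation_in_ideal, unfold tensor_relations_def, blast)
  then show ?thesis
    using assms unfolding tensor_smult_single[OF assms]
    unfolding pure_tensor_def by (subst coset_eq_iff) (simp_all del: monoid_algebra_simps)
qed

lemma pure_tensor_smult_right:
  assumes "a \<in> carrier A" "b \<in> carrier B"
  shows "pure_tensor A B a (c \<odot>\<^bsub>B\<^esub> b) = c \<odot>\<^bsub>tensor A B\<^esub> pure_tensor A B a b"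
proof -
  have "Poly_Mapping.single (a, c \<odot>\<^bsub>B\<^esub> b) 1 \<ominus>\<^bsub>F\<^esub> Poly_Mapping.single (a, b) c \<in> tensor_ideal A B"
    using assms
    by (subst F_minus) (simp_all del: monoid_algebra_simps, rule relation_in_ideal, unfold tensor_relations_def, blast)
  then show ?thesis
    using assms unfolding tensor_smult_single[OF assms]
    unfolding pure_tensor_def by (subst coset_eq_iff) (simp_all del: monoid_algebra_simps)
qed

lemma pure_tensor_add_left:
  assumes "a \<in> carrier A" "a' \<in> carrier A" "b \<in> carrier B"
  shows "pure_tensor A B (a \<oplus>\<^bsub>A\<^esub> a') b = pure_tensor A B a b \<oplus>\<^bsub>tensor A B\<^esub> pure_tensor A B a' b"
proof -
  let ?s = "Poly_Mapping.single (a, b) 1 \<oplus>\<^bsub>F\<^esub> Poly_Mapping.single (a', b) 1"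
  have s: "?s \<in> carrier F" using assms by (intro F.a_closed single_carrier)
  have "Poly_Mapping.single (a \<oplus>\<^bsub>A\<^esub> a', b) 1 \<ominus>\<^bsub>F\<^esub> ?s \<in> tensor_ideal A B"
    using assms s
    by (subst F_minus)
       (simp_all del: monoid_algebra_simps(1), unfold diff_diff_eq[symmetric],
        rule relation_in_ideal, unfold tensor_relations_def, blast)
  then show ?thesis
    using assms s coset_add[OF single_carrier single_carrier, of a b a' b 1 1]
    by (simp add: pure_tensor_def tensor_def coset_eq_iff)
qed

lemma pure_tensor_add_right:
  assumes "a \<in> carrier A" "b \<in> carrier B" "b' \<in> carrier B"
  shows "pure_tensor A B a (b \<oplus>\<^bsub>B\<^esub> b') = pure_tensor A B a b \<oplus>\<^bsub>tensor A B\<^esub> pure_tensor A B a b'"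
proof -
  let ?s = "Poly_Mapping.single (a, b) 1 \<oplus>\<^bsub>F\<^esub> Poly_Mapping.single (a, b') 1"
  have s: "?s \<in> carrier F" using assms by (intro F.a_closed single_carrier)
  have "Poly_Mapping.single (a, b \<oplus>\<^bsub>B\<^esub> b') 1 \<ominus>\<^bsub>F\<^esub> ?s \<in> tensor_ideal A B"
    using assms s
    by (subst F_minus)
       (simp_all del: monoid_algebra_simps(1), unfold diff_diff_eq[symmetric],
        rule relation_in_ideal, unfold tensor_relations_def, blast)
  then show ?thesis
    using assms s coset_add[OF single_carrier single_carrier, of a b a b' 1 1]
    by (simp add: pure_tensor_def tensor_def coset_eq_iff)
qed

lemma pure_tensor_mult:
  assumes "a \<in> carrier A" "b \<in> carrier B" "a' \<in> carrier A" "b' \<in> carrier B"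
  shows "pure_tensor A B a b \<otimes>\<^bsub>tensor A B\<^esub> pure_tensor A B a' b' = pure_tensor A B (a \<otimes>\<^bsub>A\<^esub> a') (b \<otimes>\<^bsub>B\<^esub> b')"
  using coset_mult[OF single_carrier single_carrier, of a b a' b' 1 1] assms
  by (simp add: pure_tensor_def tensor_def)

lemma tensor_one: "\<one>\<^bsub>tensor A B\<^esub> = pure_tensor A B \<one>\<^bsub>A\<^esub> \<one>\<^bsub>B\<^esub>"
  by (simp add: pure_tensor_def tensor_def coset_one)

text \<open>
  Sums of pure tensors exhaust the tensor product because a scalar can be absorbed into the first
  factor; no separate case for scalar multiples is therefore required.
\<close>

lemma tensor_induct [consumes 1, case_names pure add]:
  assumes "t \<in> carrier (tensor A B)"
    and pure: "\<And>a b. a \<in> carrier A \<Longrightarrow> b \<in> carrier B \<Longrightarrow> P (pure_tensor A B a b)"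
    and add: "\<And>s t. s \<in> carrier (tensor A B) \<Longrightarrow> t \<in> carrier (tensor A B) \<Longrightarrow> P s \<Longrightarrow> P t \<Longrightarrow>
      P (s \<oplus>\<^bsub>tensor A B\<^esub> t)"
  shows "P t"
proof -
  obtain x where x: "Poly_Mapping.keys x \<subseteq> carrier A \<times> carrier B" "t = tensor_ideal A B +>\<^bsub>F\<^esub> x"
    using assms(1) by (auto simp: tensor_def quotient_carrier)
  have "P (tensor_ideal A B +>\<^bsub>F\<^esub> x)"
    using x(1)
  proof (induction x rule: finite_support_induct)
    case zero
    have "P (pure_tensor A B (0 \<odot>\<^bsub>A\<^esub> \<one>\<^bsub>A\<^esub>) \<one>\<^bsub>B\<^esub>)" by (intro pure) auto
    moreover have "pure_tensor A B (0 \<odot>\<^bsub>A\<^esub> \<one>\<^bsub>A\<^esub>) \<one>\<^bsub>B\<^esub> = tensor_ideal A B +>\<^bsub>F\<^esub> 0"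
      by (subst pure_tensor_smult_left) (auto simp: tensor_smult_single)
    ultimately show ?case by simp
  next
    case (single q c)
    obtain a b where q: "q = (a, b)" "a \<in> carrier A" "b \<in> carrier B" using single by auto
    have "P (pure_tensor A B (c \<odot>\<^bsub>A\<^esub> a) b)" using q by (intro pure) auto
    then show ?case using q by (simp add: pure_tensor_smult_left tensor_smult_single)
  next
    case (add x y)
    then have xy: "x \<in> carrier F" "y \<in> carrier F" by auto
    then have "tensor_ideal A B +>\<^bsub>F\<^esub> x \<in> carrier (tensor A B)" "tensor_ideal A B +>\<^bsub>F\<^esub> y \<in> carrier (tensor A B)"
      unfolding tensor_def quotient_carrier by auto
    with add assms(3) have "P ((tensor_ideal A B +>\<^bsub>F\<^esub> x) \<oplus>\<^bsub>tensor A B\<^esub> (tensor_ideal A B +>\<^bsub>F\<^esub> y))"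
      by blast
    also have "(tensor_ideal A B +>\<^bsub>F\<^esub> x) \<oplus>\<^bsub>tensor A B\<^esub> (tensor_ideal A B +>\<^bsub>F\<^esub> y) = tensor_ideal A B +>\<^bsub>F\<^esub> (x + y)"
      using coset_add[OF xy] by (simp add: tensor_def)
    finally show ?case .
  qed
  then show ?thesis using x by simp
qed

end

definition bilinear_map ::
    "('k, 'a, 'l) module_scheme \<Rightarrow> ('k, 'b, 'm) module_scheme \<Rightarrow> ('k, 'c, 'n) module_scheme \<Rightarrow>
     ('a \<Rightarrow> 'b \<Rightarrow> 'c) \<Rightarrow> bool" where
  "bilinear_map A B M \<beta> \<longleftrightarrow>
     (\<forall>a\<in>carrier A. linear_map B M (\<beta> a)) \<and> (\<forall>b\<in>carrier B. linear_map A M (\<lambda>a. \<beta> a b))"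

lemma bilinear_mapI:
  assumes "\<And>a. a \<in> carrier A \<Longrightarrow> linear_map B M (\<beta> a)"
    and "\<And>b. b \<in> carrier B \<Longrightarrow> linear_map A M (\<lambda>a. \<beta> a b)"
  shows "bilinear_map A B M \<beta>"
  using assms by (auto simp: bilinear_map_def)

context tensor_pair
begin

text \<open>
  The universal property rests on this. The linear extension is not multiplicative, so its kernel is
  no ideal, whereas the relations are divided out as an ideal. The set \<open>J\<close> of all \<open>x\<close> such that
  \<open>u x v\<close> is in the kernel for all \<open>u\<close> and \<open>v\<close> is an ideal; it contains the relations, since
  multiplying a bilinearity relation by a pair on either side gives a relation of the same kind.
\<close>

lemma bilinear_extension_vanishes:
  assumes "k_algebra M" "bilinear_map A B M \<beta>" "x \<in> tensor_ideal A B"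
  shows "linear_extension M (\<lambda>(a, b). \<beta> a b) x = \<zero>\<^bsub>M\<^esub>"
proof -
  interpret M: k_alg M by (rule k_alg.intro) fact
  let ?f = "\<lambda>(a, b). \<beta> a b"
  let ?L = "linear_extension M ?f"
  have lin: "linear_map B M (\<beta> a)" if "a \<in> carrier A" for a
    using assms(2) that by (simp add: bilinear_map_def)
  have lin': "linear_map A M (\<lambda>a. \<beta> a b)" if "b \<in> carrier B" for b
    using assms(2) that by (simp add: bilinear_map_def)
  have f: "?f \<in> carrier (A \<times>\<times> B) \<rightarrow> carrier M"
    using linear_mapD(1)[OF lin] by auto
  note Llin = linear_extension_linear[OF assms(1) f]
  note LD = linear_mapD[OF Llin]
  have f': "\<beta> a b \<in> carrier M" if "a \<in> carrier A" "b \<in> carrier B" for a b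
    using that linear_mapD(1)[OF lin] by simp
  have Lsingle: "?L (Poly_Mapping.single (a, b) c) = c \<odot>\<^bsub>M\<^esub> \<beta> a b" if "a \<in> carrier A" "b \<in> carrier B" for a b c
    using f' that by simp
  have Ldiff: "?L (x - y) = ?L x \<ominus>\<^bsub>M\<^esub> ?L y"
    if "Poly_Mapping.keys x \<subseteq> carrier A \<times> carrier B" "Poly_Mapping.keys y \<subseteq> carrier A \<times> carrier B" for x y
    using linear_map_minus[OF F.k_algebra assms(1) Llin, of x y] that by (simp add: F_minus)
  define J where "J = {x \<in> carrier F. \<forall>u\<in>carrier F. \<forall>v\<in>carrier F. ?L (u \<otimes>\<^bsub>F\<^esub> x \<otimes>\<^bsub>F\<^esub> v) = \<zero>\<^bsub>M\<^esub>}"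
  have J: "ideal J F"
  proof (rule idealI)
    show "ring F" by (rule F.ring_axioms)
    show "subgroup J (add_monoid F)"
    proof (rule F.add.subgroupI)
      show "J \<subseteq> carrier F" by (auto simp: J_def)
      have "\<zero>\<^bsub>F\<^esub> \<in> J"
        unfolding J_def using linear_map_zero[OF F.k_algebra assms(1) Llin]
        by (auto simp del: monoid_algebra_simps)
      then show "J \<noteq> {}" by blast
    next
      fix x assume "x \<in> J"
      then show "\<ominus>\<^bsub>F\<^esub> x \<in> J"
        unfolding J_def
        by (auto simp del: monoid_algebra_simps simp: F.smult_mult_left F.smult_mult_right LD(3) simp flip: F.smult_minus_one)
    next
      fix x y assume "x \<in> J" "y \<in> J"
      then show "x \<oplus>\<^bsub>F\<^esub> y \<in> J"
        unfolding J_def by (auto simp del: monoid_algebra_simps simp: F.l_distr F.r_distr LD(2))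
    qed
  next
    fix x y assume xy: "x \<in> J" "y \<in> carrier F"
    then show "y \<otimes>\<^bsub>F\<^esub> x \<in> J"
      unfolding J_def by (auto simp del: monoid_algebra_simps simp flip: F.m_assoc)
    show "x \<otimes>\<^bsub>F\<^esub> y \<in> J"
      using xy unfolding J_def by (auto simp del: monoid_algebra_simps simp: F.m_assoc)
  qed
  have "tensor_relations A B \<subseteq> J"
  proof
    fix r assume r: "r \<in> tensor_relations A B"
    (* By bilinearity in u and v, it is enough to multiply a relation by scaled pairs. *)
    have basis: "?L (Poly_Mapping.single (a, b) c \<otimes>\<^bsub>F\<^esub> r \<otimes>\<^bsub>F\<^esub> Poly_Mapping.single (a', b') c') = \<zero>\<^bsub>M\<^esub>"
      if ab: "a \<in> carrier A" "b \<in> carrier B" "a' \<in> carrier A" "b' \<in> carrier B" for a b a' b' c c'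
    proof -
      note simps = monoid_algebra_mult_diff Ldiff diff_carrier[simplified] ab f' Lsingle
        A.l_distr A.r_distr B.l_distr B.r_distr linear_mapD(2)[OF lin] linear_mapD(2)[OF lin']
        linear_mapD(3)[OF lin] linear_mapD(3)[OF lin'] M.smult_add_right M.add_diff_diff_self
        A.smult_mult_left A.smult_mult_right B.smult_mult_left B.smult_mult_right
        M.smult_smult mult_ac M.diff_self
      from r consider
          x x' y where "r = Poly_Mapping.single (x \<oplus>\<^bsub>A\<^esub> x', y) 1 - Poly_Mapping.single (x, y) 1 - Poly_Mapping.single (x', y) 1"
            "x \<in> carrier A" "x' \<in> carrier A" "y \<in> carrier B"
        | x y y' where "r = Poly_Mapping.single (x, y \<oplus>\<^bsub>B\<^esub> y') 1 - Poly_Mapping.single (x, y) 1 - Poly_Mapping.single (x, y') 1"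
            "x \<in> carrier A" "y \<in> carrier B" "y' \<in> carrier B"
        | d x y where "r = Poly_Mapping.single (d \<odot>\<^bsub>A\<^esub> x, y) 1 - Poly_Mapping.single (x, y) d" "x \<in> carrier A" "y \<in> carrier B"
        | d x y where "r = Poly_Mapping.single (x, d \<odot>\<^bsub>B\<^esub> y) 1 - Poly_Mapping.single (x, y) d" "x \<in> carrier A" "y \<in> carrier B"
        unfolding tensor_relations_def by blast
      then show ?thesis
        by cases (simp_all add: simps)
    qed
    have rc: "r \<in> carrier F" using r relations_carrier by blast
    have "?L (u \<otimes>\<^bsub>F\<^esub> r \<otimes>\<^bsub>F\<^esub> v) = \<zero>\<^bsub>M\<^esub>" if u: "u \<in> carrier F" and v: "v \<in> carrier F" for u v
    proof -
      have "Poly_Mapping.keys u \<subseteq> carrier A \<times> carrier B" using u by simp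
      then show ?thesis
      proof (induction u rule: finite_support_induct)
        case (single q c)
        then have qc: "Poly_Mapping.single q c \<in> carrier F" by auto
        have "Poly_Mapping.keys v \<subseteq> carrier A \<times> carrier B" using v by simp
        then show ?case
        proof (induction v rule: finite_support_induct)
          case (single q' c')
          then show ?case using basis \<open>q \<in> _\<close> by auto
        next
          case (add x y)
          then have "x \<in> carrier F" "y \<in> carrier F" by auto
          then show ?case
            using add.IH qc rc LD(2)[of "Poly_Mapping.single q c \<otimes>\<^bsub>F\<^esub> r \<otimes>\<^bsub>F\<^esub> x" "Poly_Mapping.single q c \<otimes>\<^bsub>F\<^esub> r \<otimes>\<^bsub>F\<^esub> y"]
            by (simp del: monoid_algebra_simps(1) add: monoid_algebra_mult_add_right)
        qed simp
      next
        case (add x y)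
        then have "x \<in> carrier F" "y \<in> carrier F" by auto
        then show ?case
          using add.IH v rc LD(2)[of "x \<otimes>\<^bsub>F\<^esub> r \<otimes>\<^bsub>F\<^esub> v" "y \<otimes>\<^bsub>F\<^esub> r \<otimes>\<^bsub>F\<^esub> v"]
          by (simp del: monoid_algebra_simps(1) add: monoid_algebra_mult_add_left)
      qed simp
    qed
    then show "r \<in> J" using rc by (simp add: J_def del: monoid_algebra_simps)
  qed
  then have "tensor_ideal A B \<subseteq> J"
    unfolding tensor_ideal_def by (intro F.genideal_minimal J)
  then have "x \<in> J" using assms(3) by blast
  then have "?L (\<one>\<^bsub>F\<^esub> \<otimes>\<^bsub>F\<^esub> x \<otimes>\<^bsub>F\<^esub> \<one>\<^bsub>F\<^esub>) = \<zero>\<^bsub>M\<^esub>" "x \<in> carrier F"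
    unfolding J_def using F.one_closed by blast+
  then show ?thesis by (simp del: monoid_algebra_simps)
qed

lemma
  assumes "k_algebra M" "bilinear_map A B M \<beta>"
  shows induced_pure: "a \<in> carrier A \<Longrightarrow> b \<in> carrier B \<Longrightarrow>
      induced M (\<lambda>(a, b). \<beta> a b) (pure_tensor A B a b) = \<beta> a b"
    and induced_bilinear_linear: "linear_map (tensor A B) M (induced M (\<lambda>(a, b). \<beta> a b))"
proof -
  interpret M: k_alg M by (rule k_alg.intro) fact
  have \<beta>: "\<beta> a b \<in> carrier M" if "a \<in> carrier A" "b \<in> carrier B" for a b
    using assms(2) that linear_mapD(1) by (fastforce simp: bilinear_map_def)
  then have f: "(\<lambda>(a, b). \<beta> a b) \<in> carrier (A \<times>\<times> B) \<rightarrow> carrier M"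
    by auto
  note prems = assms(1) monoid_prod is_ideal f bilinear_extension_vanishes[OF assms]
  show "linear_map (tensor A B) M (induced M (\<lambda>(a, b). \<beta> a b))"
    unfolding tensor_def by (rule induced_linear[OF prems])
  show "induced M (\<lambda>(a, b). \<beta> a b) (pure_tensor A B a b) = \<beta> a b"
    if "a \<in> carrier A" "b \<in> carrier B"
    using that \<beta> induced_coset[OF prems, of "Poly_Mapping.single (a, b) 1"]
    by (simp add: pure_tensor_def)
qed

text \<open>
  A linear map that is multiplicative on pure tensors is an algebra map, by induction on both factors.
\<close>

lemma tensor_linear_hom:
  assumes "k_algebra M" "linear_map (tensor A B) M f" "f \<one>\<^bsub>tensor A B\<^esub> = \<one>\<^bsub>M\<^esub>"
    and mult: "\<And>a b a' b'. a \<in> carrier A \<Longrightarrow> b \<in> carrier B \<Longrightarrow> a' \<in> carrier A \<Longrightarrow> b' \<in> carrier B \<Longrightarrow>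
      f (pure_tensor A B (a \<otimes>\<^bsub>A\<^esub> a') (b \<otimes>\<^bsub>B\<^esub> b')) = f (pure_tensor A B a b) \<otimes>\<^bsub>M\<^esub> f (pure_tensor A B a' b')"
  shows "f \<in> k_algebra_hom (tensor A B) M"
proof (rule k_algebra_homI)
  interpret M: k_alg M by (rule k_alg.intro) fact
  interpret T: k_alg "tensor A B" by (rule k_alg.intro, rule k_algebra_tensor)
  note [simp] = linear_mapD[OF assms(2)]
  fix s t assume s: "s \<in> carrier (tensor A B)" and t: "t \<in> carrier (tensor A B)"
  show "f (s \<otimes>\<^bsub>tensor A B\<^esub> t) = f s \<otimes>\<^bsub>M\<^esub> f t"
    using s
  proof (induction rule: tensor_induct)
    case (pure a b)
    show ?case
      using t by (induction rule: tensor_induct)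
        (use pure in \<open>simp_all add: pure_tensor_mult mult T.r_distr M.r_distr\<close>)
  qed (use t in \<open>simp add: T.l_distr M.l_distr\<close>)
qed (fact assms)+

lemma bilinear_pure_tensor: "bilinear_map A B (tensor A B) (pure_tensor A B)"
  by (intro bilinear_mapI linear_mapI)
     (simp_all add: pure_tensor_add_left pure_tensor_add_right pure_tensor_smult_left pure_tensor_smult_right)

end

lemma tensor_pairI: "k_algebra A \<Longrightarrow> k_algebra B \<Longrightarrow> tensor_pair A B"
  by (simp add: tensor_pair_def k_alg_def)

lemma bilinear_mapD:
  assumes "bilinear_map A B M \<beta>"
  shows "a \<in> carrier A \<Longrightarrow> linear_map B M (\<beta> a)"
    and "b \<in> carrier B \<Longrightarrow> linear_map A M (\<lambda>a. \<beta> a b)"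
  using assms by (simp_all add: bilinear_map_def)

lemma bilinear_map_compose:
  assumes "bilinear_map C D M \<beta>" "linear_map A C f" "linear_map B D g"
  shows "bilinear_map A B M (\<lambda>a b. \<beta> (f a) (g b))"
proof (rule bilinear_mapI)
  show "linear_map B M (\<lambda>b. \<beta> (f a) (g b))" if "a \<in> carrier A" for a
    using linear_map_compose[OF assms(3) bilinear_mapD(1)[OF assms(1)]] that linear_mapD(1)[OF assms(2)] by blast
  show "linear_map A M (\<lambda>a. \<beta> (f a) (g b))" if "b \<in> carrier B" for b
    using linear_map_compose[OF assms(2) bilinear_mapD(2)[OF assms(1)]] that linear_mapD(1)[OF assms(3)] by blast
qed

lemma
  assumes "k_algebra A" "k_algebra B" "k_algebra C" "k_algebra D"
    and "linear_map A C f" "linear_map B D g"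
  shows tensor_map_pure: "a \<in> carrier A \<Longrightarrow> b \<in> carrier B \<Longrightarrow>
      tensor_map C D f g (pure_tensor A B a b) = pure_tensor C D (f a) (g b)"
    and tensor_map_linear: "linear_map (tensor A B) (tensor C D) (tensor_map C D f g)"
proof -
  interpret AB: tensor_pair A B by (intro tensor_pairI assms)
  interpret CD: tensor_pair C D by (intro tensor_pairI assms)
  note bil = bilinear_map_compose[OF CD.bilinear_pure_tensor assms(5,6)]
  show "linear_map (tensor A B) (tensor C D) (tensor_map C D f g)"
    unfolding tensor_map_def by (rule AB.induced_bilinear_linear[OF CD.k_algebra_tensor bil])
  show "tensor_map C D f g (pure_tensor A B a b) = pure_tensor C D (f a) (g b)"
    if "a \<in> carrier A" "b \<in> carrier B"
    unfolding tensor_map_def by (rule AB.induced_pure[OF CD.k_algebra_tensor bil that])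
qed

lemma tensor_map_hom:
  assumes "k_algebra A" "k_algebra B" "k_algebra C" "k_algebra D"
    and "f \<in> k_algebra_hom A C" "g \<in> k_algebra_hom B D"
  shows "tensor_map C D f g \<in> k_algebra_hom (tensor A B) (tensor C D)"
proof -
  interpret AB: tensor_pair A B by (intro tensor_pairI assms)
  interpret CD: tensor_pair C D by (intro tensor_pairI assms)
  note lin = assms(1-4) k_algebra_hom_linear[OF assms(5)] k_algebra_hom_linear[OF assms(6)]
  show ?thesis
    by (rule AB.tensor_linear_hom[OF CD.k_algebra_tensor tensor_map_linear[OF lin]])
       (simp_all add: AB.tensor_one CD.tensor_one tensor_map_pure[OF lin] k_algebra_homD[OF assms(5)]
          k_algebra_homD[OF assms(6)] CD.pure_tensor_mult)
qed

text \<open>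
  The associator is defined by two nested bilinear extensions. The inner one, \<open>\<beta>\<close> in the proof, has to
  be shown bilinear in the element of \<open>A \<otimes> B\<close> and the element of \<open>C\<close> before the outer one makes sense.
\<close>

lemma
  assumes "k_algebra A" "k_algebra B" "k_algebra C"
  shows tensor_assoc_pure: "a \<in> carrier A \<Longrightarrow> b \<in> carrier B \<Longrightarrow> c \<in> carrier C \<Longrightarrow>
      tensor_assoc A B C (pure_tensor (tensor A B) C (pure_tensor A B a b) c) =
      pure_tensor A (tensor B C) a (pure_tensor B C b c)"
    and tensor_assoc_hom: "tensor_assoc A B C \<in> k_algebra_hom (tensor (tensor A B) C) (tensor A (tensor B C))"
proof -
  interpret AB: tensor_pair A B by (intro tensor_pairI assms)
  interpret BC: tensor_pair B C by (intro tensor_pairI assms)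
  interpret AB_C: tensor_pair "tensor A B" C by (intro tensor_pairI assms AB.k_algebra_tensor)
  interpret A_BC: tensor_pair A "tensor B C" by (intro tensor_pairI assms BC.k_algebra_tensor)
  interpret T: k_alg "tensor A (tensor B C)" by (rule k_alg.intro, rule A_BC.k_algebra_tensor)
  note T = A_BC.k_algebra_tensor
  define \<beta> where "\<beta> = (\<lambda>t c. induced (tensor A (tensor B C)) (\<lambda>(a, b). pure_tensor A (tensor B C) a (pure_tensor B C b c)) t)"
  have bil: "bilinear_map A B (tensor A (tensor B C)) (\<lambda>a b. pure_tensor A (tensor B C) a (pure_tensor B C b c))"
    if "c \<in> carrier C" for c
    by (rule bilinear_map_compose[OF A_BC.bilinear_pure_tensor linear_map_id bilinear_mapD(2)[OF BC.bilinear_pure_tensor that]])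
  have lin: "linear_map (tensor A B) (tensor A (tensor B C)) (\<lambda>t. \<beta> t c)" if "c \<in> carrier C" for c
    unfolding \<beta>_def by (rule AB.induced_bilinear_linear[OF T bil[OF that]])
  note [simp] = linear_mapD[OF lin]
  have pure [simp]: "\<beta> (pure_tensor A B a b) c = pure_tensor A (tensor B C) a (pure_tensor B C b c)"
    if "a \<in> carrier A" "b \<in> carrier B" "c \<in> carrier C" for a b c
    unfolding \<beta>_def by (rule AB.induced_pure[OF T bil[OF that(3)] that(1,2)])
  have add: "\<beta> t (c \<oplus>\<^bsub>C\<^esub> d) = \<beta> t c \<oplus>\<^bsub>tensor A (tensor B C)\<^esub> \<beta> t d"
    if "t \<in> carrier (tensor A B)" "c \<in> carrier C" "d \<in> carrier C" for t c d
    using that(1) by (induction rule: AB.tensor_induct)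
      (use that(2,3) in \<open>simp_all add: BC.pure_tensor_add_right A_BC.pure_tensor_add_right T.a_ac\<close>)
  have smult: "\<beta> t (e \<odot>\<^bsub>C\<^esub> c) = e \<odot>\<^bsub>tensor A (tensor B C)\<^esub> \<beta> t c"
    if "t \<in> carrier (tensor A B)" "c \<in> carrier C" for t c e
    using that(1) by (induction rule: AB.tensor_induct)
      (use that(2) in \<open>simp_all add: BC.pure_tensor_smult_right A_BC.pure_tensor_smult_right T.smult_add_right\<close>)
  have bil': "bilinear_map (tensor A B) C (tensor A (tensor B C)) \<beta>"
    by (intro bilinear_mapI linear_mapI) (simp_all add: add smult)
  have eq: "tensor_assoc A B C = induced (tensor A (tensor B C)) (\<lambda>(t, c). \<beta> t c)"
    by (simp add: tensor_assoc_def \<beta>_def)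
  have val: "tensor_assoc A B C (pure_tensor (tensor A B) C t c) = \<beta> t c"
    if "t \<in> carrier (tensor A B)" "c \<in> carrier C" for t c
    unfolding eq by (rule AB_C.induced_pure[OF T bil' that])
  show "tensor_assoc A B C (pure_tensor (tensor A B) C (pure_tensor A B a b) c) =
      pure_tensor A (tensor B C) a (pure_tensor B C b c)"
    if "a \<in> carrier A" "b \<in> carrier B" "c \<in> carrier C"
    using that by (simp add: val)
  have mult: "\<beta> (s \<otimes>\<^bsub>tensor A B\<^esub> t) (c \<otimes>\<^bsub>C\<^esub> d) = \<beta> s c \<otimes>\<^bsub>tensor A (tensor B C)\<^esub> \<beta> t d"
    if s: "s \<in> carrier (tensor A B)" and t: "t \<in> carrier (tensor A B)" and cd: "c \<in> carrier C" "d \<in> carrier C" for s t c d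
    using s
  proof (induction rule: AB.tensor_induct)
    case (pure a b)
    show ?case
      using t by (induction rule: AB.tensor_induct)
        (use pure cd in \<open>simp_all add: AB.pure_tensor_mult BC.pure_tensor_mult A_BC.pure_tensor_mult
            AB_C.A.r_distr T.r_distr\<close>)
  qed (use t cd in \<open>simp add: AB_C.A.l_distr T.l_distr\<close>)
  show "tensor_assoc A B C \<in> k_algebra_hom (tensor (tensor A B) C) (tensor A (tensor B C))"
  proof (rule AB_C.tensor_linear_hom[OF T])
    show "linear_map (tensor (tensor A B) C) (tensor A (tensor B C)) (tensor_assoc A B C)"
      unfolding eq by (rule AB_C.induced_bilinear_linear[OF T bil'])
  qed (simp_all add: val mult AB_C.tensor_one A_BC.tensor_one AB.tensor_one BC.tensor_one)
qed

section \<open>Two identities in characteristic p\<close>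

lemma binomial_commuting:
  fixes a b :: "'r::ring_1"
  assumes "a * b = b * a"
  shows "(a + b) ^ m = (\<Sum>k\<le>m. of_nat (m choose k) * a ^ k * b ^ (m - k))"
proof (induction m)
  case (Suc m)
  have ba: "b * a ^ k = a ^ k * b" for k
    using power_commuting_commutes[OF assms, of k] by simp
  have decomp: "{0..Suc m} = {0} \<union> {Suc m} \<union> {1..m}" by auto
  have "(a + b) ^ Suc m = (a + b) * (\<Sum>k\<le>m. of_nat (m choose k) * a ^ k * b ^ (m - k))"
    using Suc by simp
  also have "\<dots> = (\<Sum>k\<le>m. of_nat (m choose k) * a ^ Suc k * b ^ (m - k)) +
                  (\<Sum>k\<le>m. of_nat (m choose k) * a ^ k * b ^ Suc (m - k))"
  proof -
    have 1: "a * (of_nat (m choose k) * a ^ k * b ^ (m - k)) = of_nat (m choose k) * a ^ Suc k * b ^ (m - k)" for k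
      by (simp add: mult_of_nat_commute[symmetric] flip: mult.assoc)
    have n: "b * (of_nat c * y) = of_nat c * (b * y)" for c and y :: 'r
      by (simp add: mult_of_nat_commute[symmetric] flip: mult.assoc)
    have ba': "b * (a ^ k * y) = a ^ k * (b * y)" for k y
      by (simp add: ba flip: mult.assoc)
    have 2: "b * (of_nat (m choose k) * a ^ k * b ^ (m - k)) = of_nat (m choose k) * a ^ k * b ^ Suc (m - k)" for k
      by (simp add: n ba' mult.assoc)
    show ?thesis by (simp only: distrib_right sum_distrib_left 1 2 sum.distrib)
  qed
  also have "(\<Sum>k\<le>m. of_nat (m choose k) * a ^ k * b ^ Suc (m - k)) =
      (\<Sum>k\<le>Suc m. of_nat (m choose k) * a ^ k * b ^ (Suc m - k))"
    by (simp add: Suc_diff_le binomial_eq_0)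
  also have "\<dots> = b ^ Suc m + (\<Sum>k\<le>m. of_nat (m choose Suc k) * a ^ Suc k * b ^ (m - k))"
    by (simp only: sum.atMost_Suc_shift) simp
  also have "(\<Sum>k\<le>m. of_nat (m choose k) * a ^ Suc k * b ^ (m - k)) +
      (b ^ Suc m + (\<Sum>k\<le>m. of_nat (m choose Suc k) * a ^ Suc k * b ^ (m - k))) =
      b ^ Suc m + (\<Sum>k\<le>m. of_nat (Suc m choose Suc k) * a ^ Suc k * b ^ (m - k))"
    by (simp add: distrib_right sum.distrib add_ac)
  also have "\<dots> = (\<Sum>k\<le>Suc m. of_nat (Suc m choose k) * a ^ k * b ^ (Suc m - k))"
    by (simp only: sum.atMost_Suc_shift) simp
  finally show ?case .
qed simp

lemma power_mult_distrib_commuting: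
  fixes a b :: "'r::monoid_mult"
  assumes "b * a = a * b"
  shows "(a * b) ^ m = a ^ m * b ^ m"
proof (induction m)
  case (Suc m)
  have "b * a ^ m = a ^ m * b"
    using power_commuting_commutes[of a b m] assms by simp
  then show ?case
    by (simp add: Suc mult.assoc) (simp flip: mult.assoc)
qed simp

lemma of_nat_left_commute: "of_nat i * (y * z) = y * (of_nat i * z)" for y z :: "'r::ring_1"
  by (metis mult.assoc mult_of_nat_commute)

context
  fixes p :: nat
  assumes prime: "prime p" and char: "of_nat p = (0 :: 'r::ring_1)"
begin

lemma of_nat_dvd_char: "p dvd m \<Longrightarrow> of_nat m = (0 :: 'r)"
  using char by (auto simp: dvd_def)

text \<open>
  The inner binomial coefficients vanish in characteristic \<open>p\<close>.
\<close>

lemma freshman_commuting: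
  fixes a b :: 'r
  assumes "a * b = b * a"
  shows "(a + b) ^ p = a ^ p + b ^ p"
proof -
  obtain q where q: "p = Suc q" using prime prime_gt_0_nat gr0_implies_Suc by blast
  have "of_nat (p choose Suc k) * a ^ Suc k * b ^ (p - Suc k) = 0" if "k < q" for k
    using that of_nat_dvd_char[OF dvd_choose_prime[of "Suc k" p]] prime q by auto
  then have "(\<Sum>k<q. of_nat (p choose Suc k) * a ^ Suc k * b ^ (p - Suc k)) = 0"
    by simp
  moreover have "(a + b) ^ p =
      (\<Sum>k<Suc (Suc q). of_nat (p choose k) * a ^ k * b ^ (p - k))"
    unfolding binomial_commuting[OF assms] q lessThan_Suc_atMost ..
  moreover have "\<dots> = b ^ p + ((\<Sum>k<q. of_nat (p choose Suc k) * a ^ Suc k * b ^ (p - Suc k)) + a ^ p)"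
    unfolding sum.lessThan_Suc_shift[of _ "Suc q"] sum.lessThan_Suc[of _ q] by (simp add: q)
  ultimately show ?thesis by (simp add: add_ac)
qed

lemma freshman_diff:
  fixes a b :: 'r
  assumes "a * b = b * a"
  shows "(a - b) ^ p = a ^ p - b ^ p"
  using freshman_commuting[of "a - b" b] assms by (simp add: algebra_simps)

lemma uminus_power_char: "(- a :: 'r) ^ p = - (a ^ p)"
  using freshman_diff[of 0 a] prime prime_gt_0_nat[of p] by (simp add: zero_power)

lemma inverse_mod_char:
  assumes "0 < j" "j < p"
  shows "\<exists>i. of_nat i * of_nat j = (1 :: 'r)"
proof -
  have "coprime j p"
    using assms prime by (metis coprime_commute dvd_imp_le linorder_not_less prime_imp_coprime)
  moreover obtain x y where "j * x = p * y + gcd j p"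
    using bezout_nat[of j p] assms(1) by blast
  ultimately have "j * x = p * y + 1" by (simp only: coprime_iff_gcd_eq_1)
  then have "x * j = p * y + 1" by (simp only: mult.commute)
  then have "of_nat (x * j) = (of_nat (p * y + 1) :: 'r)" by (rule arg_cong)
  then have "of_nat x * of_nat j = (1 :: 'r)" using char by simp
  then show ?thesis by blast
qed

text \<open>
  In the two applications \<open>R j\<close> is the multiple of the \<open>(j + 1)\<close>-st power of a nilpotent element, which
  dies for \<open>j = p - 1\<close>; so the two sums are a shift of each other.
\<close>

lemma telescoping_cancel:
  fixes T R :: "nat \<Rightarrow> 'r"
  assumes "T 0 = 0" "\<And>j. Suc j < p \<Longrightarrow> R j = T (Suc j)" "\<And>j. Suc j = p \<Longrightarrow> R j = 0"
  shows "(\<Sum>j<p. T j) = (\<Sum>j<p. R j)"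
proof -
  obtain q where q: "p = Suc q" using prime prime_gt_0_nat gr0_implies_Suc by blast
  have "(\<Sum>j<p. T j) = (\<Sum>j<q. T (Suc j))"
    unfolding q sum.lessThan_Suc_shift by (simp add: assms(1))
  also have "\<dots> = (\<Sum>j<q. R j)" using assms(2) q by simp
  also have "\<dots> = (\<Sum>j<p. R j)" using assms(3) q by simp
  finally show ?thesis .
qed

text \<open>
  From \<open>z u = u x\<close> one gets \<open>z\<^sup>k u = u x\<^sup>k\<close>, so \<open>q = z\<^sup>p - z\<close> satisfies \<open>q u = 0\<close>.
  Invertibility of \<open>u\<close> is not assumed as such. It is enough that \<open>u\<close> acts as the identity on each
  \<open>w\<^sup>m\<close> up to higher powers of \<open>w\<close>: then \<open>q w\<^sup>m = 0\<close> descends from \<open>m = p\<close> to \<open>m = 0\<close>.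
\<close>

lemma unipotent_conjugate_power:
  fixes w x z u :: 'r
  assumes w: "w ^ p = 0" and x: "x ^ p = x" and zu: "z * u = u * x"
    and u: "\<And>m. \<exists>d. u * w ^ m = w ^ m + w ^ Suc m * d"
  shows "z ^ p = z"
proof -
  define q where "q = z ^ p - z"
  have "z ^ k * u = u * x ^ k" for k
    by (induction k) (simp_all add: mult.assoc, metis mult.assoc zu)
  then have qu: "q * u = 0"
    using x zu by (simp add: q_def left_diff_distrib)
  have "q * w ^ (p - m) = 0" if "m \<le> p" for m
    using that
  proof (induction m)
    case (Suc m)
    obtain d where "u * w ^ (p - Suc m) = w ^ (p - Suc m) + w ^ Suc (p - Suc m) * d"
      using u by blast
    moreover have "Suc (p - Suc m) = p - m" using Suc.prems by simp
    ultimately have "q * (u * w ^ (p - Suc m)) = q * w ^ (p - Suc m) + q * w ^ (p - m) * d"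
      by (simp add: distrib_left mult.assoc)
    then show ?case
      using Suc qu by (simp flip: mult.assoc)
  qed (simp add: w)
  from this[of p] show ?thesis by (simp add: q_def)
qed

text \<open>
  Formally \<open>x + s (1 - g) = g\<^sup>s x g\<^sup>-\<^sup>s\<close>, since conjugation by \<open>g\<close> adds \<open>1 - g\<close> to \<open>x\<close>. With
  \<open>w = 1 - g\<close> nilpotent, \<open>g\<^sup>s\<close> stands for the truncated binomial series \<open>u = \<Sum> e\<^sub>j w\<^sup>j\<close>, where
  \<open>e\<^sub>j\<close> is \<open>(-1)\<^sup>j\<close> times the binomial coefficient of \<open>s\<close> over \<open>j\<close>; it only involves \<open>j!\<close> for
  \<open>j < p\<close> and so makes sense in characteristic \<open>p\<close>.
\<close>

lemma twist_power:
  fixes g x s :: 'r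
  assumes g: "g ^ p = 1" and x: "x ^ p = x" and gx: "g * x - x * g = g * (1 - g)"
    and sg: "s * g = g * s" and sx: "s * x = x * s"
  shows "(x + s * (1 - g)) ^ p = x + s * (1 - g)"
proof -
  define w where "w = 1 - g"
  have wp: "w ^ p = 0"
    unfolding w_def using freshman_diff[of 1 g] g by simp
  have xw: "x * w = w * x + w - w * w"
    unfolding w_def using gx by (simp add: algebra_simps)
  have xwj: "x * w ^ j = w ^ j * x + of_nat j * (w ^ j - w ^ Suc j)" for j
  proof (induction j)
    case (Suc j)
    have "x * w ^ Suc j = (x * w ^ j) * w" by (simp add: power_commutes mult.assoc)
    also have "\<dots> = w ^ j * (x * w) + of_nat j * (w ^ Suc j - w ^ Suc (Suc j))"
      by (simp add: Suc distrib_right left_diff_distrib mult.assoc power_commutes)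
    also have "w ^ j * (x * w) = w ^ Suc j * x + (w ^ Suc j - w ^ Suc (Suc j))"
      unfolding xw power_Suc2 by (simp add: distrib_left right_diff_distrib mult.assoc)
    finally show ?case by (simp add: algebra_simps)
  qed simp
  have sw: "s * w = w * s" unfolding w_def using sg by (simp add: algebra_simps)
  obtain iv where iv: "\<And>j. 0 < j \<Longrightarrow> j < p \<Longrightarrow> of_nat (iv j) * of_nat j = (1 :: 'r)"
    using inverse_mod_char by metis
  (* iv (Suc m) inverts Suc m modulo p, so that e satisfies
     (j + 1) e (j + 1) = (j - s) e j. *)
  define e where "e = rec_nat (1 :: 'r) (\<lambda>m em. of_nat (iv (Suc m)) * ((of_nat m - s) * em))"
  have e0: "e 0 = 1" and eS: "\<And>m. e (Suc m) = of_nat (iv (Suc m)) * ((of_nat m - s) * e m)"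
    by (simp_all add: e_def)
  have e_comm: "e j * y = y * e j" if "s * y = y * s" for y j
  proof (induction j)
    case (Suc j)
    have c: "(of_nat j - s) * y = y * (of_nat j - s)"
      using that by (simp add: left_diff_distrib right_diff_distrib mult_of_nat_commute)
    have "(of_nat j - s) * (e j * y) = (of_nat j - s) * y * e j"
      by (simp add: Suc mult.assoc)
    also have "\<dots> = y * ((of_nat j - s) * e j)"
      by (simp add: c mult.assoc)
    finally have *: "(of_nat j - s) * (e j * y) = y * ((of_nat j - s) * e j)" .
    have "e (Suc j) * y = of_nat (iv (Suc j)) * ((of_nat j - s) * (e j * y))"
      by (simp only: eS mult.assoc)
    also have "\<dots> = of_nat (iv (Suc j)) * (y * ((of_nat j - s) * e j))"
      by (simp only: *)
    also have "\<dots> = y * e (Suc j)"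
      unfolding eS by (rule of_nat_left_commute)
    finally show ?case .
  qed (simp add: e0)
  have e_rec: "of_nat (Suc j) * e (Suc j) = (of_nat j - s) * e j" if "Suc j < p" for j
  proof -
    have "of_nat (Suc j) * e (Suc j) = (of_nat (iv (Suc j)) * of_nat (Suc j)) * ((of_nat j - s) * e j)"
      unfolding eS mult.assoc by (rule of_nat_left_commute)
    then show ?thesis using iv[of "Suc j"] that by simp
  qed
  define u where "u = (\<Sum>j<p. e j * w ^ j)"
  have "(x + s * w) * u - u * x = 0"
  proof -
    have "(x + s * w) * (e j * w ^ j) - e j * w ^ j * x =
        of_nat j * e j * w ^ j - (of_nat j - s) * e j * w ^ Suc j" for j
    proof -
      have "x * (e j * w ^ j) = e j * (x * w ^ j)"
        using e_comm[of x j] sx by (simp flip: mult.assoc)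
      also have "\<dots> = e j * w ^ j * x + of_nat j * e j * w ^ j - of_nat j * e j * w ^ Suc j"
        unfolding xwj
        by (simp only: distrib_left right_diff_distrib of_nat_left_commute[of j "e j", symmetric] mult.assoc add_diff_eq)
      finally have 1: "x * (e j * w ^ j) = e j * w ^ j * x + of_nat j * e j * w ^ j - of_nat j * e j * w ^ Suc j" .
      have 2: "s * w * (e j * w ^ j) = s * e j * w ^ Suc j"
        using e_comm[of w j] sw by (simp add: mult.assoc) (simp flip: mult.assoc)
      show ?thesis unfolding distrib_right 1 2 by (simp add: algebra_simps)
    qed
    then have "(x + s * w) * u - u * x =
        (\<Sum>j<p. of_nat j * e j * w ^ j) - (\<Sum>j<p. (of_nat j - s) * e j * w ^ Suc j)"
      unfolding u_def sum_distrib_left sum_distrib_right by (simp flip: sum_subtractf)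
    also have "(\<Sum>j<p. of_nat j * e j * w ^ j) = (\<Sum>j<p. (of_nat j - s) * e j * w ^ Suc j)"
      by (rule telescoping_cancel) (use e_rec wp in \<open>auto simp del: of_nat_Suc power_Suc\<close>)
    finally show ?thesis by simp
  qed
  then have zu: "(x + s * w) * u = u * x" by simp
  have "\<exists>d. u * w ^ m = w ^ m + w ^ Suc m * d" for m
  proof -
    obtain q where q: "p = Suc q" using prime prime_gt_0_nat gr0_implies_Suc by blast
    define v where "v = (\<Sum>j<q. e (Suc j) * w ^ j)"
    have "e (Suc j) * w ^ Suc j * w ^ m = w ^ Suc m * (e (Suc j) * w ^ j)" for j
    proof -
      have 1: "w ^ Suc j * w ^ m = w ^ Suc m * w ^ j"
        by (metis add.commute add_Suc power_add)
      have 2: "e (Suc j) * w ^ Suc m = w ^ Suc m * e (Suc j)"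
        using e_comm[of "w ^ Suc m" "Suc j"] power_commuting_commutes[OF sw[symmetric], of "Suc m"] by simp
      have "e (Suc j) * w ^ Suc j * w ^ m = e (Suc j) * w ^ Suc m * w ^ j"
        by (simp only: mult.assoc 1)
      then show ?thesis by (simp only: 2 mult.assoc)
    qed
    then have "u * w ^ m = w ^ m + w ^ Suc m * v"
      unfolding u_def v_def q sum.lessThan_Suc_shift sum_distrib_left distrib_right sum_distrib_right e0
      by (simp del: power_Suc)
    then show ?thesis by blast
  qed
  from unipotent_conjugate_power[OF wp x zu this] show ?thesis by (simp add: w_def)
qed

text \<open>
  The same device for the antipode. Here \<open>u = \<Sum> t\<^sup>j c\<^sub>j\<close> with \<open>c\<^sub>j\<close> the binomial coefficient of
  \<open>x + j - 1\<close> over \<open>j\<close>, that is, \<open>(1 - t)\<^sup>-\<^sup>x\<close> with all powers of \<open>x\<close> written on the right.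
\<close>

lemma inverse_grouplike_power:
  fixes t x :: 'r
  assumes t: "t ^ p = 0" and x: "x ^ p = x" and xt: "x * t = t * x + t"
  shows "((1 - t) * x) ^ p = (1 - t) * x"
proof -
  have xtj: "x * t ^ j = t ^ j * (x + of_nat j)" for j
  proof (induction j)
    case (Suc j)
    have "x * t ^ Suc j = (x * t ^ j) * t" by (simp add: power_commutes mult.assoc)
    also have "\<dots> = t ^ j * (x * t) + of_nat j * t ^ Suc j"
      by (simp add: Suc distrib_left distrib_right mult.assoc power_commutes mult_of_nat_commute)
         (simp add: power_commutes flip: mult.assoc)
    also have "\<dots> = t ^ Suc j * (x + of_nat (Suc j))"
      unfolding xt power_Suc2 by (simp add: distrib_left mult.assoc mult_of_nat_commute)
    finally show ?case .
  qed simp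
  obtain iv where iv: "\<And>j. 0 < j \<Longrightarrow> j < p \<Longrightarrow> of_nat (iv j) * of_nat j = (1 :: 'r)"
    using inverse_mod_char by metis
  (* As above, iv (Suc m) inverts Suc m, which gives
     (j + 1) c (j + 1) = (x + j) c j. *)
  define c where "c = rec_nat (1 :: 'r) (\<lambda>m cm. of_nat (iv (Suc m)) * ((x + of_nat m) * cm))"
  have c0: "c 0 = 1" and cS: "\<And>m. c (Suc m) = of_nat (iv (Suc m)) * ((x + of_nat m) * c m)"
    by (simp_all add: c_def)
  have c_x: "c j * x = x * c j" for j
  proof (induction j)
    case (Suc j)
    have "(x + of_nat j) * x = x * (x + of_nat j)"
      by (simp add: distrib_left distrib_right mult_of_nat_commute)
    then have "(x + of_nat j) * (c j * x) = x * ((x + of_nat j) * c j)"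
      by (simp add: Suc flip: mult.assoc)
    then have "c (Suc j) * x = of_nat (iv (Suc j)) * (x * ((x + of_nat j) * c j))"
      unfolding cS mult.assoc by (rule arg_cong)
    also have "\<dots> = x * c (Suc j)"
      unfolding cS by (rule of_nat_left_commute)
    finally show ?case .
  qed (simp add: c0)
  have c_rec: "of_nat (Suc j) * c (Suc j) = (x + of_nat j) * c j" if "Suc j < p" for j
  proof -
    have "of_nat (Suc j) * c (Suc j) = (of_nat (iv (Suc j)) * of_nat (Suc j)) * ((x + of_nat j) * c j)"
      unfolding cS mult.assoc by (rule of_nat_left_commute)
    then show ?thesis using iv[of "Suc j"] that by simp
  qed
  have "\<exists>c'. c j * t ^ m = t ^ m * c'" for j m
  proof (induction j)
    case (Suc j)
    then obtain c' where "c j * t ^ m = t ^ m * c'" by blast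
    have "(x + of_nat j) * t ^ m = t ^ m * (x + of_nat m + of_nat j)"
      by (simp add: xtj distrib_right distrib_left mult_of_nat_commute)
    then have "(x + of_nat j) * (t ^ m * c') = t ^ m * ((x + of_nat m + of_nat j) * c')"
      by (simp only: mult.assoc[symmetric])
    moreover have "c (Suc j) * t ^ m = of_nat (iv (Suc j)) * ((x + of_nat j) * (t ^ m * c'))"
      unfolding cS mult.assoc \<open>c j * t ^ m = t ^ m * c'\<close> ..
    ultimately have "c (Suc j) * t ^ m = t ^ m * (of_nat (iv (Suc j)) * ((x + of_nat m + of_nat j) * c'))"
      using of_nat_left_commute[of "iv (Suc j)" "t ^ m"] by simp
    then show ?case by blast
  qed (auto simp: c0 intro: exI[of _ 1])
  then obtain c' where c': "\<And>j m. c j * t ^ m = t ^ m * c' j m" by metis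
  define u where "u = (\<Sum>j<p. t ^ j * c j)"
  have "((1 - t) * x) * u - u * x = 0"
  proof -
    have "((1 - t) * x) * (t ^ j * c j) - t ^ j * c j * x =
        t ^ j * (of_nat j * c j) - t ^ Suc j * ((x + of_nat j) * c j)" for j
    proof -
      have "(1 - t) * x * (t ^ j * c j) = (1 - t) * ((x * t ^ j) * c j)"
        by (simp add: mult.assoc)
      also have "\<dots> = t ^ j * ((x + of_nat j) * c j) - t ^ Suc j * ((x + of_nat j) * c j)"
        unfolding xtj by (simp add: left_diff_distrib mult.assoc)
      finally show ?thesis by (simp add: c_x distrib_right distrib_left mult.assoc)
    qed
    then have "((1 - t) * x) * u - u * x =
        (\<Sum>j<p. t ^ j * (of_nat j * c j)) - (\<Sum>j<p. t ^ Suc j * ((x + of_nat j) * c j))"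
      unfolding u_def sum_distrib_left sum_distrib_right by (simp flip: sum_subtractf)
    also have "(\<Sum>j<p. t ^ j * (of_nat j * c j)) = (\<Sum>j<p. t ^ Suc j * ((x + of_nat j) * c j))"
      by (rule telescoping_cancel) (use c_rec t in \<open>auto simp del: of_nat_Suc power_Suc\<close>)
    finally show ?thesis by simp
  qed
  then have zu: "((1 - t) * x) * u = u * x" by simp
  have "\<exists>d. u * t ^ m = t ^ m + t ^ Suc m * d" for m
  proof -
    obtain q where q: "p = Suc q" using prime prime_gt_0_nat gr0_implies_Suc by blast
    define v where "v = (\<Sum>j<q. t ^ j * c' (Suc j) m)"
    have "t ^ Suc j * c (Suc j) * t ^ m = t ^ Suc m * (t ^ j * c' (Suc j) m)" for j
    proof -
      have "t ^ Suc j * t ^ m = t ^ Suc m * t ^ j"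
        by (metis add.commute add_Suc power_add)
      then show ?thesis by (simp only: mult.assoc c') (simp only: mult.assoc[symmetric])
    qed
    then have "u * t ^ m = t ^ m + t ^ Suc m * v"
      unfolding u_def v_def q sum.lessThan_Suc_shift sum_distrib_left distrib_right sum_distrib_right c0
      by (simp del: power_Suc)
    then show ?thesis by blast
  qed
  from unipotent_conjugate_power[OF t x zu this] show ?thesis .
qed

end

section \<open>The defining relations inside a ring\<close>

text \<open>
  The relations in a type class ring, where simplification with ring axioms is available. The central
  element \<open>a\<close> plays the role of the scalar \<open>\<alpha>\<close>, so that no scalar action is needed here.
\<close>

definition E_relations_hold :: "nat \<Rightarrow> nat \<Rightarrow> 'r::ring_1 \<Rightarrow> 'r \<Rightarrow> 'r \<Rightarrow> 'r \<Rightarrow> bool" where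
  "E_relations_hold p n a g h x \<longleftrightarrow>
     g ^ p = 1 \<and> h ^ n = 1 \<and> g * h = h * g \<and> x ^ p = x \<and>
     g * x - x * g = g * (1 - g) \<and> x * h - h * x = a * (h * (1 - g))"

text \<open>
  The comultiplication respects the relations: apply this to \<open>g \<otimes> 1, h \<otimes> 1, x \<otimes> 1\<close> and to
  \<open>1 \<otimes> g, 1 \<otimes> h, 1 \<otimes> x\<close>. For the \<open>p\<close>-th power, \<open>x + g x'\<close> is the twist of \<open>x + x'\<close> by \<open>s = - x'\<close>, and
  \<open>x + x'\<close> is a sum of commuting elements.
\<close>

lemma E_relations_coproduct:
  fixes a g h x g' h' x' :: "'r::ring_1"
  assumes p: "prime p" "of_nat p = (0 :: 'r)" and a: "\<And>y. a * y = y * a"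
    and rel: "E_relations_hold p n a g h x" and rel': "E_relations_hold p n a g' h' x'"
    and comm: "\<And>y y'. y \<in> {g, h, x} \<Longrightarrow> y' \<in> {g', h', x'} \<Longrightarrow> y' * y = y * y'"
  shows "E_relations_hold p n a (g * g') (h * h') (x + g * x')"
proof -
  have c: "g' * g = g * g'" "h' * g = g * h'" "x' * g = g * x'" "g' * h = h * g'" "h' * h = h * h'"
      "x' * h = h * x'" "g' * x = x * g'" "h' * x = x * h'" "x' * x = x * x'"
    using comm by auto
  have r: "g ^ p = 1" "h ^ n = 1" "g * h = h * g" "x ^ p = x" "g * x = x * g + g - g * g"
      "x * h = h * x + a * h - a * h * g"
    using rel by (auto simp: E_relations_hold_def algebra_simps)
  have r': "g' ^ p = 1" "h' ^ n = 1" "g' * h' = h' * g'" "x' ^ p = x'" "g' * x' = x' * g' + g' - g' * g'"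
      "x' * h' = h' * x' + a * h' - a * h' * g'"
    using rel' by (auto simp: E_relations_hold_def algebra_simps)
  have assoc: "u * (v * z) = w * z" if "u * v = w" for u v w z :: 'r
    using that by (simp flip: mult.assoc)
  have a': "y * (a * z) = a * (y * z)" for y z by (metis a mult.assoc)
  have "(x + x') + (- x') * (1 - g) = x + g * x'"
    by (simp add: algebra_simps c)
  moreover have "((x + x') + (- x') * (1 - g)) ^ p = (x + x') + (- x') * (1 - g)"
  proof (rule twist_power[OF p r(1)])
    show "(x + x') ^ p = x + x'"
      using freshman_commuting[OF p, of x x'] c r r' by simp
  qed (simp_all add: algebra_simps c r)
  ultimately have "(x + g * x') ^ p = x + g * x'" by (simp only:)
  moreover have "(g * g') ^ p = 1" "(h * h') ^ n = 1"
    using r r' c by (simp_all add: power_mult_distrib_commuting)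
  moreover have "g * g' * (h * h') = h * h' * (g * g')"
    by (simp add: mult.assoc c r r' c[THEN assoc] r(3)[THEN assoc])
  moreover have "(g * g') * (x + g * x') - (x + g * x') * (g * g') = (g * g') * (1 - g * g')"
    by (simp add: algebra_simps c r(5) r'(5) c[THEN assoc] r(5)[THEN assoc] r'(5)[THEN assoc])
  moreover have "(x + g * x') * (h * h') - (h * h') * (x + g * x') = a * ((h * h') * (1 - g * g'))"
    by (simp add: algebra_simps c r(3,6) r'(6) c[THEN assoc] r(3,6)[THEN assoc] r'(3)[THEN assoc] r'(6)[THEN assoc] a')
  ultimately show ?thesis by (simp add: E_relations_hold_def)
qed

text \<open>
  The inverses \<open>\<gamma>\<close> and \<open>\<eta>\<close> of \<open>g\<close> and \<open>h\<close> and \<open>\<xi> = - \<gamma> x\<close> satisfy the relations with every product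
  reversed, as is required of the values of an antipode. For \<open>\<xi>\<^sup>p = \<xi>\<close> the nilpotent
  element is \<open>t = 1 - \<gamma>\<close>.
\<close>

lemma E_relations_antipode:
  fixes a g h x :: "'r::ring_1"
  assumes p: "prime p" "of_nat p = (0 :: 'r)" and n: "n > 0" and a: "\<And>y. a * y = y * a"
    and rel: "E_relations_hold p n a g h x"
  defines "\<gamma> \<equiv> g ^ (p - 1)" and "\<eta> \<equiv> h ^ (n - 1)"
  defines "\<xi> \<equiv> - (\<gamma> * x)"
  shows "\<gamma> ^ p = 1" "\<eta> ^ n = 1" "\<eta> * \<gamma> = \<gamma> * \<eta>" "\<xi> ^ p = \<xi>"
    "\<xi> * \<gamma> - \<gamma> * \<xi> = (1 - \<gamma>) * \<gamma>" "\<eta> * \<xi> - \<xi> * \<eta> = a * ((1 - \<gamma>) * \<eta>)"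
    "\<gamma> * g = 1" "g * \<gamma> = 1" "\<eta> * h = 1" "h * \<eta> = 1"
proof -
  have r: "g ^ p = 1" "h ^ n = 1" "g * h = h * g" "x ^ p = x" "g * x - x * g = g - g * g"
      "x * h - h * x = a * (h * (1 - g))"
    using rel by (auto simp: E_relations_hold_def algebra_simps)
  have pS: "p = Suc (p - 1)" "n = Suc (n - 1)"
    using p n prime_gt_0_nat by (simp_all add: Suc_diff_1)
  show g\<gamma>: "g * \<gamma> = 1" and h\<eta>: "h * \<eta> = 1"
    using r(1,2) pS by (metis power_Suc \<gamma>_def, metis power_Suc \<eta>_def)
  show \<gamma>g: "\<gamma> * g = 1" and \<eta>h: "\<eta> * h = 1"
    using r(1,2) pS by (metis power_Suc2 \<gamma>_def, metis power_Suc2 \<eta>_def)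
  show \<gamma>p: "\<gamma> ^ p = 1" and "\<eta> ^ n = 1"
    using r(1,2) by (simp_all add: \<gamma>_def \<eta>_def mult.commute flip: power_mult)
      (simp_all add: power_mult mult.commute[of _ p] mult.commute[of _ n])
  show \<eta>\<gamma>: "\<eta> * \<gamma> = \<gamma> * \<eta>"
    unfolding \<gamma>_def \<eta>_def by (metis power_commuting_commutes r(3))
  have \<gamma>x: "\<gamma> * x - x * \<gamma> = 1 - \<gamma>"
  proof -
    have "\<gamma> * (g * x - x * g) * \<gamma> = (\<gamma> * g) * x * \<gamma> - \<gamma> * x * (g * \<gamma>)"
      by (simp add: algebra_simps)
    also have "\<dots> = x * \<gamma> - \<gamma> * x" unfolding g\<gamma> \<gamma>g by simp
    finally have "x * \<gamma> - \<gamma> * x = \<gamma> * (g - g * g) * \<gamma>" unfolding r(5) ..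
    also have "\<dots> = (\<gamma> * g) * \<gamma> - (\<gamma> * g) * (g * \<gamma>)"
      by (simp add: algebra_simps)
    also have "\<dots> = \<gamma> - 1" unfolding g\<gamma> \<gamma>g by simp
    finally show ?thesis by (simp add: algebra_simps)
  qed
  have \<eta>x: "\<eta> * x - x * \<eta> = a * ((1 - g) * \<eta>)"
  proof -
    have "\<eta> * (x * h - h * x) * \<eta> = \<eta> * x * (h * \<eta>) - (\<eta> * h) * x * \<eta>"
      by (simp add: algebra_simps)
    moreover have "\<eta> * (a * (h * (1 - g))) * \<eta> = a * ((\<eta> * h) * (1 - g) * \<eta>)"
      by (metis a mult.assoc)
    ultimately show ?thesis
      unfolding r(6) h\<eta> \<eta>h by simp
  qed
  have "((1 - (1 - \<gamma>)) * x) ^ p = (1 - (1 - \<gamma>)) * x"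
  proof (rule inverse_grouplike_power[OF p])
    show "(1 - \<gamma>) ^ p = 0"
      using freshman_diff[OF p, of 1 \<gamma>] \<gamma>p by simp
    show "x * (1 - \<gamma>) = (1 - \<gamma>) * x + (1 - \<gamma>)"
      using \<gamma>x by (simp add: algebra_simps)
  qed fact
  then show "\<xi> ^ p = \<xi>"
    using uminus_power_char[OF p, of "\<gamma> * x"] by (simp add: \<xi>_def)
  have "\<xi> * \<gamma> - \<gamma> * \<xi> = \<gamma> * (\<gamma> * x - x * \<gamma>)"
    by (simp add: \<xi>_def algebra_simps)
  then show "\<xi> * \<gamma> - \<gamma> * \<xi> = (1 - \<gamma>) * \<gamma>"
    unfolding \<gamma>x by (simp add: algebra_simps)
  have "\<eta> * \<xi> - \<xi> * \<eta> = - (\<gamma> * (\<eta> * x - x * \<eta>))"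
    unfolding \<xi>_def using \<eta>\<gamma> by (simp add: algebra_simps) (simp flip: mult.assoc)
  also have "\<dots> = a * (- (\<gamma> * ((1 - g) * \<eta>)))"
    unfolding \<eta>x by (metis a mult.assoc mult_minus_right)
  also have "- (\<gamma> * ((1 - g) * \<eta>)) = (1 - \<gamma>) * \<eta>"
    using \<gamma>g by (simp add: algebra_simps) (simp flip: mult.assoc)
  finally show "\<eta> * \<xi> - \<xi> * \<eta> = a * ((1 - \<gamma>) * \<eta>)" .
qed

text \<open>
  \<open>y \<mapsto> x y - y x\<close> is a derivation with \<open>h \<mapsto> \<alpha> h (1 - g)\<close> and \<open>g \<mapsto> - g (1 - g)\<close>, and \<open>1 - g\<close> commutes
  with \<open>g\<close> and \<open>h\<close>. This formula is what links the parameter to the prime field.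
\<close>

lemma commutator_grouplike:
  fixes a g h x :: "'r::ring_1"
  assumes a: "\<And>y. a * y = y * a" and rel: "E_relations_hold p n a g h x"
  shows "x * (h ^ i * g ^ j) - h ^ i * g ^ j * x = (of_nat i * a - of_nat j) * (h ^ i * g ^ j * (1 - g))"
proof -
  have r: "g * h = h * g" "x * g = g * x - g * (1 - g)" "x * h = h * x + a * (h * (1 - g))"
    using rel by (auto simp: E_relations_hold_def algebra_simps)
  have gh: "g * h ^ i = h ^ i * g" for i
    using power_commuting_commutes[of h g i] r(1) by simp
  have a': "y * (a * z) = a * (y * z)" for y z by (metis a mult.assoc)
  have h: "x * h ^ i = h ^ i * x + of_nat i * (a * (h ^ i * (1 - g)))" for i
  proof (induction i)
    case (Suc i)
    have "x * h ^ Suc i = (x * h ^ i) * h" by (simp add: power_Suc2 mult.assoc del: power_Suc)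
    also have "\<dots> = h ^ i * (x * h) + of_nat i * (a * (h ^ i * ((1 - g) * h)))"
      by (simp add: Suc distrib_right mult.assoc)
    also have "(1 - g) * h = h * (1 - g)"
      by (simp add: algebra_simps r(1))
    also have "h ^ i * (x * h) = h ^ Suc i * x + a * (h ^ Suc i * (1 - g))"
      unfolding r(3) by (simp only: distrib_left a' power_Suc2 mult.assoc)
    finally show ?case
      by (simp only: power_Suc2 mult.assoc of_nat_Suc distrib_right mult_1_left add.assoc)
  qed simp
  have g: "x * g ^ j = g ^ j * x - of_nat j * (g ^ j * (1 - g))" for j
  proof (induction j)
    case (Suc j)
    have "x * g ^ Suc j = (x * g ^ j) * g" by (simp add: power_Suc2 mult.assoc del: power_Suc)
    also have "\<dots> = g ^ j * (x * g) - of_nat j * (g ^ j * ((1 - g) * g))"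
      by (simp add: Suc left_diff_distrib mult.assoc)
    also have "(1 - g) * g = g * (1 - g)"
      by (simp add: algebra_simps)
    also have "g ^ j * (x * g) = g ^ Suc j * x - g ^ Suc j * (1 - g)"
      unfolding r(2) by (simp only: right_diff_distrib power_Suc2 mult.assoc)
    finally show ?case
      by (simp only: power_Suc2 mult.assoc of_nat_Suc distrib_right mult_1_left diff_diff_eq)
  qed simp
  have comm: "(1 - g) * g ^ j = g ^ j * (1 - g)"
    by (simp add: algebra_simps power_commutes)
  have "x * (h ^ i * g ^ j) = (x * h ^ i) * g ^ j" by (simp only: mult.assoc)
  also have "\<dots> = h ^ i * (x * g ^ j) + of_nat i * (a * (h ^ i * ((1 - g) * g ^ j)))"
    unfolding h by (simp only: distrib_right mult.assoc)
  also have "h ^ i * (x * g ^ j) = h ^ i * g ^ j * x - of_nat j * (h ^ i * g ^ j * (1 - g))"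
    unfolding g by (simp only: right_diff_distrib mult.assoc of_nat_left_commute[of j "h ^ i"])
  finally show ?thesis
    unfolding comm by (simp add: left_diff_distrib mult.assoc)
qed

lemma E_relations_change_h:
  fixes a g h x :: "'r::ring_1"
  assumes p: "prime p" "of_nat p = (0 :: 'r)" "p dvd n" and a: "\<And>y. a * y = y * a"
    and rel: "E_relations_hold p n a g h x"
  shows "E_relations_hold p n (of_nat i * a - of_nat j) g (h ^ i * g ^ j) x"
proof -
  have r: "g ^ p = 1" "h ^ n = 1" "g * h = h * g"
    using rel by (auto simp: E_relations_hold_def)
  have gh: "g * h ^ i = h ^ i * g" for i
    using power_commuting_commutes[of h g i] r(3) by simp
  have "g ^ n = 1"
    using p(3) r(1) by (auto simp: power_mult)
  then have "(h ^ i) ^ n = 1" "(g ^ j) ^ n = 1"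
    using r(2) by (metis power_mult mult.commute power_one)+
  then have "(h ^ i * g ^ j) ^ n = 1"
    using power_commuting_commutes[OF gh[of i], of j] by (simp add: power_mult_distrib_commuting)
  moreover have "g * (h ^ i * g ^ j) = h ^ i * g ^ j * g"
    by (simp add: gh mult.assoc power_commutes flip: mult.assoc) (simp add: power_commutes mult.assoc)
  ultimately show ?thesis
    using rel commutator_grouplike[OF a rel] by (simp add: E_relations_hold_def)
qed

section \<open>Transfer of ring identities to algebras with carriers\<close>

text \<open>
  The identities so far hold in type class rings, while the algebras of interest are records with
  carriers. A type cannot depend on such a record, so one takes the product of all algebras over a
  given element type at once: it is a type class ring, its components are ring maps onto the
  algebras, and an identity there projects to each of them. The additional factor \<open>k\<close> guarantees
  \<open>0 \<noteq> 1\<close>, which would fail if all algebras on the element type were zero.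
\<close>

typedef (overloaded) ('k::field, 'a) alg_product =
  "{(c :: 'k, f :: ('k, 'a) module \<Rightarrow> 'a). \<forall>R. if k_algebra R then f R \<in> carrier R else f R = undefined}"
proof -
  have "\<zero>\<^bsub>R\<^esub> \<in> carrier R" if "k_algebra R" for R :: "('k, 'a) module"
    using that by (intro ring.ring_simprules) (simp add: k_algebra_def)
  then show ?thesis
    by (intro exI[of _ "(0, \<lambda>R. if k_algebra R then \<zero>\<^bsub>R\<^esub> else undefined)"]) auto
qed

definition scalar_component :: "('k::field, 'a) alg_product \<Rightarrow> 'k" where
  "scalar_component y = fst (Rep_alg_product y)"

definition component :: "('k::field, 'a) module \<Rightarrow> ('k, 'a) alg_product \<Rightarrow> 'a" where
  "component R y = snd (Rep_alg_product y) R"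

definition family :: "'k::field \<Rightarrow> (('k, 'a) module \<Rightarrow> 'a) \<Rightarrow> ('k, 'a) alg_product" where
  "family c f = Abs_alg_product (c, \<lambda>R. if k_algebra R then f R else undefined)"

lemma component_closed [simp]: "k_algebra R \<Longrightarrow> component R y \<in> carrier R"
  using Rep_alg_product[of y] by (auto simp: component_def case_prod_beta)

lemma alg_product_eqI:
  assumes "scalar_component y = scalar_component z" "\<And>R. k_algebra R \<Longrightarrow> component R y = component R z"
  shows "y = z"
proof -
  have "snd (Rep_alg_product y) R = snd (Rep_alg_product z) R" for R
    using assms(2)[of R] Rep_alg_product[of y] Rep_alg_product[of z]
    by (cases "k_algebra R") (auto simp: component_def case_prod_beta)
  then show ?thesis
    using assms(1) by (simp add: scalar_component_def prod_eq_iff fun_eq_iff flip: Rep_alg_product_inject)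
qed

lemma
  fixes f :: "('k::field, 'a) module \<Rightarrow> 'a"
  assumes "\<And>R. k_algebra R \<Longrightarrow> f R \<in> carrier R"
  shows component_family: "k_algebra R \<Longrightarrow> component R (family c f) = f R"
    and scalar_component_family: "scalar_component (family c f) = c"
proof -
  have "(c, \<lambda>R. if k_algebra R then f R else undefined) \<in>
     {(c :: 'k, f :: ('k, 'a) module \<Rightarrow> 'a). \<forall>R. if k_algebra R then f R \<in> carrier R else f R = undefined}"
    using assms by simp
  from Abs_alg_product_inverse[OF this]
  show "k_algebra R \<Longrightarrow> component R (family c f) = f R" "scalar_component (family c f) = c"
    by (simp_all add: component_def scalar_component_def family_def)
qed

instantiation alg_product :: (field, type) ring_1
begin

definition "0 = family 0 (\<lambda>R. \<zero>\<^bsub>R\<^esub>)"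
definition "1 = family 1 (\<lambda>R. \<one>\<^bsub>R\<^esub>)"
definition "y + z = family (scalar_component y + scalar_component z) (\<lambda>R. component R y \<oplus>\<^bsub>R\<^esub> component R z)"
definition "- y = family (- scalar_component y) (\<lambda>R. \<ominus>\<^bsub>R\<^esub> component R y)"
definition "y - z = family (scalar_component y - scalar_component z) (\<lambda>R. component R y \<ominus>\<^bsub>R\<^esub> component R z)"
definition "y * z = family (scalar_component y * scalar_component z) (\<lambda>R. component R y \<otimes>\<^bsub>R\<^esub> component R z)"

lemma ring_if_k_algebra: "k_algebra R \<Longrightarrow> ring R"
  by (simp add: k_algebra_def)

lemmas alg_product_defs = zero_alg_product_def one_alg_product_def plus_alg_product_def
  uminus_alg_product_def minus_alg_product_def times_alg_product_def

lemma component_simps: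
  assumes "k_algebra R"
  shows "component R 0 = \<zero>\<^bsub>R\<^esub>" "component R 1 = \<one>\<^bsub>R\<^esub>"
    "component R (y + z) = component R y \<oplus>\<^bsub>R\<^esub> component R z"
    "component R (- y) = \<ominus>\<^bsub>R\<^esub> component R y"
    "component R (y - z) = component R y \<ominus>\<^bsub>R\<^esub> component R z"
    "component R (y * z) = component R y \<otimes>\<^bsub>R\<^esub> component R z"
  unfolding alg_product_defs
  by (subst component_family; simp add: assms ring.ring_simprules ring_if_k_algebra)+

lemma scalar_component_simps [simp]:
  "scalar_component 0 = 0" "scalar_component 1 = 1"
  "scalar_component (y + z) = scalar_component y + scalar_component z"
  "scalar_component (- y) = - scalar_component y"
  "scalar_component (y - z) = scalar_component y - scalar_component z"
  "scalar_component (y * z) = scalar_component y * scalar_component z"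
  unfolding alg_product_defs
  by (subst scalar_component_family; simp add: ring.ring_simprules ring_if_k_algebra)+

instance
proof
  fix y z w :: "('a, 'b) alg_product"
  have "(0 :: ('a, 'b) alg_product) \<noteq> 1 "
    using scalar_component_simps(1,2) by (metis zero_neq_one)
  then show "(0 :: ('a, 'b) alg_product) \<noteq> 1" .
qed (rule alg_product_eqI;
     simp add: component_simps ring.ring_simprules ring_if_k_algebra monoid.r_one ring.is_monoid algebra_simps)+

end

lemma component_power:
  "k_algebra R \<Longrightarrow> component R (y ^ m) = component R y [^]\<^bsub>R\<^esub> m"
proof (induction m)
  case (Suc m)
  interpret R: k_alg R by (rule k_alg.intro) fact
  show ?case using Suc by (simp add: component_simps power_Suc2 del: power_Suc)
next
  case 0
  interpret R: k_alg R by (rule k_alg.intro) fact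
  show ?case using 0 by (simp add: component_simps)
qed

lemma component_of_nat:
  "k_algebra R \<Longrightarrow> component R (of_nat m :: ('k::field, 'a) alg_product) = (of_nat m :: 'k) \<odot>\<^bsub>R\<^esub> \<one>\<^bsub>R\<^esub>"
proof (induction m)
  case (Suc m)
  interpret R: k_alg R by (rule k_alg.intro) fact
  show ?case using Suc by (simp add: component_simps R.smult_add_left)
next
  case 0
  interpret R: k_alg R by (rule k_alg.intro) fact
  show ?case using 0 by (simp add: component_simps)
qed

lemma scalar_component_of_nat [simp]: "scalar_component (of_nat m) = of_nat m"
  by (induction m) simp_all

lemma scalar_component_power [simp]: "scalar_component (y ^ m) = scalar_component y ^ m"
  by (induction m) simp_all

lemma alg_product_char: "of_nat CHAR('k) = (0 :: ('k::field, 'a) alg_product)"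
proof (rule alg_product_eqI)
  fix R :: "('k, 'a) module" assume R: "k_algebra R"
  interpret R: k_alg R by (rule k_alg.intro) fact
  show "component R (of_nat CHAR('k)) = component R 0"
    using R by (simp add: component_of_nat component_simps)
qed simp

text \<open>
  Changes one component. Elements of \<open>R\<close> that satisfy the relations are lifted to the product by
  putting them over the trivial solution \<open>g = h = 1\<close>, \<open>x = 0\<close> in all other components.
\<close>

definition put :: "('k::field, 'a) module \<Rightarrow> 'a \<Rightarrow> ('k, 'a) alg_product \<Rightarrow> ('k, 'a) alg_product" where
  "put R a y = family (scalar_component y) (\<lambda>R'. if R' = R then a else component R' y)"

lemma
  assumes "a \<in> carrier R"
  shows component_put: "k_algebra R' \<Longrightarrow> component R' (put R a y) = (if R' = R then a else component R' y)"
    and scalar_component_put: "scalar_component (put R a y) = scalar_component y"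
  unfolding put_def
  by (subst component_family scalar_component_family; use assms in simp)+

text \<open>
  The relations in an algebra with carrier; the algebra maps from \<open>E\<^sub>\<alpha>\<close> to \<open>B\<close> correspond to such triples.
\<close>

definition E_triple ::
    "('k::field, 'a, 'm) module_scheme \<Rightarrow> nat \<Rightarrow> nat \<Rightarrow> 'k \<Rightarrow> 'a \<Rightarrow> 'a \<Rightarrow> 'a \<Rightarrow> bool" where
  "E_triple B p n \<alpha> g h x \<longleftrightarrow> g \<in> carrier B \<and> h \<in> carrier B \<and> x \<in> carrier B \<and>
     g [^]\<^bsub>B\<^esub> p = \<one>\<^bsub>B\<^esub> \<and> h [^]\<^bsub>B\<^esub> n = \<one>\<^bsub>B\<^esub> \<and> g \<otimes>\<^bsub>B\<^esub> h = h \<otimes>\<^bsub>B\<^esub> g \<and> x [^]\<^bsub>B\<^esub> p = x \<and>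
     g \<otimes>\<^bsub>B\<^esub> x \<ominus>\<^bsub>B\<^esub> x \<otimes>\<^bsub>B\<^esub> g = g \<otimes>\<^bsub>B\<^esub> (\<one>\<^bsub>B\<^esub> \<ominus>\<^bsub>B\<^esub> g) \<and>
     x \<otimes>\<^bsub>B\<^esub> h \<ominus>\<^bsub>B\<^esub> h \<otimes>\<^bsub>B\<^esub> x = \<alpha> \<odot>\<^bsub>B\<^esub> (h \<otimes>\<^bsub>B\<^esub> (\<one>\<^bsub>B\<^esub> \<ominus>\<^bsub>B\<^esub> g))"

lemma trivial_algebra_identities:
  assumes "k_algebra R"
  shows "\<one>\<^bsub>R\<^esub> [^]\<^bsub>R\<^esub> (m::nat) = \<one>\<^bsub>R\<^esub>" "m > 0 \<Longrightarrow> \<zero>\<^bsub>R\<^esub> [^]\<^bsub>R\<^esub> m = \<zero>\<^bsub>R\<^esub>" "\<one>\<^bsub>R\<^esub> \<otimes>\<^bsub>R\<^esub> \<one>\<^bsub>R\<^esub> = \<one>\<^bsub>R\<^esub>"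
    "\<one>\<^bsub>R\<^esub> \<ominus>\<^bsub>R\<^esub> \<one>\<^bsub>R\<^esub> = \<zero>\<^bsub>R\<^esub>" "\<zero>\<^bsub>R\<^esub> \<ominus>\<^bsub>R\<^esub> \<zero>\<^bsub>R\<^esub> = \<zero>\<^bsub>R\<^esub>" "\<zero>\<^bsub>R\<^esub> \<otimes>\<^bsub>R\<^esub> \<zero>\<^bsub>R\<^esub> = \<zero>\<^bsub>R\<^esub>"
    "\<one>\<^bsub>R\<^esub> \<otimes>\<^bsub>R\<^esub> \<zero>\<^bsub>R\<^esub> = \<zero>\<^bsub>R\<^esub>" "\<zero>\<^bsub>R\<^esub> \<otimes>\<^bsub>R\<^esub> \<one>\<^bsub>R\<^esub> = \<zero>\<^bsub>R\<^esub>"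
proof -
  interpret R: k_alg R by (rule k_alg.intro) fact
  show "\<one>\<^bsub>R\<^esub> [^]\<^bsub>R\<^esub> m = \<one>\<^bsub>R\<^esub>" "m > 0 \<Longrightarrow> \<zero>\<^bsub>R\<^esub> [^]\<^bsub>R\<^esub> m = \<zero>\<^bsub>R\<^esub>" "\<one>\<^bsub>R\<^esub> \<otimes>\<^bsub>R\<^esub> \<one>\<^bsub>R\<^esub> = \<one>\<^bsub>R\<^esub>"
    "\<one>\<^bsub>R\<^esub> \<ominus>\<^bsub>R\<^esub> \<one>\<^bsub>R\<^esub> = \<zero>\<^bsub>R\<^esub>" "\<zero>\<^bsub>R\<^esub> \<ominus>\<^bsub>R\<^esub> \<zero>\<^bsub>R\<^esub> = \<zero>\<^bsub>R\<^esub>" "\<zero>\<^bsub>R\<^esub> \<otimes>\<^bsub>R\<^esub> \<zero>\<^bsub>R\<^esub> = \<zero>\<^bsub>R\<^esub>"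
    "\<one>\<^bsub>R\<^esub> \<otimes>\<^bsub>R\<^esub> \<zero>\<^bsub>R\<^esub> = \<zero>\<^bsub>R\<^esub>" "\<zero>\<^bsub>R\<^esub> \<otimes>\<^bsub>R\<^esub> \<one>\<^bsub>R\<^esub> = \<zero>\<^bsub>R\<^esub>"
    by (auto simp: R.diff_self R.nat_pow_zero)
qed

lemma component_scalar:
  assumes B: "k_algebra B" and a: "component B a = \<alpha> \<odot>\<^bsub>B\<^esub> \<one>\<^bsub>B\<^esub>"
  shows "component B (of_nat i * a - of_nat j) = (of_nat i * \<alpha> - of_nat j) \<odot>\<^bsub>B\<^esub> \<one>\<^bsub>B\<^esub>"
proof -
  interpret B: k_alg B by (rule k_alg.intro) fact
  have "(of_nat i * \<alpha> - of_nat j) \<odot>\<^bsub>B\<^esub> \<one>\<^bsub>B\<^esub> =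
      (of_nat i * \<alpha>) \<odot>\<^bsub>B\<^esub> \<one>\<^bsub>B\<^esub> \<oplus>\<^bsub>B\<^esub> (- 1) \<odot>\<^bsub>B\<^esub> (of_nat j \<odot>\<^bsub>B\<^esub> \<one>\<^bsub>B\<^esub>)"
    by (simp add: B.smult_smult flip: B.smult_add_left)
  then show ?thesis
    using B a by (simp add: component_simps component_of_nat B.smult_mult_left B.smult_smult B.minus_eq
        flip: B.smult_minus_one)
qed

lemma E_triple_lift:
  fixes B :: "('k::field, 'a) module"
  assumes B: "k_algebra B" and p: "p > 0" and t: "E_triple B p n \<alpha> g h x"
  shows "E_relations_hold p n (put B (\<alpha> \<odot>\<^bsub>B\<^esub> \<one>\<^bsub>B\<^esub>) 0) (put B g 1) (put B h 1) (put B x 0)"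
proof -
  interpret B: k_alg B by (rule k_alg.intro) fact
  have c: "g \<in> carrier B" "h \<in> carrier B" "x \<in> carrier B" "\<alpha> \<odot>\<^bsub>B\<^esub> \<one>\<^bsub>B\<^esub> \<in> carrier B"
    using t by (auto simp: E_triple_def)
  note put = c[THEN component_put] c[THEN scalar_component_put]
  have "\<alpha> \<odot>\<^bsub>B\<^esub> (h \<otimes>\<^bsub>B\<^esub> (\<one>\<^bsub>B\<^esub> \<ominus>\<^bsub>B\<^esub> g)) = (\<alpha> \<odot>\<^bsub>B\<^esub> \<one>\<^bsub>B\<^esub>) \<otimes>\<^bsub>B\<^esub> (h \<otimes>\<^bsub>B\<^esub> (\<one>\<^bsub>B\<^esub> \<ominus>\<^bsub>B\<^esub> g))"
    using c by (simp add: B.smult_mult_left)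
  then have rel: "g [^]\<^bsub>B\<^esub> p = \<one>\<^bsub>B\<^esub>" "h [^]\<^bsub>B\<^esub> n = \<one>\<^bsub>B\<^esub>" "g \<otimes>\<^bsub>B\<^esub> h = h \<otimes>\<^bsub>B\<^esub> g" "x [^]\<^bsub>B\<^esub> p = x"
     "g \<otimes>\<^bsub>B\<^esub> x \<ominus>\<^bsub>B\<^esub> x \<otimes>\<^bsub>B\<^esub> g = g \<otimes>\<^bsub>B\<^esub> (\<one>\<^bsub>B\<^esub> \<ominus>\<^bsub>B\<^esub> g)"
     "x \<otimes>\<^bsub>B\<^esub> h \<ominus>\<^bsub>B\<^esub> h \<otimes>\<^bsub>B\<^esub> x = (\<alpha> \<odot>\<^bsub>B\<^esub> \<one>\<^bsub>B\<^esub>) \<otimes>\<^bsub>B\<^esub> (h \<otimes>\<^bsub>B\<^esub> (\<one>\<^bsub>B\<^esub> \<ominus>\<^bsub>B\<^esub> g))"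
    using t by (auto simp: E_triple_def)
  show ?thesis
    unfolding E_relations_hold_def
    by (intro conjI alg_product_eqI)
       (use p in \<open>simp_all add: put component_simps component_power rel trivial_algebra_identities zero_power\<close>)
qed

lemma put_scalar_central:
  fixes B :: "('k::field, 'a) module"
  assumes B: "k_algebra B"
  shows "put B (\<alpha> \<odot>\<^bsub>B\<^esub> \<one>\<^bsub>B\<^esub>) 0 * y = y * put B (\<alpha> \<odot>\<^bsub>B\<^esub> \<one>\<^bsub>B\<^esub>) 0"
proof (rule alg_product_eqI)
  interpret B: k_alg B by (rule k_alg.intro) fact
  have c: "\<alpha> \<odot>\<^bsub>B\<^esub> \<one>\<^bsub>B\<^esub> \<in> carrier B" by simp
  fix R :: "('k, 'a) module" assume R: "k_algebra R"
  interpret R: k_alg R by (rule k_alg.intro) fact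
  show "component R (put B (\<alpha> \<odot>\<^bsub>B\<^esub> \<one>\<^bsub>B\<^esub>) 0 * y) = component R (y * put B (\<alpha> \<odot>\<^bsub>B\<^esub> \<one>\<^bsub>B\<^esub>) 0)"
    using R component_closed[OF R, of y] component_closed[OF B, of y]
    by (cases "R = B") (simp_all add: component_simps component_put[OF c] B.smult_mult_left B.smult_mult_right)
qed (simp add: scalar_component_put[OF k_alg.smult_closed[OF k_alg.intro[OF B]]]
      ring.ring_simprules ring_if_k_algebra B)

lemma E_triple_project:
  fixes B :: "('k::field, 'a) module"
  assumes B: "k_algebra B" and a: "component B a = \<alpha> \<odot>\<^bsub>B\<^esub> \<one>\<^bsub>B\<^esub>"
    and rel: "E_relations_hold p n a g h x"
  shows "E_triple B p n \<alpha> (component B g) (component B h) (component B x)"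
proof -
  interpret B: k_alg B by (rule k_alg.intro) fact
  note [simp] = component_simps[OF B, symmetric] component_power[OF B, symmetric]
  have "\<alpha> \<odot>\<^bsub>B\<^esub> (component B h \<otimes>\<^bsub>B\<^esub> (\<one>\<^bsub>B\<^esub> \<ominus>\<^bsub>B\<^esub> component B g)) = component B (a * (h * (1 - g)))"
    using B by (simp add: component_simps[OF B] a B.smult_mult_left del: component_simps[OF B, symmetric])
  then show ?thesis
    using rel B by (simp add: E_triple_def E_relations_hold_def)
qed

lemma E_triple_coproduct:
  fixes B :: "('k::field, 'a) module"
  assumes B: "k_algebra B" and p: "p = CHAR('k)" "p > 0"
    and t: "E_triple B p n \<alpha> g h x" and t': "E_triple B p n \<alpha> g' h' x'"
    and comm: "\<And>y y'. y \<in> {g, h, x} \<Longrightarrow> y' \<in> {g', h', x'} \<Longrightarrow> y' \<otimes>\<^bsub>B\<^esub> y = y \<otimes>\<^bsub>B\<^esub> y'"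
  shows "E_triple B p n \<alpha> (g \<otimes>\<^bsub>B\<^esub> g') (h \<otimes>\<^bsub>B\<^esub> h') (x \<oplus>\<^bsub>B\<^esub> g \<otimes>\<^bsub>B\<^esub> x')"
proof -
  interpret B: k_alg B by (rule k_alg.intro) fact
  have c: "g \<in> carrier B" "h \<in> carrier B" "x \<in> carrier B" "g' \<in> carrier B" "h' \<in> carrier B" "x' \<in> carrier B"
      "\<alpha> \<odot>\<^bsub>B\<^esub> \<one>\<^bsub>B\<^esub> \<in> carrier B"
    using t t' by (auto simp: E_triple_def)
  note put = c[THEN component_put] c[THEN scalar_component_put]
  have prime: "prime p" using p prime_CHAR_semidom[where ?'a = 'k] by simp
  have char: "of_nat p = (0 :: ('k, 'a) alg_product)" using alg_product_char p by simp
  have comm': "put B y' d' * put B y d = put B y d * put B y' d'"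
    if "y \<in> {g, h, x}" "y' \<in> {g', h', x'}" "d \<in> {0, 1}" "d' \<in> {0, 1}" for y y' d d'
  proof (rule alg_product_eqI)
    have y: "y \<in> carrier B" "y' \<in> carrier B" using that c by auto
    fix R :: "('k, 'a) module" assume R: "k_algebra R"
    interpret R: k_alg R by (rule k_alg.intro) fact
    show "component R (put B y' d' * put B y d) = component R (put B y d * put B y' d')"
      using R comm[OF that(1,2)] that(3,4) by (auto simp: component_simps y[THEN component_put])
  qed (use that c in \<open>auto simp: put\<close>)
  have "E_relations_hold p n (put B (\<alpha> \<odot>\<^bsub>B\<^esub> \<one>\<^bsub>B\<^esub>) 0) (put B g 1 * put B g' 1) (put B h 1 * put B h' 1)
      (put B x 0 + put B g 1 * put B x' 0)"
    by (rule E_relations_coproduct[OF prime char put_scalar_central[OF B] E_triple_lift[OF B p(2) t]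
          E_triple_lift[OF B p(2) t']])
       (use comm' in \<open>auto simp del: One_nat_def\<close>)
  from E_triple_project[OF B _ this, of \<alpha>] show ?thesis
    using B by (simp add: put component_simps)
qed

text \<open>
  An antipode reverses products; as a map into the opposite algebra it becomes an algebra map, which
  the universal property can produce.
\<close>

definition opposite_algebra :: "('k, 'a) module \<Rightarrow> ('k, 'a) module" where
  "opposite_algebra B = B\<lparr>monoid.mult := (\<lambda>a b. b \<otimes>\<^bsub>B\<^esub> a)\<rparr>"

lemma opposite_algebra_simps [simp]:
  "carrier (opposite_algebra B) = carrier B" "\<one>\<^bsub>opposite_algebra B\<^esub> = \<one>\<^bsub>B\<^esub>" "\<zero>\<^bsub>opposite_algebra B\<^esub> = \<zero>\<^bsub>B\<^esub>"
  "a \<oplus>\<^bsub>opposite_algebra B\<^esub> b = a \<oplus>\<^bsub>B\<^esub> b" "a \<otimes>\<^bsub>opposite_algebra B\<^esub> b = b \<otimes>\<^bsub>B\<^esub> a"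
  "c \<odot>\<^bsub>opposite_algebra B\<^esub> a = c \<odot>\<^bsub>B\<^esub> a" "a \<ominus>\<^bsub>opposite_algebra B\<^esub> b = a \<ominus>\<^bsub>B\<^esub> b"
  by (simp_all add: opposite_algebra_def a_minus_def a_inv_def)

lemma k_algebra_opposite:
  assumes "k_algebra B"
  shows "k_algebra (opposite_algebra B)"
proof -
  interpret B: k_alg B by (rule k_alg.intro) fact
  show ?thesis
  proof (rule k_algebraI)
    show "ring (opposite_algebra B)"
      by (intro ringI abelian_groupI monoidI)
         (auto simp: B.a_ac B.m_assoc B.l_distr B.r_distr intro: B.add.l_inv_ex)
  qed (auto simp: B.smult_add_left B.smult_add_right B.smult_smult B.smult_mult_left B.smult_mult_right)
qed

lemma opposite_algebra_power:
  assumes "k_algebra B" "a \<in> carrier B"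
  shows "a [^]\<^bsub>opposite_algebra B\<^esub> (m::nat) = a [^]\<^bsub>B\<^esub> m"
proof -
  interpret B: k_alg B by (rule k_alg.intro) fact
  interpret O: k_alg "opposite_algebra B" by (rule k_alg.intro, rule k_algebra_opposite) fact
  show ?thesis
    by (induction m) (use assms in \<open>simp_all add: B.nat_pow_comm[of a 1, simplified] flip: B.nat_pow_Suc2\<close>)
qed

lemma E_triple_antipode:
  fixes B :: "('k::field, 'a) module"
  assumes B: "k_algebra B" and p: "p = CHAR('k)" "p > 0" and n: "n > 0" and t: "E_triple B p n \<alpha> g h x"
  shows "E_triple (opposite_algebra B) p n \<alpha> (g [^]\<^bsub>B\<^esub> (p - 1)) (h [^]\<^bsub>B\<^esub> (n - 1)) (\<ominus>\<^bsub>B\<^esub> (g [^]\<^bsub>B\<^esub> (p - 1) \<otimes>\<^bsub>B\<^esub> x))"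
proof -
  interpret B: k_alg B by (rule k_alg.intro) fact
  have c: "g \<in> carrier B" "h \<in> carrier B" "x \<in> carrier B" "\<alpha> \<odot>\<^bsub>B\<^esub> \<one>\<^bsub>B\<^esub> \<in> carrier B"
    using t by (auto simp: E_triple_def)
  note put = c[THEN component_put]
  have prime: "prime p" using p prime_CHAR_semidom[where ?'a = 'k] by simp
  have char: "of_nat p = (0 :: ('k, 'a) alg_product)" using alg_product_char p by simp
  define \<gamma> \<eta> \<xi> where "\<gamma> = put B g 1 ^ (p - 1)" and "\<eta> = put B h 1 ^ (n - 1)" and "\<xi> = - (\<gamma> * put B x 0)"
  note E_relations_antipode(1-6)[OF prime char n put_scalar_central[OF B] E_triple_lift[OF B p(2) t],
      folded \<gamma>_def \<eta>_def, folded \<xi>_def]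
  from this[THEN arg_cong, of "component B"]
  have "E_triple (opposite_algebra B) p n \<alpha> (component B \<gamma>) (component B \<eta>) (component B \<xi>)"
    using B c by (simp add: put component_simps component_power E_triple_def opposite_algebra_power B.smult_mult_left)
  moreover have "component B \<gamma> = g [^]\<^bsub>B\<^esub> (p - 1)" "component B \<eta> = h [^]\<^bsub>B\<^esub> (n - 1)"
    using B by (simp_all add: \<gamma>_def \<eta>_def component_power put)
  ultimately show ?thesis
    using B by (simp add: \<xi>_def component_simps put)
qed

lemma E_triple_commutator:
  fixes B :: "('k::field, 'a) module"
  assumes B: "k_algebra B" and p: "p > 0" and t: "E_triple B p n \<alpha> g h x"
  defines "m \<equiv> \<lambda>i j. h [^]\<^bsub>B\<^esub> (i::nat) \<otimes>\<^bsub>B\<^esub> g [^]\<^bsub>B\<^esub> (j::nat)"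
  shows "x \<otimes>\<^bsub>B\<^esub> m i j \<ominus>\<^bsub>B\<^esub> m i j \<otimes>\<^bsub>B\<^esub> x = (of_nat i * \<alpha> - of_nat j) \<odot>\<^bsub>B\<^esub> (m i j \<otimes>\<^bsub>B\<^esub> (\<one>\<^bsub>B\<^esub> \<ominus>\<^bsub>B\<^esub> g))"
proof -
  interpret B: k_alg B by (rule k_alg.intro) fact
  have c: "g \<in> carrier B" "h \<in> carrier B" "x \<in> carrier B" "\<alpha> \<odot>\<^bsub>B\<^esub> \<one>\<^bsub>B\<^esub> \<in> carrier B"
    using t by (auto simp: E_triple_def)
  define M where "M = put B h 1 ^ i * put B g 1 ^ j"
  have M: "component B M = m i j"
    using B by (simp add: M_def m_def component_simps component_power c[THEN component_put])
  have ca: "component B (put B (\<alpha> \<odot>\<^bsub>B\<^esub> \<one>\<^bsub>B\<^esub>) 0) = \<alpha> \<odot>\<^bsub>B\<^esub> \<one>\<^bsub>B\<^esub>"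
    using B by (simp add: c[THEN component_put])
  have sc: "component B (of_nat i) \<otimes>\<^bsub>B\<^esub> (\<alpha> \<odot>\<^bsub>B\<^esub> \<one>\<^bsub>B\<^esub>) \<ominus>\<^bsub>B\<^esub> component B (of_nat j) =
      (of_nat i * \<alpha> - of_nat j) \<odot>\<^bsub>B\<^esub> \<one>\<^bsub>B\<^esub>"
    using component_scalar[OF B ca, of i j] B
    by (simp add: component_simps c[THEN component_put])
  have "m i j \<in> carrier B" using B M by (metis component_closed)
  moreover from commutator_grouplike[OF put_scalar_central[OF B] E_triple_lift[OF B p t], of i j, folded M_def, THEN arg_cong, of "component B"]
  have "x \<otimes>\<^bsub>B\<^esub> m i j \<ominus>\<^bsub>B\<^esub> m i j \<otimes>\<^bsub>B\<^esub> x =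
      (of_nat i * \<alpha> - of_nat j) \<odot>\<^bsub>B\<^esub> \<one>\<^bsub>B\<^esub> \<otimes>\<^bsub>B\<^esub> (m i j \<otimes>\<^bsub>B\<^esub> (\<one>\<^bsub>B\<^esub> \<ominus>\<^bsub>B\<^esub> g))"
    using B by (simp add: component_simps M sc c[THEN component_put])
  ultimately show ?thesis
    using c by (simp add: B.smult_mult_left)
qed

lemma E_triple_change_h:
  fixes B :: "('k::field, 'a) module"
  assumes B: "k_algebra B" and p: "p = CHAR('k)" "p > 0" "p dvd n" and t: "E_triple B p n \<alpha> g h x"
  shows "E_triple B p n (of_nat i * \<alpha> - of_nat j) g (h [^]\<^bsub>B\<^esub> i \<otimes>\<^bsub>B\<^esub> g [^]\<^bsub>B\<^esub> j) x"
proof -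
  interpret B: k_alg B by (rule k_alg.intro) fact
  have c: "g \<in> carrier B" "h \<in> carrier B" "x \<in> carrier B" "\<alpha> \<odot>\<^bsub>B\<^esub> \<one>\<^bsub>B\<^esub> \<in> carrier B"
    using t by (auto simp: E_triple_def)
  have prime: "prime p" using p prime_CHAR_semidom[where ?'a = 'k] by simp
  have char: "of_nat p = (0 :: ('k, 'a) alg_product)" using alg_product_char p by simp
  have ca: "component B (put B (\<alpha> \<odot>\<^bsub>B\<^esub> \<one>\<^bsub>B\<^esub>) 0) = \<alpha> \<odot>\<^bsub>B\<^esub> \<one>\<^bsub>B\<^esub>"
    using B by (simp add: c[THEN component_put])
  note E_relations_change_h[OF prime char p(3) put_scalar_central[OF B] E_triple_lift[OF B p(2) t], of i j]
  from E_triple_project[OF B component_scalar[OF B ca] this]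
  show ?thesis
    using B by (simp add: component_simps component_power c[THEN component_put])
qed

section \<open>The universal property of the presented algebra\<close>

abbreviation words :: "'s list monoid" where
  "words \<equiv> \<lparr>carrier = UNIV, monoid.mult = (@), one = []\<rparr>"

lemma monoid_words: "Group.monoid words"
  by (rule monoidI) auto

lemma k_algebra_free: "k_algebra (free_algebra :: ('k::field, 's list \<Rightarrow>\<^sub>0 'k) module)"
  unfolding free_algebra_def by (rule k_algebra_monoid_algebra[OF monoid_words])

lemma free_algebra_carrier [simp]: "carrier free_algebra = UNIV"
  by (simp add: free_algebra_def)

lemma eval_word_simps [simp]:
  "eval_word B f [] = \<one>\<^bsub>B\<^esub>" "eval_word B f (s # w) = f s \<otimes>\<^bsub>B\<^esub> eval_word B f w"
  by (simp_all add: eval_word_def)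

lemma eval_word_closed:
  assumes "k_algebra B" "\<And>s. f s \<in> carrier B"
  shows "eval_word B f w \<in> carrier B"
proof -
  interpret B: k_alg B by (rule k_alg.intro) fact
  show ?thesis by (induction w) (use assms in auto)
qed

lemma eval_word_append:
  assumes "k_algebra B" "\<And>s. f s \<in> carrier B"
  shows "eval_word B f (v @ w) = eval_word B f v \<otimes>\<^bsub>B\<^esub> eval_word B f w"
proof -
  interpret B: k_alg B by (rule k_alg.intro) fact
  show ?thesis by (induction v) (use assms eval_word_closed[of B f, OF assms] in \<open>auto simp: B.m_assoc\<close>)
qed

lemma free_algebra_hom:
  assumes "k_algebra B" "\<And>s. f s \<in> carrier B"
  shows "linear_extension B (eval_word B f) \<in> k_algebra_hom free_algebra B"
  unfolding free_algebra_def
  by (rule linear_extension_hom[OF assms(1) monoid_words])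
     (auto simp: eval_word_closed[of B f, OF assms] eval_word_append[of B f, OF assms])

lemma free_algebra_hom_gen:
  assumes "k_algebra B" "\<And>s. f s \<in> carrier B"
  shows "linear_extension B (eval_word B f) (free_gen s) = f s"
proof -
  interpret B: k_alg B by (rule k_alg.intro) fact
  show ?thesis by (simp add: free_gen_def assms)
qed

lemma k_algebra_hom_kernel_ideal:
  assumes "k_algebra A" "k_algebra B" "f \<in> k_algebra_hom A B"
  shows "ideal {a \<in> carrier A. f a = \<zero>\<^bsub>B\<^esub>} A"
proof -
  interpret A: k_alg A by (rule k_alg.intro) fact
  interpret B: k_alg B by (rule k_alg.intro) fact
  interpret ring_hom_ring A B f
    using assms(3) by (intro ring_hom_ringI2[OF A.ring_axioms B.ring_axioms]) (simp add: k_algebra_hom_def)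
  show ?thesis using kernel_is_ideal unfolding a_kernel_def' .
qed

lemma E_triple_hom:
  assumes "k_algebra A" "k_algebra B" "f \<in> k_algebra_hom A B" "E_triple A p n \<alpha> g h x"
  shows "E_triple B p n \<alpha> (f g) (f h) (f x)"
proof -
  interpret A: k_alg A by (rule k_alg.intro) fact
  interpret B: k_alg B by (rule k_alg.intro) fact
  note [simp] = k_algebra_homD(2-5)[OF assms(3), symmetric] k_algebra_hom_pow[OF assms(1-3), symmetric]
    linear_map_minus[OF assms(1,2) k_algebra_hom_linear[OF assms(3)], symmetric]
  show ?thesis
    using assms(4) k_algebra_homD(1)[OF assms(3)] by (simp add: E_triple_def)
qed

locale E_presentation =
  fixes p n :: nat and \<alpha> :: "'k::field"
begin

abbreviation "F \<equiv> (free_algebra :: ('k, generator list \<Rightarrow>\<^sub>0 'k) module)"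
abbreviation "E \<equiv> E_algebra p n \<alpha>"
abbreviation "gen \<equiv> E_gen p n \<alpha>"

sublocale F: k_alg F
  by (rule k_alg.intro, rule k_algebra_free)

sublocale k_quotient F "E_ideal p n \<alpha>"
proof -
  have "ideal (E_ideal p n \<alpha>) F"
    unfolding E_ideal_def by (rule F.genideal_ideal) simp
  then show "k_quotient F (E_ideal p n \<alpha>)"
    by (intro k_quotient.intro F.k_alg_axioms)
qed

lemma k_algebra_E: "k_algebra E"
  unfolding E_algebra_def by (rule k_algebra_quotient)

sublocale E: k_alg E
  by (rule k_alg.intro, rule k_algebra_E)

lemma proj_hom: "(\<lambda>y. E_ideal p n \<alpha> +>\<^bsub>F\<^esub> y) \<in> k_algebra_hom F E"
  unfolding E_algebra_def by (rule coset_hom)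

lemma gen_closed [simp, intro]: "gen s \<in> carrier E"
  unfolding E_gen_def using k_algebra_homD(1)[OF proj_hom] by simp

text \<open>
  Evaluation of words is an algebra map, so it turns each defining relator into the difference of the
  two sides of an equation in \<open>B\<close>.
\<close>

lemma relations_hold_iff:
  assumes "k_algebra B" "\<And>s. f s \<in> carrier B"
  shows "(\<forall>r\<in>E_relations p n \<alpha>. linear_extension B (eval_word B f) r = \<zero>\<^bsub>B\<^esub>) \<longleftrightarrow>
    E_triple B p n \<alpha> (f Gen_g) (f Gen_h) (f Gen_x)"
proof -
  interpret B: k_alg B by (rule k_alg.intro) fact
  note hom = free_algebra_hom[of B f, OF assms]
  note [simp] = free_algebra_hom_gen[of B f, OF assms] k_algebra_homD[OF hom] k_algebra_hom_pow[OF k_algebra_free assms(1) hom]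
    linear_map_minus[OF k_algebra_free assms(1) k_algebra_hom_linear[OF hom]] assms(2)
  have eq0: "u \<ominus>\<^bsub>B\<^esub> v = \<zero>\<^bsub>B\<^esub> \<longleftrightarrow> u = v" if "u \<in> carrier B" "v \<in> carrier B" for u v
    using that by (metis B.diff_self B.r_right_minus_eq)
  show ?thesis
    unfolding E_relations_def Let_def E_triple_def by (simp add: eq0)
qed

text \<open>
  The universal property of \<open>E\<^sub>\<alpha>\<close>: the kernel of the evaluation is an ideal, so it contains the ideal
  generated by the relators as soon as it contains the relators.
\<close>

lemma E_hom_exists:
  assumes "k_algebra B" "E_triple B p n \<alpha> (f Gen_g) (f Gen_h) (f Gen_x)"
  shows "induced B (eval_word B f) \<in> k_algebra_hom E B" "induced B (eval_word B f) (gen s) = f s"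
proof -
  have f: "f s \<in> carrier B" for s
    using assms(2) by (cases s) (auto simp: E_triple_def)
  note hom = free_algebra_hom[of B f, OF assms(1) f]
  have "E_relations p n \<alpha> \<subseteq> {r \<in> carrier F. linear_extension B (eval_word B f) r = \<zero>\<^bsub>B\<^esub>}"
    using relations_hold_iff[where f=f, OF assms(1) f] assms(2) by auto
  then have "E_ideal p n \<alpha> \<subseteq> {r \<in> carrier F. linear_extension B (eval_word B f) r = \<zero>\<^bsub>B\<^esub>}"
    unfolding E_ideal_def
    by (intro F.genideal_minimal k_algebra_hom_kernel_ideal[OF k_algebra_free assms(1) hom])
  then have zero: "linear_extension B (eval_word B f) i = \<zero>\<^bsub>B\<^esub>" if "i \<in> E_ideal p n \<alpha>" for i
    using that by blast
  note prems = assms(1) monoid_words is_ideal[unfolded free_algebra_def]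
  have c: "eval_word B f \<in> carrier words \<rightarrow> carrier B"
    using eval_word_closed[of B f, OF assms(1) f] by simp
  show "induced B (eval_word B f) \<in> k_algebra_hom E B"
    unfolding E_algebra_def free_algebra_def
    by (rule induced_hom[OF prems c zero hom[unfolded free_algebra_def]])
  show "induced B (eval_word B f) (gen s) = f s"
    unfolding E_gen_def free_algebra_def
    using induced_coset[OF prems c zero, of "free_gen s"] free_algebra_hom_gen[of B f, OF assms(1) f]
    by simp
qed

lemma E_triple_gens: "E_triple E p n \<alpha> (gen Gen_g) (gen Gen_h) (gen Gen_x)"
proof -
  note hom = proj_hom
  note hs = k_algebra_homD[OF hom] k_algebra_hom_pow[OF k_algebra_free k_algebra_E hom]
    linear_map_minus[OF k_algebra_free k_algebra_E k_algebra_hom_linear[OF hom]]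
  have eq: "\<pi> u = \<pi> v" if "u \<ominus>\<^bsub>F\<^esub> v \<in> E_relations p n \<alpha>" "\<pi> = (\<lambda>y. E_ideal p n \<alpha> +>\<^bsub>F\<^esub> y)" for u v \<pi>
  proof -
    have "u \<ominus>\<^bsub>F\<^esub> v \<in> E_ideal p n \<alpha>"
      unfolding E_ideal_def using F.genideal_self[of "E_relations p n \<alpha>"] that by auto
    then show ?thesis using coset_eq_iff[of u v] that by simp
  qed
  define \<pi> where "\<pi> = (\<lambda>y. E_ideal p n \<alpha> +>\<^bsub>F\<^esub> y)"
  note eqs = eq[OF _ \<pi>_def, unfolded E_relations_def Let_def]
  note hs' = hs[folded \<pi>_def, simplified free_algebra_carrier, simplified]
  have gen: "gen s = \<pi> (free_gen s)" for s by (simp add: E_gen_def \<pi>_def)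
  show ?thesis
    unfolding E_triple_def gen hs'(2-)[symmetric]
    using gen_closed[unfolded gen] by (auto intro!: eqs)
qed

text \<open>
  Words are built by multiplying with generators on the left, so closure under left multiplication by
  generators replaces closure under products.
\<close>

lemma E_induct [consumes 1, case_names one gen add smult]:
  assumes "a \<in> carrier E"
    and one: "P \<one>\<^bsub>E\<^esub>"
    and gen: "\<And>s a. a \<in> carrier E \<Longrightarrow> P a \<Longrightarrow> P (gen s \<otimes>\<^bsub>E\<^esub> a)"
    and add: "\<And>a b. a \<in> carrier E \<Longrightarrow> b \<in> carrier E \<Longrightarrow> P a \<Longrightarrow> P b \<Longrightarrow> P (a \<oplus>\<^bsub>E\<^esub> b)"
    and smult: "\<And>c a. a \<in> carrier E \<Longrightarrow> P a \<Longrightarrow> P (c \<odot>\<^bsub>E\<^esub> a)"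
  shows "P a"
proof -
  define \<pi> where "\<pi> = (\<lambda>y. E_ideal p n \<alpha> +>\<^bsub>F\<^esub> y)"
  note hom = k_algebra_homD[OF proj_hom, folded \<pi>_def, simplified]
  obtain y where y: "a = \<pi> y"
    using assms(1) by (auto simp: E_algebra_def quotient_carrier \<pi>_def)
  have word: "P (\<pi> (Poly_Mapping.single w 1))" for w
  proof (induction w)
    case Nil
    have "\<pi> (Poly_Mapping.single [] 1) = \<one>\<^bsub>E\<^esub>"
      using hom(5) by (simp add: free_algebra_def)
    then show ?case using one by simp
  next
    case (Cons s w)
    have "\<pi> (Poly_Mapping.single (s # w) 1) = gen s \<otimes>\<^bsub>E\<^esub> \<pi> (Poly_Mapping.single w 1)"
      using hom(4)[of "free_gen s" "Poly_Mapping.single w 1"]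
      by (simp add: free_algebra_def free_gen_def E_gen_def \<pi>_def)
    then show ?case using gen[OF hom(1) Cons] by simp
  qed
  have "Poly_Mapping.keys y \<subseteq> UNIV" by simp
  then have "P (\<pi> y)"
  proof (induction y rule: finite_support_induct)
    case zero
    have "\<pi> 0 = 0 \<odot>\<^bsub>E\<^esub> \<one>\<^bsub>E\<^esub>"
      using linear_map_zero[OF k_algebra_free k_algebra_E k_algebra_hom_linear[OF proj_hom]]
      by (simp add: \<pi>_def free_algebra_def)
    then show ?case using smult[OF _ one, of 0] by (simp del: E.smult_zero_left)
  next
    case (single w c)
    have "\<pi> (Poly_Mapping.single w c) = c \<odot>\<^bsub>E\<^esub> \<pi> (Poly_Mapping.single w 1)"
      using hom(3)[of c "Poly_Mapping.single w 1"] by (simp add: free_algebra_def map_times_single)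
    then show ?case using smult[OF hom(1) word] by simp
  next
    case (add u v)
    have "\<pi> (u + v) = \<pi> u \<oplus>\<^bsub>E\<^esub> \<pi> v"
      using hom(2)[of u v] by (simp add: free_algebra_def)
    then show ?case using assms(4)[OF hom(1) hom(1)] add by simp
  qed
  then show ?thesis using y by simp
qed

lemma E_hom_unique:
  assumes "f \<in> k_algebra_hom E B" "f' \<in> k_algebra_hom E B" "\<And>s. f (gen s) = f' (gen s)" "a \<in> carrier E"
  shows "f a = f' a"
  using assms(4)
  by (induction rule: E_induct)
     (simp_all add: k_algebra_homD[OF assms(1)] k_algebra_homD[OF assms(2)] assms(3))

end

section \<open>The coalgebra structure\<close>

lemma base_algebra_simps [simp]:
  "carrier base_algebra = UNIV" "a \<otimes>\<^bsub>base_algebra\<^esub> b = a * b" "\<one>\<^bsub>base_algebra\<^esub> = 1"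
  "\<zero>\<^bsub>base_algebra\<^esub> = 0" "a \<oplus>\<^bsub>base_algebra\<^esub> b = a + b" "c \<odot>\<^bsub>base_algebra\<^esub> a = c * a"
  by (simp_all add: base_algebra_def ring.defs module.defs ring_of_type_algebra_def)

lemma k_algebra_base: "k_algebra (base_algebra :: ('k::field, 'k) module)"
proof (rule k_algebraI)
  show "ring (base_algebra :: ('k, 'k) module)"
    by (rule ring_cong[OF ring_from_type_algebra])
       (simp_all add: base_algebra_def ring.defs module.defs ring_of_type_algebra_def)
qed (simp_all add: distrib_left distrib_right mult.assoc mult.left_commute)

interpretation base: k_alg base_algebra
  by (rule k_alg.intro, rule k_algebra_base)

lemma base_algebra_minus [simp]: "a \<ominus>\<^bsub>base_algebra\<^esub> b = a - b"
proof -
  have "\<ominus>\<^bsub>base_algebra\<^esub> b = - b" by (rule base.add.inv_equality) simp_all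
  then show ?thesis by (simp add: base.minus_eq)
qed

lemma base_algebra_power [simp]: "a [^]\<^bsub>base_algebra\<^esub> (m::nat) = a ^ m"
  by (induction m) (simp_all add: mult.commute)

lemma (in tensor_pair)
  shows left_inclusion_hom: "(\<lambda>a. pure_tensor A B a \<one>\<^bsub>B\<^esub>) \<in> k_algebra_hom A (tensor A B)"
    and right_inclusion_hom: "pure_tensor A B \<one>\<^bsub>A\<^esub> \<in> k_algebra_hom B (tensor A B)"
  by (auto intro!: k_algebra_homI linear_mapI
      simp: pure_tensor_mult tensor_one pure_tensor_add_left pure_tensor_add_right
        pure_tensor_smult_left pure_tensor_smult_right)

text \<open>
  The standing assumptions of the theorem. \<open>\<Delta>\<close> and \<open>\<epsilon>\<close> below are the comultiplication and the counit.
\<close>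

locale E_hopf_context = E_presentation p n \<alpha> for p n and \<alpha> :: "'k::field" +
  assumes p: "p = CHAR('k)" "p > 0" and n: "n > 0" and p_dvd: "p dvd n"
begin

abbreviation "EE \<equiv> tensor E E"
abbreviation "gg \<equiv> gen Gen_g"
abbreviation "hh \<equiv> gen Gen_h"
abbreviation "xx \<equiv> gen Gen_x"

sublocale EE: tensor_pair E E
  by (intro tensor_pairI k_algebra_E)

sublocale T: k_alg EE
  by (rule k_alg.intro, rule EE.k_algebra_tensor)

sublocale E_EE: tensor_pair E EE
  by (intro tensor_pairI k_algebra_E EE.k_algebra_tensor)

sublocale EE_E: tensor_pair EE E
  by (intro tensor_pairI k_algebra_E EE.k_algebra_tensor)

definition \<Delta> where "\<Delta> = induced EE (eval_word EE (E_comult_gen p n \<alpha>))"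
definition \<epsilon> where "\<epsilon> = induced base_algebra (eval_word base_algebra E_counit_gen)"

lemma comult_gen_simps:
  "E_comult_gen p n \<alpha> Gen_g = pure_tensor E E gg gg"
  "E_comult_gen p n \<alpha> Gen_h = pure_tensor E E hh hh"
  "E_comult_gen p n \<alpha> Gen_x = pure_tensor E E xx \<one>\<^bsub>E\<^esub> \<oplus>\<^bsub>EE\<^esub> pure_tensor E E gg xx"
  by (simp_all add: E_comult_gen_def Let_def)

lemma prime_p: "prime p"
  using p prime_CHAR_semidom[where ?'a = 'k] by simp

text \<open>
  Both inclusions of \<open>E\<close> into \<open>E \<otimes> E\<close> carry the generators to solutions of the relations, and the two
  images commute elementwise.
\<close>

lemma E_triple_comult:
  "E_triple EE p n \<alpha> (E_comult_gen p n \<alpha> Gen_g) (E_comult_gen p n \<alpha> Gen_h) (E_comult_gen p n \<alpha> Gen_x)"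
proof -
  have left: "E_triple EE p n \<alpha> (pure_tensor E E gg \<one>\<^bsub>E\<^esub>) (pure_tensor E E hh \<one>\<^bsub>E\<^esub>) (pure_tensor E E xx \<one>\<^bsub>E\<^esub>)"
    by (rule E_triple_hom[OF k_algebra_E T.k_algebra EE.left_inclusion_hom E_triple_gens])
  have right: "E_triple EE p n \<alpha> (pure_tensor E E \<one>\<^bsub>E\<^esub> gg) (pure_tensor E E \<one>\<^bsub>E\<^esub> hh) (pure_tensor E E \<one>\<^bsub>E\<^esub> xx)"
    by (rule E_triple_hom[OF k_algebra_E T.k_algebra EE.right_inclusion_hom E_triple_gens])
  have comm: "y' \<otimes>\<^bsub>EE\<^esub> y = y \<otimes>\<^bsub>EE\<^esub> y'"
    if "y \<in> {pure_tensor E E gg \<one>\<^bsub>E\<^esub>, pure_tensor E E hh \<one>\<^bsub>E\<^esub>, pure_tensor E E xx \<one>\<^bsub>E\<^esub>}"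
      "y' \<in> {pure_tensor E E \<one>\<^bsub>E\<^esub> gg, pure_tensor E E \<one>\<^bsub>E\<^esub> hh, pure_tensor E E \<one>\<^bsub>E\<^esub> xx}" for y y'
    using that by (auto simp: EE.pure_tensor_mult)
  from E_triple_coproduct[OF T.k_algebra p left right comm]
  show ?thesis
    unfolding comult_gen_simps by (simp add: EE.pure_tensor_mult)
qed

lemma \<Delta>_hom: "\<Delta> \<in> k_algebra_hom E EE"
  and \<Delta>_gen: "\<Delta> (gen s) = E_comult_gen p n \<alpha> s"
  unfolding \<Delta>_def by (rule E_hom_exists[OF T.k_algebra E_triple_comult])+

lemmas \<Delta>_simps [simp] = \<Delta>_gen[of Gen_g, unfolded comult_gen_simps] \<Delta>_gen[of Gen_h, unfolded comult_gen_simps]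
  \<Delta>_gen[of Gen_x, unfolded comult_gen_simps] k_algebra_homD[OF \<Delta>_hom]

lemma \<epsilon>_hom: "\<epsilon> \<in> k_algebra_hom E base_algebra"
  and \<epsilon>_gen: "\<epsilon> (gen s) = E_counit_gen s"
proof -
  have t: "E_triple base_algebra p n \<alpha> (E_counit_gen Gen_g) (E_counit_gen Gen_h) (E_counit_gen Gen_x)"
    using p by (simp add: E_triple_def E_counit_gen_def zero_power)
  show "\<epsilon> \<in> k_algebra_hom E base_algebra" "\<epsilon> (gen s) = E_counit_gen s"
    unfolding \<epsilon>_def by (rule E_hom_exists[OF k_algebra_base t])+
qed

lemma \<epsilon>_simps [simp]: "\<epsilon> gg = 1" "\<epsilon> hh = 1" "\<epsilon> xx = 0"
  by (simp_all add: \<epsilon>_gen E_counit_gen_def)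

lemmas \<epsilon>_homD [simp] = k_algebra_homD(2-5)[OF \<epsilon>_hom, simplified]

text \<open>
  Both sides are algebra maps in \<open>a\<close>, so it suffices to compare them on the generators.
\<close>

lemma coassociative:
  assumes "a \<in> carrier E"
  shows "tensor_assoc E E E (tensor_map EE E \<Delta> id (\<Delta> a)) = tensor_map E EE id \<Delta> (\<Delta> a)"
proof -
  have id: "id \<in> k_algebra_hom E E"
    using k_algebra_hom_id[of E] by (simp add: id_def)
  note ka = k_algebra_E T.k_algebra
  note 1 = tensor_map_hom[OF ka(1,1,2,1) \<Delta>_hom id]
  note 2 = tensor_map_hom[OF ka(1,1,1,2) id \<Delta>_hom]
  note 3 = tensor_assoc_hom[OF ka(1,1,1)]
  note v1 = tensor_map_pure[OF ka(1,1,2,1) k_algebra_hom_linear[OF \<Delta>_hom] k_algebra_hom_linear[OF id]]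
  note v2 = tensor_map_pure[OF ka(1,1,1,2) k_algebra_hom_linear[OF id] k_algebra_hom_linear[OF \<Delta>_hom]]
  note v3 = tensor_assoc_pure[OF ka(1,1,1)]
  interpret T3: k_alg "tensor E EE" by (rule k_alg.intro, rule E_EE.k_algebra_tensor)
  interpret T3': k_alg "tensor EE E" by (rule k_alg.intro, rule EE_E.k_algebra_tensor)
  have "tensor_assoc E E E (tensor_map EE E \<Delta> id (\<Delta> (gen s))) = tensor_map E EE id \<Delta> (\<Delta> (gen s))" for s
    by (cases s) (simp_all add: v1 v2 v3 k_algebra_homD[OF 1] k_algebra_homD[OF 2] k_algebra_homD[OF 3]
        EE.tensor_one EE_E.pure_tensor_add_left E_EE.pure_tensor_add_right T3.a_assoc)
  then show ?thesis
    by (rule E_hom_unique[OF k_algebra_hom_compose[OF k_algebra_hom_compose[OF \<Delta>_hom 1] 3]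
          k_algebra_hom_compose[OF \<Delta>_hom 2] _ assms])
qed

lemma bilinear_scaled_left:
  assumes "linear_map E base_algebra f"
  shows "bilinear_map E E E (\<lambda>b c. f b \<odot>\<^bsub>E\<^esub> c)"
  using linear_mapD[OF assms]
  by (intro bilinear_mapI linear_mapI)
     (auto simp: E.smult_add_right E.smult_add_left E.smult_smult mult.commute)

lemma bilinear_scaled_right:
  assumes "linear_map E base_algebra f"
  shows "bilinear_map E E E (\<lambda>b c. f c \<odot>\<^bsub>E\<^esub> b)"
  using linear_mapD[OF assms]
  by (intro bilinear_mapI linear_mapI)
     (auto simp: E.smult_add_right E.smult_add_left E.smult_smult mult.commute)

text \<open>
  Convolution with a character on either side is an algebra endomorphism. The counit is one such
  character, for which this endomorphism turns out to be the identity; others are used to move within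
  the algebra when elements are compared.
\<close>

lemma
  assumes \<chi>: "\<chi> \<in> k_algebra_hom E base_algebra"
  shows left_translate_hom: "(\<lambda>a. induced E (\<lambda>(b, c). \<chi> b \<odot>\<^bsub>E\<^esub> c) (\<Delta> a)) \<in> k_algebra_hom E E"
    and right_translate_hom: "(\<lambda>a. induced E (\<lambda>(b, c). \<chi> c \<odot>\<^bsub>E\<^esub> b) (\<Delta> a)) \<in> k_algebra_hom E E"
    and left_translate_linear: "linear_map EE E (induced E (\<lambda>(b, c). \<chi> b \<odot>\<^bsub>E\<^esub> c))"
    and left_translate_pure: "a \<in> carrier E \<Longrightarrow> b \<in> carrier E \<Longrightarrow>
          induced E (\<lambda>(b, c). \<chi> b \<odot>\<^bsub>E\<^esub> c) (pure_tensor E E a b) = \<chi> a \<odot>\<^bsub>E\<^esub> b"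
    and right_translate_linear: "linear_map EE E (induced E (\<lambda>(b, c). \<chi> c \<odot>\<^bsub>E\<^esub> b))"
    and right_translate_pure: "a \<in> carrier E \<Longrightarrow> b \<in> carrier E \<Longrightarrow>
          induced E (\<lambda>(b, c). \<chi> c \<odot>\<^bsub>E\<^esub> b) (pure_tensor E E a b) = \<chi> b \<odot>\<^bsub>E\<^esub> a"
proof -
  note lin = k_algebra_hom_linear[OF \<chi>]
  note bl = bilinear_scaled_left[OF lin] and br = bilinear_scaled_right[OF lin]
  note [simp] = k_algebra_homD(2-5)[OF \<chi>, simplified]
  show l: "linear_map EE E (induced E (\<lambda>(b, c). \<chi> b \<odot>\<^bsub>E\<^esub> c))"
    by (rule EE.induced_bilinear_linear[OF k_algebra_E bl])
  show lp: "induced E (\<lambda>(b, c). \<chi> b \<odot>\<^bsub>E\<^esub> c) (pure_tensor E E a b) = \<chi> a \<odot>\<^bsub>E\<^esub> b"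
    if "a \<in> carrier E" "b \<in> carrier E" for a b
    by (rule EE.induced_pure[OF k_algebra_E bl that])
  show r: "linear_map EE E (induced E (\<lambda>(b, c). \<chi> c \<odot>\<^bsub>E\<^esub> b))"
    by (rule EE.induced_bilinear_linear[OF k_algebra_E br])
  show rp: "induced E (\<lambda>(b, c). \<chi> c \<odot>\<^bsub>E\<^esub> b) (pure_tensor E E a b) = \<chi> b \<odot>\<^bsub>E\<^esub> a"
    if "a \<in> carrier E" "b \<in> carrier E" for a b
    by (rule EE.induced_pure[OF k_algebra_E br that])
  show "(\<lambda>a. induced E (\<lambda>(b, c). \<chi> b \<odot>\<^bsub>E\<^esub> c) (\<Delta> a)) \<in> k_algebra_hom E E"
    by (rule k_algebra_hom_compose[OF \<Delta>_hom], rule EE.tensor_linear_hom[OF k_algebra_E l])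
       (simp_all add: lp EE.tensor_one E.smult_mult_left E.smult_mult_right E.smult_smult mult.commute)
  show "(\<lambda>a. induced E (\<lambda>(b, c). \<chi> c \<odot>\<^bsub>E\<^esub> b) (\<Delta> a)) \<in> k_algebra_hom E E"
    by (rule k_algebra_hom_compose[OF \<Delta>_hom], rule EE.tensor_linear_hom[OF k_algebra_E r])
       (simp_all add: rp EE.tensor_one E.smult_mult_left E.smult_mult_right E.smult_smult mult.commute)
qed

lemma counit_left:
  assumes "a \<in> carrier E"
  shows "induced E (\<lambda>(b, c). \<epsilon> b \<odot>\<^bsub>E\<^esub> c) (\<Delta> a) = a"
proof (rule E_hom_unique[OF left_translate_hom[OF \<epsilon>_hom] k_algebra_hom_id _ assms])
  show "induced E (\<lambda>(b, c). \<epsilon> b \<odot>\<^bsub>E\<^esub> c) (\<Delta> (gen s)) = gen s" for s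
    by (cases s) (simp_all add: left_translate_pure[OF \<epsilon>_hom] linear_mapD(2)[OF left_translate_linear[OF \<epsilon>_hom]])
qed

lemma counit_right:
  assumes "a \<in> carrier E"
  shows "induced E (\<lambda>(b, c). \<epsilon> c \<odot>\<^bsub>E\<^esub> b) (\<Delta> a) = a"
proof (rule E_hom_unique[OF right_translate_hom[OF \<epsilon>_hom] k_algebra_hom_id _ assms])
  show "induced E (\<lambda>(b, c). \<epsilon> c \<odot>\<^bsub>E\<^esub> b) (\<Delta> (gen s)) = gen s" for s
    by (cases s) (simp_all add: right_translate_pure[OF \<epsilon>_hom] linear_mapD(2)[OF right_translate_linear[OF \<epsilon>_hom]])
qed

section \<open>The antipode\<close>

abbreviation "Eop \<equiv> opposite_algebra E"

definition antipode_gen :: "generator \<Rightarrow> (generator list \<Rightarrow>\<^sub>0 'k) set" where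
  "antipode_gen s = (case s of Gen_g \<Rightarrow> gg [^]\<^bsub>E\<^esub> (p - 1) | Gen_h \<Rightarrow> hh [^]\<^bsub>E\<^esub> (n - 1)
     | Gen_x \<Rightarrow> \<ominus>\<^bsub>E\<^esub> (gg [^]\<^bsub>E\<^esub> (p - 1) \<otimes>\<^bsub>E\<^esub> xx))"

definition S where "S = induced Eop (eval_word Eop antipode_gen)"

lemma S_hom: "S \<in> k_algebra_hom E Eop"
  and S_gen: "S (gen s) = antipode_gen s"
proof -
  have t: "E_triple Eop p n \<alpha> (antipode_gen Gen_g) (antipode_gen Gen_h) (antipode_gen Gen_x)"
    using E_triple_antipode[OF k_algebra_E p n E_triple_gens] by (simp add: antipode_gen_def)
  show "S \<in> k_algebra_hom E Eop" "S (gen s) = antipode_gen s"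
    unfolding S_def by (rule E_hom_exists[OF k_algebra_opposite[OF k_algebra_E] t])+
qed

lemmas S_simps [simp] = k_algebra_homD[OF S_hom, simplified]

lemma gen_power: "gg [^]\<^bsub>E\<^esub> p = \<one>\<^bsub>E\<^esub>" "hh [^]\<^bsub>E\<^esub> n = \<one>\<^bsub>E\<^esub>" "gg \<otimes>\<^bsub>E\<^esub> hh = hh \<otimes>\<^bsub>E\<^esub> gg"
  using E_triple_gens by (simp_all add: E_triple_def)

lemma S_inverse:
  "S gg \<otimes>\<^bsub>E\<^esub> gg = \<one>\<^bsub>E\<^esub>" "gg \<otimes>\<^bsub>E\<^esub> S gg = \<one>\<^bsub>E\<^esub>" "S hh \<otimes>\<^bsub>E\<^esub> hh = \<one>\<^bsub>E\<^esub>" "hh \<otimes>\<^bsub>E\<^esub> S hh = \<one>\<^bsub>E\<^esub>"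
  "S xx = \<ominus>\<^bsub>E\<^esub> (S gg \<otimes>\<^bsub>E\<^esub> xx)"
proof -
  have "p = Suc (p - 1)" "n = Suc (n - 1)" using p(2) n by simp_all
  then have "gg [^]\<^bsub>E\<^esub> (p - 1) \<otimes>\<^bsub>E\<^esub> gg = \<one>\<^bsub>E\<^esub>" "hh [^]\<^bsub>E\<^esub> (n - 1) \<otimes>\<^bsub>E\<^esub> hh = \<one>\<^bsub>E\<^esub>"
    by (metis E.nat_pow_Suc gen_power(1), metis E.nat_pow_Suc gen_power(2))
  moreover have "gg \<otimes>\<^bsub>E\<^esub> gg [^]\<^bsub>E\<^esub> m = gg [^]\<^bsub>E\<^esub> m \<otimes>\<^bsub>E\<^esub> gg" "hh \<otimes>\<^bsub>E\<^esub> hh [^]\<^bsub>E\<^esub> m = hh [^]\<^bsub>E\<^esub> m \<otimes>\<^bsub>E\<^esub> hh" for m :: nat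
    using E.nat_pow_Suc2[of gg m] E.nat_pow_Suc2[of hh m] by simp_all
  ultimately show "S gg \<otimes>\<^bsub>E\<^esub> gg = \<one>\<^bsub>E\<^esub>" "gg \<otimes>\<^bsub>E\<^esub> S gg = \<one>\<^bsub>E\<^esub>" "S hh \<otimes>\<^bsub>E\<^esub> hh = \<one>\<^bsub>E\<^esub>" "hh \<otimes>\<^bsub>E\<^esub> S hh = \<one>\<^bsub>E\<^esub>"
    "S xx = \<ominus>\<^bsub>E\<^esub> (S gg \<otimes>\<^bsub>E\<^esub> xx)"
    by (simp_all add: S_gen antipode_gen_def)
qed

text \<open>
  The products that arise when a pure tensor \<open>a \<otimes> b\<close> is multiplied by \<open>g \<otimes> g\<close> or \<open>h \<otimes> h\<close> and contracted.
\<close>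

lemma mult_inverse_cancel:
  assumes "a \<in> carrier E" "b \<in> carrier E"
  shows "a \<otimes>\<^bsub>E\<^esub> S gg \<otimes>\<^bsub>E\<^esub> (gg \<otimes>\<^bsub>E\<^esub> b) = a \<otimes>\<^bsub>E\<^esub> b" "a \<otimes>\<^bsub>E\<^esub> gg \<otimes>\<^bsub>E\<^esub> (S gg \<otimes>\<^bsub>E\<^esub> b) = a \<otimes>\<^bsub>E\<^esub> b"
    "a \<otimes>\<^bsub>E\<^esub> S hh \<otimes>\<^bsub>E\<^esub> (hh \<otimes>\<^bsub>E\<^esub> b) = a \<otimes>\<^bsub>E\<^esub> b" "a \<otimes>\<^bsub>E\<^esub> hh \<otimes>\<^bsub>E\<^esub> (S hh \<otimes>\<^bsub>E\<^esub> b) = a \<otimes>\<^bsub>E\<^esub> b"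
proof -
  have key: "a \<otimes>\<^bsub>E\<^esub> u \<otimes>\<^bsub>E\<^esub> (v \<otimes>\<^bsub>E\<^esub> b) = a \<otimes>\<^bsub>E\<^esub> b"
    if "u \<otimes>\<^bsub>E\<^esub> v = \<one>\<^bsub>E\<^esub>" "u \<in> carrier E" "v \<in> carrier E" for u v
  proof -
    have "a \<otimes>\<^bsub>E\<^esub> u \<otimes>\<^bsub>E\<^esub> (v \<otimes>\<^bsub>E\<^esub> b) = a \<otimes>\<^bsub>E\<^esub> (u \<otimes>\<^bsub>E\<^esub> v \<otimes>\<^bsub>E\<^esub> b)"
      using that(2,3) assms by (simp add: E.m_assoc)
    then show ?thesis using that(1) assms by simp
  qed
  show "a \<otimes>\<^bsub>E\<^esub> S gg \<otimes>\<^bsub>E\<^esub> (gg \<otimes>\<^bsub>E\<^esub> b) = a \<otimes>\<^bsub>E\<^esub> b" "a \<otimes>\<^bsub>E\<^esub> gg \<otimes>\<^bsub>E\<^esub> (S gg \<otimes>\<^bsub>E\<^esub> b) = a \<otimes>\<^bsub>E\<^esub> b"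
    "a \<otimes>\<^bsub>E\<^esub> S hh \<otimes>\<^bsub>E\<^esub> (hh \<otimes>\<^bsub>E\<^esub> b) = a \<otimes>\<^bsub>E\<^esub> b" "a \<otimes>\<^bsub>E\<^esub> hh \<otimes>\<^bsub>E\<^esub> (S hh \<otimes>\<^bsub>E\<^esub> b) = a \<otimes>\<^bsub>E\<^esub> b"
    by (rule key; simp add: S_inverse(1-4))+
qed

lemma bilinear_S_left: "bilinear_map E E E (\<lambda>b c. S b \<otimes>\<^bsub>E\<^esub> c)"
  by (intro bilinear_mapI linear_mapI)
     (simp_all add: E.l_distr E.r_distr E.smult_mult_left E.smult_mult_right)

lemma bilinear_S_right: "bilinear_map E E E (\<lambda>b c. b \<otimes>\<^bsub>E\<^esub> S c)"
  by (intro bilinear_mapI linear_mapI)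
     (simp_all add: E.l_distr E.r_distr E.smult_mult_left E.smult_mult_right)

text \<open>
  Neither side is multiplicative in \<open>a\<close>, so comparison on generators alone is not enough. Since \<open>S\<close>
  reverses products, the contraction \<open>\<sigma>\<close> of \<open>S b \<otimes> c\<close> to \<open>S b c\<close> satisfies
  \<open>\<sigma> (\<Delta> s u) = \<epsilon> s \<sigma> u\<close> for every generator \<open>s\<close> and every \<open>u\<close>, and left multiplication by generators
  reaches all of \<open>E\<close>.
\<close>

lemma antipode_left:
  assumes "a \<in> carrier E"
  shows "induced E (\<lambda>(b, c). S b \<otimes>\<^bsub>E\<^esub> c) (\<Delta> a) = \<epsilon> a \<odot>\<^bsub>E\<^esub> \<one>\<^bsub>E\<^esub>"
proof -
  define \<sigma> where "\<sigma> = induced E (\<lambda>(b, c). S b \<otimes>\<^bsub>E\<^esub> c)"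
  have lin: "linear_map EE E \<sigma>"
    unfolding \<sigma>_def by (rule EE.induced_bilinear_linear[OF k_algebra_E bilinear_S_left])
  have pure: "\<sigma> (pure_tensor E E b c) = S b \<otimes>\<^bsub>E\<^esub> c" if "b \<in> carrier E" "c \<in> carrier E" for b c
    unfolding \<sigma>_def by (rule EE.induced_pure[OF k_algebra_E bilinear_S_left that])
  note [simp] = linear_mapD[OF lin] pure
  have step: "\<sigma> (\<Delta> (gen s) \<otimes>\<^bsub>EE\<^esub> u) = \<epsilon> (gen s) \<odot>\<^bsub>E\<^esub> \<sigma> u" if "u \<in> carrier EE" for s u
    using that
  proof (induction rule: EE.tensor_induct)
    case (pure a b)
    have neg: "S a \<otimes>\<^bsub>E\<^esub> S xx \<otimes>\<^bsub>E\<^esub> b \<oplus>\<^bsub>E\<^esub> S a \<otimes>\<^bsub>E\<^esub> S gg \<otimes>\<^bsub>E\<^esub> (xx \<otimes>\<^bsub>E\<^esub> b) = \<zero>\<^bsub>E\<^esub>"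
      using pure by (simp add: S_inverse(5) E.l_minus E.r_minus E.m_assoc E.l_neg)
    show ?case
      using pure by (cases s)
        (simp_all add: EE.pure_tensor_mult mult_inverse_cancel T.l_distr neg)
  qed (simp add: T.r_distr E.smult_add_right)
  have "\<sigma> (\<Delta> a) = \<epsilon> a \<odot>\<^bsub>E\<^esub> \<one>\<^bsub>E\<^esub>"
    using assms by (induction rule: E_induct)
      (simp_all add: step EE.tensor_one E.smult_smult E.smult_add_left)
  then show ?thesis by (simp add: \<sigma>_def)
qed

text \<open>
  For the other contraction the generator has to be split off on the right of \<open>u\<close>. The statement proved
  by induction, \<open>\<sigma> (u \<Delta> a) = \<epsilon> a \<sigma> u\<close>, therefore quantifies over all \<open>u\<close>.
\<close>

lemma antipode_right:
  assumes "a \<in> carrier E"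
  shows "induced E (\<lambda>(b, c). b \<otimes>\<^bsub>E\<^esub> S c) (\<Delta> a) = \<epsilon> a \<odot>\<^bsub>E\<^esub> \<one>\<^bsub>E\<^esub>"
proof -
  define \<sigma> where "\<sigma> = induced E (\<lambda>(b, c). b \<otimes>\<^bsub>E\<^esub> S c)"
  have lin: "linear_map EE E \<sigma>"
    unfolding \<sigma>_def by (rule EE.induced_bilinear_linear[OF k_algebra_E bilinear_S_right])
  have pure: "\<sigma> (pure_tensor E E b c) = b \<otimes>\<^bsub>E\<^esub> S c" if "b \<in> carrier E" "c \<in> carrier E" for b c
    unfolding \<sigma>_def by (rule EE.induced_pure[OF k_algebra_E bilinear_S_right that])
  note [simp] = linear_mapD[OF lin] pure
  have step: "\<sigma> (u \<otimes>\<^bsub>EE\<^esub> \<Delta> (gen s)) = \<epsilon> (gen s) \<odot>\<^bsub>E\<^esub> \<sigma> u" if "u \<in> carrier EE" for s u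
    using that
  proof (induction rule: EE.tensor_induct)
    case (pure a b)
    have "a \<otimes>\<^bsub>E\<^esub> gg \<otimes>\<^bsub>E\<^esub> (S xx \<otimes>\<^bsub>E\<^esub> S b) = \<ominus>\<^bsub>E\<^esub> (a \<otimes>\<^bsub>E\<^esub> gg \<otimes>\<^bsub>E\<^esub> (S gg \<otimes>\<^bsub>E\<^esub> (xx \<otimes>\<^bsub>E\<^esub> S b)))"
      using pure by (simp add: S_inverse(5) E.l_minus E.r_minus E.m_assoc)
    also have "\<dots> = \<ominus>\<^bsub>E\<^esub> (a \<otimes>\<^bsub>E\<^esub> xx \<otimes>\<^bsub>E\<^esub> S b)"
      using pure by (simp add: mult_inverse_cancel(2) E.m_assoc[of a xx])
    finally have neg: "a \<otimes>\<^bsub>E\<^esub> xx \<otimes>\<^bsub>E\<^esub> S b \<oplus>\<^bsub>E\<^esub> a \<otimes>\<^bsub>E\<^esub> gg \<otimes>\<^bsub>E\<^esub> (S xx \<otimes>\<^bsub>E\<^esub> S b) = \<zero>\<^bsub>E\<^esub>"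
      using pure by (simp add: E.r_neg)
    show ?case
      using pure by (cases s)
        (simp_all add: EE.pure_tensor_mult mult_inverse_cancel T.r_distr neg)
  qed (simp add: T.l_distr E.smult_add_right)
  have "\<forall>u\<in>carrier EE. \<sigma> (u \<otimes>\<^bsub>EE\<^esub> \<Delta> a) = \<epsilon> a \<odot>\<^bsub>E\<^esub> \<sigma> u"
    using assms by (induction rule: E_induct)
      (simp_all add: step E.smult_smult E.smult_add_left T.r_distr T.smult_mult_right mult.commute
        flip: T.m_assoc)
  then have "\<sigma> (\<one>\<^bsub>EE\<^esub> \<otimes>\<^bsub>EE\<^esub> \<Delta> a) = \<epsilon> a \<odot>\<^bsub>E\<^esub> \<sigma> \<one>\<^bsub>EE\<^esub>" by blast
  then show ?thesis using assms by (simp add: \<sigma>_def[symmetric] EE.tensor_one[symmetric]) (simp add: EE.tensor_one)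
qed

end

section \<open>The Hopf algebra axioms\<close>

text \<open>
  The Hopf algebra record extends the algebra record by comultiplication and counit; none of the
  constructions on algebras sees these extra fields.
\<close>

lemma module_extend_simps [simp]:
  "carrier (module.extend A e) = carrier A" "monoid.mult (module.extend A e) = monoid.mult A"
  "\<one>\<^bsub>module.extend A e\<^esub> = \<one>\<^bsub>A\<^esub>" "\<zero>\<^bsub>module.extend A e\<^esub> = \<zero>\<^bsub>A\<^esub>" "add (module.extend A e) = add A"
  "module.smult (module.extend A e) = module.smult A"
  by (simp_all add: module.defs)

lemma tensor_extend_left [simp]: "tensor (module.extend A e) B = tensor A B"
  by (simp add: tensor_def tensor_ideal_def tensor_relations_def DirProd_def)

lemma tensor_extend_right [simp]: "tensor A (module.extend B e) = tensor A B"
  by (simp add: tensor_def tensor_ideal_def tensor_relations_def DirProd_def)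

lemma pure_tensor_extend_left [simp]: "pure_tensor (module.extend A e) B = pure_tensor A B"
  by (simp add: pure_tensor_def tensor_ideal_def tensor_relations_def DirProd_def fun_eq_iff)

lemma pure_tensor_extend_right [simp]: "pure_tensor A (module.extend B e) = pure_tensor A B"
  by (simp add: pure_tensor_def tensor_ideal_def tensor_relations_def DirProd_def fun_eq_iff)

lemma induced_extend [simp]: "induced (module.extend A e) = induced A"
  by (simp add: induced_def finsum_def finprod_def fun_eq_iff)

lemma tensor_map_extend_left [simp]: "tensor_map (module.extend C e) D = tensor_map C D"
  by (simp add: tensor_map_def fun_eq_iff)

lemma tensor_map_extend_right [simp]: "tensor_map C (module.extend D e) = tensor_map C D"
  by (simp add: tensor_map_def fun_eq_iff)

lemma tensor_assoc_extend [simp]: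
  "tensor_assoc (module.extend A e) (module.extend B e') (module.extend C e'') = tensor_assoc A B C"
  by (simp add: tensor_assoc_def fun_eq_iff)

lemma k_algebra_hom_extend_left [simp]: "k_algebra_hom (module.extend A e) B = k_algebra_hom A B"
  by (simp add: k_algebra_hom_def ring_hom_def)

lemma k_algebra_hom_extend_right [simp]: "k_algebra_hom A (module.extend B e) = k_algebra_hom A B"
  by (simp add: k_algebra_hom_def ring_hom_def)

lemma k_algebra_extend:
  assumes "k_algebra A"
  shows "k_algebra (module.extend A e)"
proof -
  interpret A: k_alg A by (rule k_alg.intro) fact
  show ?thesis
  proof (rule k_algebraI)
    show "ring (module.extend A e)"
      by (rule ring_cong[OF A.ring_axioms]) simp_all
  qed (simp_all add: A.smult_add_left A.smult_add_right A.smult_smult A.smult_mult_left A.smult_mult_right)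
qed

context E_hopf_context
begin

lemma E_hopf_eq: "E_hopf p n \<alpha> = module.extend E (bialgebra.fields \<Delta> \<epsilon>)"
  by (simp add: E_hopf_def Let_def \<Delta>_def \<epsilon>_def)

lemma E_hopf_simps [simp]:
  "comult (module.extend E (bialgebra.fields \<Delta> \<epsilon>)) = \<Delta>"
  "counit (module.extend E (bialgebra.fields \<Delta> \<epsilon>)) = \<epsilon>"
  by (simp_all add: module.defs bialgebra.defs)

theorem hopf_algebra_E: "hopf_algebra (E_hopf p n \<alpha>)"
proof -
  have "bialgebra (E_hopf p n \<alpha>)"
    unfolding bialgebra_def E_hopf_eq
    by (simp add: k_algebra_extend[OF k_algebra_E] \<Delta>_hom \<epsilon>_hom coassociative counit_left counit_right)
  moreover have "is_antipode (E_hopf p n \<alpha>) S"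
    unfolding is_antipode_def E_hopf_eq
    by (simp add: antipode_left antipode_right)
  ultimately show ?thesis
    unfolding hopf_algebra_def by blast
qed

end

section \<open>A faithful representation\<close>

text \<open>
  A recipe for solutions of the relations from simpler data: a Weyl type pair \<open>t, \<theta>\<close> with
  \<open>[\<theta>, t] = t\<close>, and a pair \<open>s, h\<close> with \<open>[s, h] = a h\<close> that commutes with it. With \<open>g = (1 - t)\<^sup>-\<^sup>1\<close> the
  first pair alone satisfies the relation between \<open>g\<close> and \<open>x\<close>, for \<open>x = \<theta>\<close>; twisting \<open>\<theta>\<close> by \<open>s\<close> makes
  the commutator with \<open>h\<close> come out right and, by \<open>twist_power\<close>, preserves \<open>x\<^sup>p = x\<close>.
\<close>

lemma E_relations_model:
  fixes a t \<theta> s h :: "'r::ring_1"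
  assumes p: "prime p" "of_nat p = (0 :: 'r)" and a: "\<And>y. a * y = y * a"
    and t: "t ^ p = 0" and \<theta>: "\<theta> ^ p = \<theta>" and \<theta>t: "\<theta> * t - t * \<theta> = t"
    and s: "s * t = t * s" "s * \<theta> = \<theta> * s"
    and h: "h ^ n = 1" "h * t = t * h" "h * \<theta> = \<theta> * h" "s * h - h * s = a * h"
  defines "g \<equiv> (1 - t) ^ (p - 1)"
  shows "E_relations_hold p n a g h (\<theta> + s * (1 - g))" "(1 - t) ^ p = 1"
proof -
  define \<gamma> where "\<gamma> = 1 - t"
  have pS: "p = Suc (p - 1)" using p prime_gt_0_nat by (simp add: Suc_diff_1)
  show "(1 - t) ^ p = 1" using freshman_diff[OF p, of 1 t] t by simp
  then have \<gamma>p: "\<gamma> ^ p = 1" by (simp add: \<gamma>_def)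
  have g\<gamma>: "g * \<gamma> = 1" and \<gamma>g: "\<gamma> * g = 1"
    using \<gamma>p pS unfolding g_def \<gamma>_def by (metis power_Suc2, metis power_Suc)
  have gp: "g ^ p = 1"
    using \<gamma>p unfolding g_def \<gamma>_def by (metis mult.commute power_mult power_one)
  have g_comm: "y * g = g * y" if "y * t = t * y" for y
    unfolding g_def using power_commuting_commutes[of "1 - t" y "p - 1"] that by (simp add: algebra_simps)
  have g\<theta>: "g * \<theta> - \<theta> * g = g * (1 - g)"
  proof -
    have "g * (\<theta> * \<gamma> - \<gamma> * \<theta>) * g = (g * \<theta>) * (\<gamma> * g) - (g * \<gamma>) * (\<theta> * g)"
      by (simp add: algebra_simps)
    then have "g * \<theta> - \<theta> * g = g * (\<theta> * \<gamma> - \<gamma> * \<theta>) * g"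
      unfolding g\<gamma> \<gamma>g by simp
    also have "\<theta> * \<gamma> - \<gamma> * \<theta> = \<gamma> - 1"
      using \<theta>t by (simp add: \<gamma>_def algebra_simps)
    also have "g * (\<gamma> - 1) * g = (g * \<gamma>) * g - g * g"
      by (simp add: algebra_simps)
    also have "\<dots> = g * (1 - g)"
      unfolding g\<gamma> by (simp add: algebra_simps)
    finally show ?thesis .
  qed
  have sg: "s * g = g * s" and hg: "h * g = g * h" using g_comm s h by auto
  define x where "x = \<theta> + s * (1 - g)"
  have xp: "x ^ p = x"
    unfolding x_def by (rule twist_power[OF p gp \<theta> g\<theta> sg s(2)])
  have "g * x - x * g = (g * \<theta> - \<theta> * g) + (g * s) * (1 - g) - (s * g) * (1 - g)"
    by (simp add: x_def algebra_simps)
  then have gx: "g * x - x * g = g * (1 - g)"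
    unfolding g\<theta> sg by simp
  have "x * h - h * x = (\<theta> * h - h * \<theta>) + (s * h - h * s) * (1 - g)"
    using hg by (simp add: x_def algebra_simps)
  then have "x * h - h * x = a * (h * (1 - g))"
    unfolding h(3,4) by (simp add: mult.assoc)
  then show "E_relations_hold p n a g h (\<theta> + s * (1 - g))"
    using gp h(1) hg xp gx by (simp add: E_relations_hold_def flip: x_def)
qed

lemma E_triple_model:
  fixes B :: "('k::field, 'a) module"
  assumes B: "k_algebra B" and p: "p = CHAR('k)" "p > 0"
    and c: "t \<in> carrier B" "\<theta> \<in> carrier B" "s \<in> carrier B" "h \<in> carrier B"
    and rel: "t [^]\<^bsub>B\<^esub> p = \<zero>\<^bsub>B\<^esub>" "\<theta> [^]\<^bsub>B\<^esub> p = \<theta>" "\<theta> \<otimes>\<^bsub>B\<^esub> t \<ominus>\<^bsub>B\<^esub> t \<otimes>\<^bsub>B\<^esub> \<theta> = t"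
      "s \<otimes>\<^bsub>B\<^esub> t = t \<otimes>\<^bsub>B\<^esub> s" "s \<otimes>\<^bsub>B\<^esub> \<theta> = \<theta> \<otimes>\<^bsub>B\<^esub> s" "h [^]\<^bsub>B\<^esub> n = \<one>\<^bsub>B\<^esub>" "h \<otimes>\<^bsub>B\<^esub> t = t \<otimes>\<^bsub>B\<^esub> h"
      "h \<otimes>\<^bsub>B\<^esub> \<theta> = \<theta> \<otimes>\<^bsub>B\<^esub> h" "s \<otimes>\<^bsub>B\<^esub> h \<ominus>\<^bsub>B\<^esub> h \<otimes>\<^bsub>B\<^esub> s = \<alpha> \<odot>\<^bsub>B\<^esub> h"
  defines "g \<equiv> (\<one>\<^bsub>B\<^esub> \<ominus>\<^bsub>B\<^esub> t) [^]\<^bsub>B\<^esub> (p - 1)"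
  shows "E_triple B p n \<alpha> g h (\<theta> \<oplus>\<^bsub>B\<^esub> s \<otimes>\<^bsub>B\<^esub> (\<one>\<^bsub>B\<^esub> \<ominus>\<^bsub>B\<^esub> g))" "(\<one>\<^bsub>B\<^esub> \<ominus>\<^bsub>B\<^esub> t) [^]\<^bsub>B\<^esub> p = \<one>\<^bsub>B\<^esub>"
proof -
  interpret B: k_alg B by (rule k_alg.intro) fact
  have prime: "prime p" using p prime_CHAR_semidom[where ?'a = 'k] by simp
  have char: "of_nat p = (0 :: ('k, 'a) alg_product)" using alg_product_char p by simp
  define aa tt th ss hh where "aa = put B (\<alpha> \<odot>\<^bsub>B\<^esub> \<one>\<^bsub>B\<^esub>) 0" and "tt = put B t 0" and "th = put B \<theta> 0" and "ss = put B s 0" and "hh = put B h 1"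
  note def = aa_def tt_def th_def ss_def hh_def
  have ac: "\<alpha> \<odot>\<^bsub>B\<^esub> \<one>\<^bsub>B\<^esub> \<in> carrier B" by simp
  have comp: "component R tt = (if R = B then t else \<zero>\<^bsub>R\<^esub>)" "component R th = (if R = B then \<theta> else \<zero>\<^bsub>R\<^esub>)"
    "component R ss = (if R = B then s else \<zero>\<^bsub>R\<^esub>)" "component R hh = (if R = B then h else \<one>\<^bsub>R\<^esub>)"
    "component R aa = (if R = B then \<alpha> \<odot>\<^bsub>B\<^esub> \<one>\<^bsub>B\<^esub> else \<zero>\<^bsub>R\<^esub>)" if "k_algebra R" for R
    using that by (simp_all add: def c[THEN component_put] ac[THEN component_put] component_simps)
  have scal: "scalar_component tt = 0" "scalar_component th = 0" "scalar_component ss = 0" "scalar_component hh = 1"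
    "scalar_component aa = 0"
    by (simp_all add: def c[THEN scalar_component_put] ac[THEN scalar_component_put])
  have central: "aa * y = y * aa" for y unfolding aa_def by (rule put_scalar_central[OF B])
  have "\<alpha> \<odot>\<^bsub>B\<^esub> \<one>\<^bsub>B\<^esub> \<otimes>\<^bsub>B\<^esub> h = \<alpha> \<odot>\<^bsub>B\<^esub> h" using c by (simp add: B.smult_mult_left)
  note rel' = rel this
  have "tt ^ p = 0" "th ^ p = th" "th * tt - tt * th = tt" "ss * tt = tt * ss" "ss * th = th * ss"
    "hh ^ n = 1" "hh * tt = tt * hh" "hh * th = th * hh" "ss * hh - hh * ss = aa * hh"
    by (rule alg_product_eqI;
        use p(2) in \<open>simp add: scal zero_power component_simps component_power comp rel'
          trivial_algebra_identities\<close>)+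
  from E_relations_model[OF prime char central this]
  have 1: "E_relations_hold p n aa ((1 - tt) ^ (p - 1)) hh (th + ss * (1 - (1 - tt) ^ (p - 1)))"
    and 2: "(1 - tt) ^ p = 1" by blast+
  show "(\<one>\<^bsub>B\<^esub> \<ominus>\<^bsub>B\<^esub> t) [^]\<^bsub>B\<^esub> p = \<one>\<^bsub>B\<^esub>"
    using 2[THEN arg_cong, of "component B"] B by (simp add: component_simps component_power comp)
  have "component B aa = \<alpha> \<odot>\<^bsub>B\<^esub> \<one>\<^bsub>B\<^esub>" using B by (simp add: comp)
  from E_triple_project[OF B this 1]
  show "E_triple B p n \<alpha> g h (\<theta> \<oplus>\<^bsub>B\<^esub> s \<otimes>\<^bsub>B\<^esub> (\<one>\<^bsub>B\<^esub> \<ominus>\<^bsub>B\<^esub> g))"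
    using B by (simp add: component_simps component_power comp g_def)
qed

text \<open>
  The linear endomorphisms of the space of sequences of polynomials. The space is far larger than
  necessary, but it involves neither \<open>p\<close> nor \<open>n\<close>; truncation of the polynomials at degree \<open>p\<close> and the
  period \<open>n\<close> enter through the operators instead.
\<close>

definition endomorphisms :: "('k::field, (nat \<Rightarrow> 'k poly) \<Rightarrow> nat \<Rightarrow> 'k poly) module" where
  "endomorphisms =
     \<lparr>carrier = {f. (\<forall>\<phi> \<psi>. f (\<lambda>i. \<phi> i + \<psi> i) = (\<lambda>i. f \<phi> i + f \<psi> i)) \<and>
                    (\<forall>c \<phi>. f (\<lambda>i. Polynomial.smult c (\<phi> i)) = (\<lambda>i. Polynomial.smult c (f \<phi> i)))},
      monoid.mult = (\<lambda>f g \<phi>. f (g \<phi>)), one = (\<lambda>\<phi>. \<phi>), zero = (\<lambda>\<phi> i. 0),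
      add = (\<lambda>f g \<phi> i. f \<phi> i + g \<phi> i), module.smult = (\<lambda>c f \<phi> i. Polynomial.smult c (f \<phi> i))\<rparr>"

lemma endomorphisms_simps [simp]:
  "f \<otimes>\<^bsub>endomorphisms\<^esub> g = (\<lambda>\<phi>. f (g \<phi>))" "\<one>\<^bsub>endomorphisms\<^esub> = (\<lambda>\<phi>. \<phi>)" "\<zero>\<^bsub>endomorphisms\<^esub> = (\<lambda>\<phi> i. 0)"
  "f \<oplus>\<^bsub>endomorphisms\<^esub> g = (\<lambda>\<phi> i. f \<phi> i + g \<phi> i)"
  "c \<odot>\<^bsub>endomorphisms\<^esub> f = (\<lambda>\<phi> i. Polynomial.smult c (f \<phi> i))"
  by (simp_all add: endomorphisms_def)

lemma endomorphisms_carrier: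
  "f \<in> carrier endomorphisms \<longleftrightarrow> (\<forall>\<phi> \<psi>. f (\<lambda>i. \<phi> i + \<psi> i) = (\<lambda>i. f \<phi> i + f \<psi> i)) \<and>
     (\<forall>c \<phi>. f (\<lambda>i. Polynomial.smult c (\<phi> i)) = (\<lambda>i. Polynomial.smult c (f \<phi> i)))"
  by (simp add: endomorphisms_def)

lemma endomorphism_zero: "f \<in> carrier endomorphisms \<Longrightarrow> f (\<lambda>i. 0) = (\<lambda>i. 0)"
proof -
  assume "f \<in> carrier endomorphisms"
  then have "f (\<lambda>i. Polynomial.smult c (\<phi> i)) = (\<lambda>i. Polynomial.smult c (f \<phi> i))" for c \<phi>
    by (simp add: endomorphisms_carrier)
  from this[of 0 "\<lambda>i. 0"] show ?thesis by simp
qed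

lemma k_algebra_endomorphisms: "k_algebra (endomorphisms :: ('k::field, _) module)"
proof (rule k_algebraI)
  show "ring (endomorphisms :: ('k, _) module)"
  proof (intro ringI abelian_groupI monoidI)
    fix f :: "(nat \<Rightarrow> 'k poly) \<Rightarrow> nat \<Rightarrow> 'k poly" assume f: "f \<in> carrier endomorphisms"
    show "\<exists>g\<in>carrier endomorphisms. g \<oplus>\<^bsub>endomorphisms\<^esub> f = \<zero>\<^bsub>endomorphisms\<^esub>"
      by (rule bexI[of _ "\<lambda>\<phi> i. - f \<phi> i"]) (use f in \<open>auto simp: endomorphisms_carrier fun_eq_iff\<close>)
  qed (auto simp: endomorphisms_carrier smult_add_right add_ac)
qed (auto simp: endomorphisms_carrier smult_add_left smult_add_right mult.commute fun_eq_iff)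

lemma endomorphisms_minus [simp]:
  assumes "g \<in> carrier endomorphisms"
  shows "f \<ominus>\<^bsub>endomorphisms\<^esub> g = (\<lambda>\<phi> i. f \<phi> i - g \<phi> i)"
proof -
  interpret k_alg endomorphisms by (rule k_alg.intro, rule k_algebra_endomorphisms)
  have "\<ominus>\<^bsub>endomorphisms\<^esub> g = (\<lambda>\<phi> i. - g \<phi> i)"
    by (rule add.inv_equality) (use assms in \<open>auto simp: endomorphisms_carrier fun_eq_iff\<close>)
  then show ?thesis by (simp add: minus_eq)
qed

lemma endomorphisms_power: "f [^]\<^bsub>endomorphisms\<^esub> (m::nat) = f ^^ m"
  by (induction m) (auto simp: fun_eq_iff funpow_swap1 nat_pow_def)

text \<open>
  The cyclic permutation of each block \<open>{q n, ..., q n + n - 1}\<close>. It has order \<open>n\<close>, and it agrees with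
  the successor modulo \<open>n\<close>, hence in \<open>k\<close> because \<open>p\<close> divides \<open>n\<close>.
\<close>

definition block_shift :: "nat \<Rightarrow> nat \<Rightarrow> nat" where
  "block_shift n i = n * (i div n) + Suc i mod n"

lemma block_shift_power: "n > 0 \<Longrightarrow> (block_shift n ^^ m) i = n * (i div n) + (i + m) mod n"
proof (induction m)
  case (Suc m)
  then have "(block_shift n ^^ Suc m) i = block_shift n (n * (i div n) + (i + m) mod n)" by simp
  also have "\<dots> = n * (i div n) + Suc (n * (i div n) + (i + m) mod n) mod n"
    using Suc.prems by (simp add: block_shift_def div_add1_eq[of "n * (i div n)"])
  also have "Suc (n * (i div n) + (i + m) mod n) mod n = (i + Suc m) mod n"
    by (simp add: mod_Suc_eq)
  finally show ?case .
qed simp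

context E_hopf_context
begin

text \<open>
  The data for \<open>E_relations_model\<close>: \<open>t\<close> multiplies by the variable and truncates below degree \<open>p\<close>, \<open>\<theta>\<close>
  is the Euler operator \<open>t d/dt\<close>, \<open>s\<close> scales the \<open>i\<close>-th row by \<open>- i \<alpha>\<close>, and \<open>h\<close> permutes the rows.
  The commutator of \<open>s\<close> and \<open>h\<close> is \<open>\<alpha> h\<close>, since neighbouring row indices differ by \<open>1\<close> in \<open>k\<close>.
\<close>

definition model_t where "model_t = (\<lambda>\<phi> (i::nat). poly_cutoff p (pCons 0 (\<phi> i :: 'k poly)))"
definition model_\<theta> where "model_\<theta> = (\<lambda>\<phi> (i::nat). pCons 0 (pderiv (\<phi> i :: 'k poly)))"
definition model_s where "model_s = (\<lambda>\<phi> i. Polynomial.smult (- of_nat i * \<alpha>) (\<phi> i :: 'k poly))"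
definition model_h where "model_h = (\<lambda>\<phi> i. \<phi> (block_shift n i) :: 'k poly)"
definition model_g where
  "model_g = (\<one>\<^bsub>endomorphisms\<^esub> \<ominus>\<^bsub>endomorphisms\<^esub> model_t) [^]\<^bsub>endomorphisms\<^esub> (p - 1)"
definition model_x where
  "model_x = model_\<theta> \<oplus>\<^bsub>endomorphisms\<^esub> model_s \<otimes>\<^bsub>endomorphisms\<^esub> (\<one>\<^bsub>endomorphisms\<^esub> \<ominus>\<^bsub>endomorphisms\<^esub> model_g)"

lemma of_nat_power_p: "(of_nat a :: 'k) ^ p = of_nat a"
proof (induction a)
  case 0 then show ?case using p by (simp add: zero_power)
next
  case (Suc a)
  have "of_nat p = (0 :: 'k)" using p by simp
  from freshman_commuting[OF prime_p this, of 1 "of_nat a"] Suc show ?case by simp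
qed

lemma model_carrier:
  "model_t \<in> carrier endomorphisms" "model_\<theta> \<in> carrier endomorphisms" "model_s \<in> carrier endomorphisms"
  "model_h \<in> carrier endomorphisms"
  by (auto simp: endomorphisms_carrier model_t_def model_\<theta>_def model_s_def model_h_def fun_eq_iff pderiv_add pderiv_smult
      smult_add_right mult.commute poly_eq_iff coeff_poly_cutoff coeff_pCons split: nat.split)

lemma coeff_model_t_power:
  "coeff ((model_t ^^ m) \<phi> i) k = (if m = 0 then coeff (\<phi> i) k else if m \<le> k \<and> k < p then coeff (\<phi> i) (k - m) else 0)"
  by (induction m arbitrary: k)
     (auto simp: model_t_def coeff_poly_cutoff coeff_pCons split: nat.split)

lemma coeff_model_\<theta>_power: "coeff ((model_\<theta> ^^ m) \<phi> i) k = of_nat k ^ m * coeff (\<phi> i) k"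
  by (induction m arbitrary: k)
     (auto simp: model_\<theta>_def coeff_pCons coeff_pderiv split: nat.split)

lemma of_nat_block_shift: "(of_nat (block_shift n i) :: 'k) = of_nat (Suc i)"
proof -
  have n0: "(of_nat n :: 'k) = 0"
    using p_dvd p by (auto simp: of_nat_eq_0_iff_char_dvd)
  have "(of_nat (Suc i) :: 'k) = of_nat (n * (Suc i div n) + Suc i mod n)"
    by (simp only: mult_div_mod_eq)
  then have "(of_nat (Suc i) :: 'k) = of_nat (Suc i mod n)"
    unfolding of_nat_add of_nat_mult n0 by (simp del: of_nat_Suc)
  then show ?thesis using n0 by (simp add: block_shift_def del: of_nat_Suc)
qed

lemma model_h_power: "(model_h ^^ m) \<phi> = (\<lambda>i. \<phi> ((block_shift n ^^ m) i))"
  by (induction m arbitrary: \<phi>) (auto simp: model_h_def fun_eq_iff funpow_swap1)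

lemma E_triple_endomorphisms: "E_triple endomorphisms p n \<alpha> model_g model_h model_x"
  and model_G_power: "(\<one>\<^bsub>endomorphisms\<^esub> \<ominus>\<^bsub>endomorphisms\<^esub> model_t) [^]\<^bsub>endomorphisms\<^esub> p = \<one>\<^bsub>endomorphisms\<^esub>"
proof -
  let ?B = "endomorphisms :: ('k, _) module"
  interpret k_alg ?B by (rule k_alg.intro, rule k_algebra_endomorphisms)
  have c: "model_t \<in> carrier ?B" "model_\<theta> \<in> carrier ?B" "model_s \<in> carrier ?B" "model_h \<in> carrier ?B"
    using model_carrier by auto
  have t: "model_t [^]\<^bsub>?B\<^esub> p = \<zero>\<^bsub>?B\<^esub>"
    using p(2) by (auto simp: endomorphisms_power fun_eq_iff poly_eq_iff coeff_model_t_power)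
  have \<theta>: "model_\<theta> [^]\<^bsub>?B\<^esub> p = model_\<theta>"
    using coeff_model_\<theta>_power[of 1]
    by (auto simp: endomorphisms_power fun_eq_iff poly_eq_iff coeff_model_\<theta>_power of_nat_power_p)
  have \<theta>t: "model_\<theta> \<otimes>\<^bsub>?B\<^esub> model_t \<ominus>\<^bsub>?B\<^esub> model_t \<otimes>\<^bsub>?B\<^esub> model_\<theta> = model_t"
  proof -
    have "model_t \<otimes>\<^bsub>?B\<^esub> model_\<theta> \<in> carrier ?B" using c by (intro m_closed)
    then show ?thesis
      by (simp only: endomorphisms_minus)
         (auto simp: fun_eq_iff poly_eq_iff model_t_def model_\<theta>_def coeff_poly_cutoff coeff_pCons coeff_pderiv
           algebra_simps split: nat.split)
  qed
  have h: "model_h [^]\<^bsub>?B\<^esub> n = \<one>\<^bsub>?B\<^esub>"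
  proof -
    show ?thesis
      using n by (simp add: endomorphisms_power fun_eq_iff model_h_power block_shift_power)
  qed
  have sh: "model_s \<otimes>\<^bsub>?B\<^esub> model_h \<ominus>\<^bsub>?B\<^esub> model_h \<otimes>\<^bsub>?B\<^esub> model_s = \<alpha> \<odot>\<^bsub>?B\<^esub> model_h"
  proof -
    have "model_h \<otimes>\<^bsub>?B\<^esub> model_s \<in> carrier ?B" using c by (intro m_closed)
    then show ?thesis
      by (simp only: endomorphisms_minus)
         (simp add: fun_eq_iff model_s_def model_h_def of_nat_block_shift algebra_simps
           flip: smult_diff_left)
  qed
  have comm: "model_s \<otimes>\<^bsub>?B\<^esub> model_t = model_t \<otimes>\<^bsub>?B\<^esub> model_s" "model_s \<otimes>\<^bsub>?B\<^esub> model_\<theta> = model_\<theta> \<otimes>\<^bsub>?B\<^esub> model_s"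
    "model_h \<otimes>\<^bsub>?B\<^esub> model_t = model_t \<otimes>\<^bsub>?B\<^esub> model_h" "model_h \<otimes>\<^bsub>?B\<^esub> model_\<theta> = model_\<theta> \<otimes>\<^bsub>?B\<^esub> model_h"
    by (auto simp: fun_eq_iff poly_eq_iff model_t_def model_\<theta>_def model_s_def model_h_def coeff_poly_cutoff
        coeff_pCons pderiv_smult pderiv_minus split: nat.split)
  note 1 = E_triple_model[OF k_algebra p c t \<theta> \<theta>t comm(1,2) h comm(3,4) sh]
  show "E_triple endomorphisms p n \<alpha> model_g model_h model_x"
    unfolding model_g_def model_x_def by (rule 1(1))
  show "(\<one>\<^bsub>endomorphisms\<^esub> \<ominus>\<^bsub>endomorphisms\<^esub> model_t) [^]\<^bsub>endomorphisms\<^esub> p = \<one>\<^bsub>endomorphisms\<^esub>"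
    by (rule 1(2))
qed

definition rep where
  "rep = induced endomorphisms (eval_word endomorphisms
     (\<lambda>s. case s of Gen_g \<Rightarrow> model_g | Gen_h \<Rightarrow> model_h | Gen_x \<Rightarrow> model_x))"

lemma rep_hom: "rep \<in> k_algebra_hom E endomorphisms"
  and rep_gen: "rep gg = model_g" "rep hh = model_h" "rep xx = model_x"
proof -
  let ?f = "\<lambda>s. case s of Gen_g \<Rightarrow> model_g | Gen_h \<Rightarrow> model_h | Gen_x \<Rightarrow> model_x"
  have t: "E_triple endomorphisms p n \<alpha> (?f Gen_g) (?f Gen_h) (?f Gen_x)"
    using E_triple_endomorphisms by simp
  note hom = E_hom_exists[of _ ?f, OF k_algebra_endomorphisms t, folded rep_def]
  show "rep \<in> k_algebra_hom E endomorphisms" by (rule hom(1))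
  show "rep gg = model_g" "rep hh = model_h" "rep xx = model_x"
    using hom(2)[of Gen_g] hom(2)[of Gen_h] hom(2)[of Gen_x] by simp_all
qed

abbreviation row0 :: "'k poly \<Rightarrow> nat \<Rightarrow> 'k poly" where "row0 q \<equiv> (\<lambda>i. if i = 0 then q else 0)"

text \<open>
  The coefficient of \<open>h\<^sup>i g\<^sup>j\<close> in the expansion of \<open>y\<close> in monomials \<open>h\<^sup>i g\<^sup>j x\<^sup>l\<close>. Acting
  on the sequence with \<open>1\<close> in row \<open>0\<close> and zeros elsewhere, \<open>x\<close> gives zero, \<open>g\<^sup>j\<close> gives
  \<open>(1 - t)\<^sup>-\<^sup>j = (1 - t)\<^sup>p\<^sup>-\<^sup>j\<close> in row \<open>0\<close>, and \<open>h\<^sup>i\<close> moves row \<open>0\<close> to row \<open>- i\<close> modulo \<open>n\<close>.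
  The substitution \<open>t \<mapsto> 1 - t\<close> turns \<open>(1 - t)\<^sup>p\<^sup>-\<^sup>j\<close> into a power of \<open>t\<close>.
\<close>

definition coord :: "nat \<Rightarrow> nat \<Rightarrow> (generator list \<Rightarrow>\<^sub>0 'k) set \<Rightarrow> 'k" where
  "coord i j y = coeff (pcompose (rep y (row0 1) ((n - i) mod n)) [:1, -1:]) ((p - j) mod p)"

lemma coord_linear: "linear_map E base_algebra (coord i j)"
  by (rule linear_mapI) (simp_all add: coord_def k_algebra_homD[OF rep_hom] pcompose_add pcompose_smult)

lemma model_G_power_row0:
  assumes "m < p"
  shows "((\<one>\<^bsub>endomorphisms\<^esub> \<ominus>\<^bsub>endomorphisms\<^esub> model_t) ^^ m) (row0 1) = row0 ([:1, -1:] ^ m)"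
  using assms
proof (induction m)
  case (Suc m)
  have "degree ([:1, -1:] ^ m :: 'k poly) \<le> m"
    using degree_power_le[of "[:1, -1:] :: 'k poly" m] by simp
  then have "poly_cutoff p (pCons 0 ([:1, -1:] ^ m)) = (pCons 0 ([:1, -1:] ^ m) :: 'k poly)"
    using Suc.prems
    by (auto simp: poly_eq_iff coeff_poly_cutoff coeff_pCons intro!: coeff_eq_0 split: nat.split)
  moreover have "[:1, -1:] ^ m - pCons 0 ([:1, -1:] ^ m) = ([:1, -1:] ^ Suc m :: 'k poly)"
    by (simp add: mult_pCons_left)
  moreover have "((\<one>\<^bsub>endomorphisms\<^esub> \<ominus>\<^bsub>endomorphisms\<^esub> model_t) ^^ m) (row0 1) = row0 ([:1, -1:] ^ m)"
    using Suc by simp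
  ultimately show ?case
    using model_carrier(1) by (auto simp: model_t_def fun_eq_iff simp del: power_Suc)
qed (auto simp: fun_eq_iff)

lemma model_g_power_row0:
  assumes "j < p"
  shows "(model_g ^^ j) (row0 1) = row0 ([:1, -1:] ^ ((p - j) mod p))"
proof -
  define G where "G = (\<one>\<^bsub>endomorphisms\<^esub> \<ominus>\<^bsub>endomorphisms\<^esub> model_t)"
  have Gp: "G ^^ p = id"
    using model_G_power by (simp add: endomorphisms_power G_def id_def)
  have red: "G ^^ k = G ^^ (k mod p)" for k
  proof -
    have "G ^^ k = G ^^ (p * (k div p) + k mod p)" by simp
    also have "\<dots> = ((G ^^ p) ^^ (k div p)) \<circ> G ^^ (k mod p)"
      by (simp only: funpow_add funpow_mult mult.commute)
    finally show ?thesis unfolding Gp by simp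
  qed
  have "model_g ^^ j = G ^^ ((p - 1) * j)"
    by (simp add: model_g_def endomorphisms_power funpow_mult mult.commute G_def)
  also have "((p - 1) * j) mod p = (p - j) mod p"
  proof (cases j)
    case (Suc j')
    then have "(p - 1) * j = p * j' + (p - j)"
      using assms by (simp add: algebra_simps)
    then show ?thesis by simp
  qed simp
  then have "G ^^ ((p - 1) * j) = G ^^ ((p - j) mod p)" by (metis red)
  finally show ?thesis using model_G_power_row0[of "(p - j) mod p"] p(2) by (simp add: G_def)
qed

definition mono :: "nat \<Rightarrow> nat \<Rightarrow> (generator list \<Rightarrow>\<^sub>0 'k) set" where
  "mono i j = hh [^]\<^bsub>E\<^esub> i \<otimes>\<^bsub>E\<^esub> gg [^]\<^bsub>E\<^esub> j"

lemma mono_closed [simp]: "mono i j \<in> carrier E"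
  by (simp add: mono_def)

lemma coord_mono:
  assumes "i < n" "j < p" "i' < n" "j' < p"
  shows "coord i j (mono i' j') = (if i = i' \<and> j = j' then 1 else 0)"
proof -
  have pc: "pcompose ([:1, -1:] ^ m) [:1, -1:] = (monom 1 m :: 'k poly)" for m
  proof (induction m)
    case (Suc m)
    then show ?case
      by (simp only: power_Suc pcompose_mult) (simp add: pcompose_pCons monom_Suc)
  qed (simp add: one_pCons monom_0)
  have "rep (mono i' j') = (\<lambda>\<phi>. (model_h ^^ i') ((model_g ^^ j') \<phi>))"
    by (simp add: mono_def k_algebra_homD[OF rep_hom] rep_gen endomorphisms_power
        k_algebra_hom_pow[OF k_algebra_E k_algebra_endomorphisms rep_hom])
  then have "rep (mono i' j') (row0 1) ((n - i) mod n) =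
      row0 ([:1, -1:] ^ ((p - j') mod p)) (((n - i) mod n + i') mod n)"
    using assms n by (simp add: model_g_power_row0 model_h_power block_shift_power)
  moreover have "((n - i) mod n + i') mod n = 0 \<longleftrightarrow> i = i'"
  proof (cases "i = 0")
    case False
    then have "((n - i) mod n + i') mod n = 0 \<longleftrightarrow> n dvd (n - i + i')"
      using assms by (simp add: mod_eq_0_iff_dvd)
    also have "\<dots> \<longleftrightarrow> n - i + i' = n"
    proof
      assume "n dvd n - i + i'"
      then obtain k where k: "n - i + i' = n * k" by (elim dvdE)
      have "n * k < n * 2" "n * k \<noteq> 0" using assms False k[symmetric] by auto
      then have "k = 1" by (cases k) auto
      then show "n - i + i' = n" using k by simp
    qed simp
    finally show ?thesis using assms by auto
  qed (use assms in auto)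
  moreover have "(p - j) mod p = (p - j') mod p \<longleftrightarrow> j = j'"
    using assms by (cases "j = 0"; cases "j' = 0") auto
  ultimately show ?thesis
    by (auto simp: coord_def pc)
qed

text \<open>
  \<open>\<theta>\<close> kills the constant \<open>1\<close>, and \<open>s\<close> vanishes on row \<open>0\<close>.
\<close>

lemma coord_mult_x:
  assumes "y \<in> carrier E"
  shows "coord i j (y \<otimes>\<^bsub>E\<^esub> xx) = 0"
proof -
  have "model_g (row0 1) = row0 ([:1, -1:] ^ ((p - 1) mod p))"
    using model_g_power_row0[of 1] prime_gt_1_nat[OF prime_p] by simp
  moreover have "model_g \<in> carrier endomorphisms"
    using k_algebra_homD(1)[OF rep_hom, of gg] by (simp add: rep_gen)
  ultimately have "model_x (row0 1) = (\<lambda>i. 0)"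
    by (auto simp: model_x_def model_\<theta>_def model_s_def fun_eq_iff)
  then have "rep (y \<otimes>\<^bsub>E\<^esub> xx) (row0 1) = (\<lambda>i. 0)"
    using assms endomorphism_zero[OF k_algebra_homD(1)[OF rep_hom assms]]
    by (simp add: k_algebra_homD[OF rep_hom] rep_gen)
  then show ?thesis by (simp add: coord_def)
qed

end

section \<open>The Poincare-Birkhoff-Witt spanning set and coordinates\<close>

lemma finsum_base_algebra: "finite Q \<Longrightarrow> (\<Oplus>\<^bsub>base_algebra\<^esub>q\<in>Q. f q) = sum f Q"
  by (induction Q rule: finite_induct) simp_all

lemma linear_map_linear_extension:
  assumes "k_algebra A" "k_algebra B" "linear_map A B f" "m \<in> Poly_Mapping.keys c \<rightarrow> carrier A"
  shows "f (linear_extension A m c) = linear_extension B (\<lambda>q. f (m q)) c"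
proof -
  interpret A: k_alg A by (rule k_alg.intro) fact
  interpret B: k_alg B by (rule k_alg.intro) fact
  have m: "m q \<in> carrier A" if "q \<in> Poly_Mapping.keys c" for q using assms(4) that by auto
  have "f (linear_extension A m c) = (\<Oplus>\<^bsub>B\<^esub>q\<in>Poly_Mapping.keys c. f (Poly_Mapping.lookup c q \<odot>\<^bsub>A\<^esub> m q))"
    unfolding linear_extension_def by (rule linear_map_finsum[OF assms(1-3)]) (use m in auto)
  also have "\<dots> = linear_extension B (\<lambda>q. f (m q)) c"
    unfolding linear_extension_def
    by (rule B.finsum_cong') (use m linear_mapD[OF assms(3)] in auto)
  finally show ?thesis .
qed

context E_hopf_context
begin

definition pbw :: "nat \<times> nat \<times> nat \<Rightarrow> (generator list \<Rightarrow>\<^sub>0 'k) set" where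
  "pbw = (\<lambda>(i, j, l). mono i j \<otimes>\<^bsub>E\<^esub> xx [^]\<^bsub>E\<^esub> l)"

abbreviation "box \<equiv> {..<n} \<times> {..<p} \<times> {..<p}"

lemma pbw_closed [simp]: "pbw q \<in> carrier E"
  by (cases q) (simp add: pbw_def)

lemma xx_power_p: "xx [^]\<^bsub>E\<^esub> p = xx"
  using E_triple_gens by (simp add: E_triple_def)

lemma power_mod:
  assumes "a \<in> carrier E" "a [^]\<^bsub>E\<^esub> (m::nat) = \<one>\<^bsub>E\<^esub>"
  shows "a [^]\<^bsub>E\<^esub> k = a [^]\<^bsub>E\<^esub> (k mod m)"
proof -
  have "a [^]\<^bsub>E\<^esub> k = a [^]\<^bsub>E\<^esub> (m * (k div m) + k mod m)" by simp
  also have "\<dots> = (a [^]\<^bsub>E\<^esub> m) [^]\<^bsub>E\<^esub> (k div m) \<otimes>\<^bsub>E\<^esub> a [^]\<^bsub>E\<^esub> (k mod m)"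
    by (simp only: E.nat_pow_mult[OF assms(1), symmetric] E.nat_pow_pow[OF assms(1)])
  finally show ?thesis using assms by simp
qed

lemma mono_mod: "mono i j = mono (i mod n) (j mod p)"
  unfolding mono_def using power_mod[OF gen_closed gen_power(2), of i] power_mod[OF gen_closed gen_power(1), of j]
  by simp

lemma mono_0 [simp]: "mono 0 0 = \<one>\<^bsub>E\<^esub>"
  by (simp add: mono_def)

lemma gg_mono: "mono 0 (Suc 0) = gg" and hh_mono: "mono (Suc 0) 0 = hh"
  by (simp_all add: mono_def)

lemma gg_hh_power: "gg [^]\<^bsub>E\<^esub> (j::nat) \<otimes>\<^bsub>E\<^esub> hh [^]\<^bsub>E\<^esub> (i::nat) = hh [^]\<^bsub>E\<^esub> i \<otimes>\<^bsub>E\<^esub> gg [^]\<^bsub>E\<^esub> j"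
proof -
  have "gg \<otimes>\<^bsub>E\<^esub> hh [^]\<^bsub>E\<^esub> i = hh [^]\<^bsub>E\<^esub> i \<otimes>\<^bsub>E\<^esub> gg"
    using E.group_commutes_pow[of hh gg i] gen_power(3) by simp
  then show ?thesis
    using E.group_commutes_pow[of gg "hh [^]\<^bsub>E\<^esub> i" j] by simp
qed

lemma mono_mult: "mono i j \<otimes>\<^bsub>E\<^esub> mono i' j' = mono (i + i') (j + j')"
proof -
  have "mono i j \<otimes>\<^bsub>E\<^esub> mono i' j' =
      hh [^]\<^bsub>E\<^esub> i \<otimes>\<^bsub>E\<^esub> (gg [^]\<^bsub>E\<^esub> j \<otimes>\<^bsub>E\<^esub> hh [^]\<^bsub>E\<^esub> i') \<otimes>\<^bsub>E\<^esub> gg [^]\<^bsub>E\<^esub> j'"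
    by (simp add: mono_def E.m_assoc)
  also have "\<dots> = (hh [^]\<^bsub>E\<^esub> i \<otimes>\<^bsub>E\<^esub> hh [^]\<^bsub>E\<^esub> i') \<otimes>\<^bsub>E\<^esub> (gg [^]\<^bsub>E\<^esub> j \<otimes>\<^bsub>E\<^esub> gg [^]\<^bsub>E\<^esub> j')"
    unfolding gg_hh_power by (simp add: E.m_assoc)
  finally show ?thesis by (simp add: mono_def E.nat_pow_mult)
qed

lemma mono_power: "mono i j [^]\<^bsub>E\<^esub> (m::nat) = mono (i * m) (j * m)"
  by (induction m) (simp_all add: mono_mult add.commute)

lemma xx_mono:
  "xx \<otimes>\<^bsub>E\<^esub> mono i j = mono i j \<otimes>\<^bsub>E\<^esub> xx \<oplus>\<^bsub>E\<^esub> (of_nat i * \<alpha> - of_nat j) \<odot>\<^bsub>E\<^esub> (mono i j \<ominus>\<^bsub>E\<^esub> mono i (Suc j))"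
proof -
  have "mono i j \<otimes>\<^bsub>E\<^esub> (\<one>\<^bsub>E\<^esub> \<ominus>\<^bsub>E\<^esub> gg) = mono i j \<ominus>\<^bsub>E\<^esub> mono i (Suc j)"
    using mono_mult[of i j 0 "Suc 0"]
    by (simp add: E.minus_eq E.r_distr E.r_minus gg_mono)
  then have eq: "xx \<otimes>\<^bsub>E\<^esub> mono i j \<ominus>\<^bsub>E\<^esub> mono i j \<otimes>\<^bsub>E\<^esub> xx =
      (of_nat i * \<alpha> - of_nat j) \<odot>\<^bsub>E\<^esub> (mono i j \<ominus>\<^bsub>E\<^esub> mono i (Suc j))"
    using E_triple_commutator[OF k_algebra_E p(2) E_triple_gens, of i j] by (simp add: mono_def)
  have "u = v \<oplus>\<^bsub>E\<^esub> w" if "u \<ominus>\<^bsub>E\<^esub> v = w" "u \<in> carrier E" "v \<in> carrier E" for u v w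
    using that by (auto simp: E.minus_eq E.a_assoc E.a_comm[of v] E.l_neg)
  from this[OF eq] show ?thesis by simp
qed

text \<open>
  \<open>x\<^sup>p = x\<close> lowers an exponent \<open>l \<ge> p\<close> to \<open>l - p + 1\<close>, which is smaller because \<open>p > 1\<close>.
\<close>

lemma xx_power_reduce: "\<exists>l'<p. xx [^]\<^bsub>E\<^esub> (l::nat) = xx [^]\<^bsub>E\<^esub> l'"
proof (induction l rule: less_induct)
  case (less l)
  show ?case
  proof (cases "l < p")
    case False
    have p1: "p > 1" by (rule prime_gt_1_nat[OF prime_p])
    have "xx [^]\<^bsub>E\<^esub> l = xx [^]\<^bsub>E\<^esub> (l - p) \<otimes>\<^bsub>E\<^esub> xx [^]\<^bsub>E\<^esub> p"
      using False by (simp add: E.nat_pow_mult)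
    also have "\<dots> = xx [^]\<^bsub>E\<^esub> Suc (l - p)"
      by (simp add: xx_power_p)
    finally show ?thesis using less[of "Suc (l - p)"] False p1 by auto
  qed auto
qed

definition pbw_span :: "(generator list \<Rightarrow>\<^sub>0 'k) set set" where
  "pbw_span = {y. \<exists>c. Poly_Mapping.keys c \<subseteq> box \<and> y = linear_extension E pbw c}"

lemma pbw_spanI: "Poly_Mapping.keys c \<subseteq> box \<Longrightarrow> y = linear_extension E pbw c \<Longrightarrow> y \<in> pbw_span"
  by (auto simp: pbw_span_def)

lemma pbw_spanE:
  assumes "y \<in> pbw_span"
  obtains c where "Poly_Mapping.keys c \<subseteq> box" "y = linear_extension E pbw c"
  using assms unfolding pbw_span_def by blast

lemma pbw_span_add:
  assumes "y \<in> pbw_span" "z \<in> pbw_span"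
  shows "y \<oplus>\<^bsub>E\<^esub> z \<in> pbw_span"
proof -
  obtain c where c: "Poly_Mapping.keys c \<subseteq> box" "y = linear_extension E pbw c"
    using assms(1) by (rule pbw_spanE)
  obtain d where d: "Poly_Mapping.keys d \<subseteq> box" "z = linear_extension E pbw d"
    using assms(2) by (rule pbw_spanE)
  show ?thesis
    by (rule pbw_spanI[of "c + d"]) (use c d in \<open>simp_all add: keys_add_subset E.linear_extension_add Pi_iff\<close>)
qed

lemma pbw_span_smult:
  assumes "y \<in> pbw_span"
  shows "d \<odot>\<^bsub>E\<^esub> y \<in> pbw_span"
proof -
  obtain c where c: "Poly_Mapping.keys c \<subseteq> box" "y = linear_extension E pbw c"
    using assms by (rule pbw_spanE)
  show ?thesis
  proof (rule pbw_spanI)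
    show "Poly_Mapping.keys (Poly_Mapping.map ((*) d) c) \<subseteq> box"
      by (rule order_trans[OF keys_map_times_subset c(1)])
    show "d \<odot>\<^bsub>E\<^esub> y = linear_extension E pbw (Poly_Mapping.map ((*) d) c)"
      using c(2) by (simp add: E.linear_extension_scale Pi_iff)
  qed
qed

lemma pbw_in_span: "pbw (i, j, l) \<in> pbw_span"
proof -
  obtain l' where l': "l' < p" "xx [^]\<^bsub>E\<^esub> l = xx [^]\<^bsub>E\<^esub> l'" using xx_power_reduce by blast
  have "pbw (i, j, l) = pbw (i mod n, j mod p, l')"
    using mono_mod[of i j] l'(2) by (simp add: pbw_def)
  also have "\<dots> = linear_extension E pbw (Poly_Mapping.single (i mod n, j mod p, l') 1)"
    by simp
  finally show ?thesis
    by (rule pbw_spanI[rotated]) (use l'(1) n p(2) in simp)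
qed

lemma mono_mult_pbw: "mono i' j' \<otimes>\<^bsub>E\<^esub> pbw (i, j, l) = pbw (i' + i, j' + j, l)"
  by (simp add: pbw_def mono_mult flip: E.m_assoc)

lemma gen_mult_pbw: "gen s \<otimes>\<^bsub>E\<^esub> pbw q \<in> pbw_span"
proof -
  obtain i j l where q: "q = (i, j, l)" by (cases q) auto
  show ?thesis
  proof (cases s)
    case Gen_g
    then show ?thesis using mono_mult_pbw[of 0 "Suc 0" i j l] pbw_in_span by (simp add: q gg_mono)
  next
    case Gen_h
    then show ?thesis using mono_mult_pbw[of "Suc 0" 0 i j l] pbw_in_span by (simp add: q hh_mono)
  next
    case Gen_x
    have "xx \<otimes>\<^bsub>E\<^esub> xx [^]\<^bsub>E\<^esub> l = xx [^]\<^bsub>E\<^esub> Suc l" using E.nat_pow_Suc2[of xx l] by simp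
    then have "gen s \<otimes>\<^bsub>E\<^esub> pbw q = pbw (i, j, Suc l) \<oplus>\<^bsub>E\<^esub>
        (of_nat i * \<alpha> - of_nat j) \<odot>\<^bsub>E\<^esub> (pbw (i, j, l) \<oplus>\<^bsub>E\<^esub> (- 1) \<odot>\<^bsub>E\<^esub> pbw (i, Suc j, l))"
      by (simp add: q Gen_x pbw_def xx_mono E.l_distr E.smult_mult_left E.minus_eq E.m_assoc E.l_minus E.smult_minus_one
          del: E.nat_pow_Suc flip: E.m_assoc[of xx])
    then show ?thesis by (simp add: pbw_span_add pbw_span_smult pbw_in_span)
  qed
qed

lemma carrier_pbw_span:
  assumes "y \<in> carrier E"
  shows "y \<in> pbw_span"
  using assms
proof (induction rule: E_induct)
  case one
  show ?case using pbw_in_span[of 0 0 0] by (simp add: pbw_def)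
next
  case (gen s a)
  obtain c where c: "Poly_Mapping.keys c \<subseteq> box" "a = linear_extension E pbw c"
    using gen.IH by (rule pbw_spanE)
  have zero: "\<zero>\<^bsub>E\<^esub> \<in> pbw_span"
    by (rule pbw_spanI[of 0]) simp_all
  have "Poly_Mapping.keys c \<subseteq> UNIV" by simp
  then have "gen s \<otimes>\<^bsub>E\<^esub> linear_extension E pbw c \<in> pbw_span"
    by (induction c rule: finite_support_induct)
       (simp_all add: zero E.linear_extension_add E.r_distr pbw_span_add Pi_iff E.linear_extension_closed
         E.smult_mult_right pbw_span_smult gen_mult_pbw)
  then show ?case using c by simp
qed (simp_all add: pbw_span_add pbw_span_smult)

lemma linear_maps_pbw_eq:
  assumes "k_algebra B" "linear_map E B f" "linear_map E B f'" "\<And>q. q \<in> box \<Longrightarrow> f (pbw q) = f' (pbw q)"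
    and "y \<in> carrier E"
  shows "f y = f' y"
proof -
  interpret B: k_alg B by (rule k_alg.intro) fact
  obtain c where c: "Poly_Mapping.keys c \<subseteq> box" "y = linear_extension E pbw c"
    using carrier_pbw_span[OF assms(5)] by (rule pbw_spanE)
  have "linear_extension B (\<lambda>q. f (pbw q)) c = linear_extension B (\<lambda>q. f' (pbw q)) c"
    unfolding linear_extension_def
    by (rule B.finsum_cong') (use c(1) assms(4) linear_mapD(1)[OF assms(3)] in auto)
  then show ?thesis
    using c(2) linear_map_linear_extension[OF k_algebra_E assms(1,2), of pbw c]
      linear_map_linear_extension[OF k_algebra_E assms(1,3), of pbw c] by (simp add: Pi_iff)
qed

text \<open>
  The algebra map to \<open>k\<close> with \<open>g, h \<mapsto> 1\<close> and \<open>x \<mapsto> a\<close>; it exists because \<open>a\<close> in the prime field satisfies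
  \<open>a\<^sup>p = a\<close>. For \<open>a = 0\<close> it is the counit.
\<close>

definition character :: "nat \<Rightarrow> (generator list \<Rightarrow>\<^sub>0 'k) set \<Rightarrow> 'k" where
  "character a = induced base_algebra (eval_word base_algebra (\<lambda>s. case s of Gen_x \<Rightarrow> of_nat a | _ \<Rightarrow> 1))"

lemma character_hom: "character a \<in> k_algebra_hom E base_algebra"
  and character_gen [simp]: "character a gg = 1" "character a hh = 1" "character a xx = of_nat a"
proof -
  let ?f = "\<lambda>s. case s of Gen_x \<Rightarrow> of_nat a :: 'k | _ \<Rightarrow> 1"
  have t: "E_triple base_algebra p n \<alpha> (?f Gen_g) (?f Gen_h) (?f Gen_x)"
    using of_nat_power_p by (simp add: E_triple_def)
  note hom = E_hom_exists[of _ ?f, OF k_algebra_base t, folded character_def]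
  show "character a \<in> k_algebra_hom E base_algebra" by (rule hom(1))
  show "character a gg = 1" "character a hh = 1" "character a xx = of_nat a"
    using hom(2)[of Gen_g] hom(2)[of Gen_h] hom(2)[of Gen_x] by simp_all
qed

lemmas character_simps [simp] = k_algebra_homD(2-5)[OF character_hom, simplified]

lemma character_cong: "(of_nat a :: 'k) = of_nat b \<Longrightarrow> character a = character b"
  by (simp add: character_def cong: generator.case_cong)

text \<open>
  Convolution with a character. It fixes \<open>g\<close> and \<open>h\<close> and sends \<open>x\<close> to \<open>x + a\<close>.
\<close>

definition translate :: "nat \<Rightarrow> (generator list \<Rightarrow>\<^sub>0 'k) set \<Rightarrow> (generator list \<Rightarrow>\<^sub>0 'k) set" where
  "translate a y = induced E (\<lambda>(b, c). character a b \<odot>\<^bsub>E\<^esub> c) (\<Delta> y)"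

lemma translate_hom: "translate a \<in> k_algebra_hom E E"
  using left_translate_hom[OF character_hom] by (simp add: translate_def[abs_def])

lemmas translate_simps [simp] = k_algebra_homD[OF translate_hom]
lemmas translate_sum = linear_mapD(2)[OF left_translate_linear[OF character_hom]]
lemmas translate_pure = left_translate_pure[OF character_hom]

lemma translate_gen [simp]:
  "translate a gg = gg" "translate a hh = hh" "translate a xx = of_nat a \<odot>\<^bsub>E\<^esub> \<one>\<^bsub>E\<^esub> \<oplus>\<^bsub>E\<^esub> xx"
  by (simp_all add: translate_def translate_sum translate_pure)

lemma translate_power: "y \<in> carrier E \<Longrightarrow> translate a (y [^]\<^bsub>E\<^esub> (m::nat)) = translate a y [^]\<^bsub>E\<^esub> m"
  by (rule k_algebra_hom_pow[OF k_algebra_E k_algebra_E translate_hom])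

lemma translate_mono [simp]: "translate a (mono i j) = mono i j"
  by (simp add: mono_def translate_power)

lemma coord_simps:
  "y \<in> carrier E \<Longrightarrow> z \<in> carrier E \<Longrightarrow> coord i j (y \<oplus>\<^bsub>E\<^esub> z) = coord i j y + coord i j z"
  "y \<in> carrier E \<Longrightarrow> coord i j (c \<odot>\<^bsub>E\<^esub> y) = c * coord i j y"
  "y \<in> carrier E \<Longrightarrow> z \<in> carrier E \<Longrightarrow> coord i j (y \<ominus>\<^bsub>E\<^esub> z) = coord i j y - coord i j z"
  using linear_mapD(2,3)[OF coord_linear, of y] linear_map_minus[OF k_algebra_E k_algebra_base coord_linear]
  by simp_all

text \<open>
  Translation replaces \<open>x\<close> by \<open>a + x\<close>, and \<open>coord\<close> drops every term that ends in \<open>x\<close>.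
\<close>

lemma coord_translate_pbw:
  assumes "i < n" "j < p" "i' < n" "j' < p"
  shows "coord i j (translate a (pbw (i', j', l))) = (if i = i' \<and> j = j' then of_nat a ^ l else 0)"
proof -
  define u where "u = of_nat a \<odot>\<^bsub>E\<^esub> \<one>\<^bsub>E\<^esub> \<oplus>\<^bsub>E\<^esub> xx"
  have u: "u \<in> carrier E" by (simp add: u_def)
  have step: "coord i j (y \<otimes>\<^bsub>E\<^esub> u) = of_nat a * coord i j y" if "y \<in> carrier E" for y
    using that by (simp add: u_def E.r_distr coord_simps coord_mult_x E.smult_mult_right)
  have "coord i j (mono i' j' \<otimes>\<^bsub>E\<^esub> u [^]\<^bsub>E\<^esub> l) = of_nat a ^ l * coord i j (mono i' j')"
    by (induction l) (use u in \<open>simp_all add: step flip: E.m_assoc\<close>)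
  then show ?thesis
    using assms by (simp add: pbw_def translate_power u_def coord_mono)
qed

text \<open>
  Translating by \<open>a\<close> makes the coordinate \<open>(i, j)\<close> equal to \<open>\<Sum> c\<^sub>l a\<^sup>l\<close>, with \<open>c\<^sub>l\<close> the coefficient of
  \<open>h\<^sup>i g\<^sup>j x\<^sup>l\<close>. This is a polynomial in \<open>a\<close> of degree below \<open>p\<close> that vanishes on the \<open>p\<close> elements
  of the prime field.
\<close>

lemma coords_determine:
  assumes y: "y \<in> carrier E"
    and zero: "\<And>a i j. i < n \<Longrightarrow> j < p \<Longrightarrow> coord i j (translate a y) = 0"
  shows "y = \<zero>\<^bsub>E\<^esub>"
proof -
  obtain c where c: "Poly_Mapping.keys c \<subseteq> box" "y = linear_extension E pbw c"
    using carrier_pbw_span[OF y] by (rule pbw_spanE)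
  have "Poly_Mapping.lookup c (i, j, l) = 0" if ij: "i < n" "j < p" and l: "l < p" for i j l
  proof -
    define P where "P = (\<Sum>l<p. monom (Poly_Mapping.lookup c (i, j, l)) l)"
    have "poly P (of_nat a) = 0" for a
    proof -
      have lin: "linear_map E base_algebra (\<lambda>y. coord i j (translate a y))"
        by (rule linear_map_compose[OF k_algebra_hom_linear[OF translate_hom] coord_linear])
      have "0 = linear_extension base_algebra (\<lambda>q. coord i j (translate a (pbw q))) c"
        using zero[OF ij, of a] c(2) linear_map_linear_extension[OF k_algebra_E k_algebra_base lin, of pbw c]
        by (simp add: Pi_iff)
      also have "\<dots> = (\<Sum>q\<in>Poly_Mapping.keys c. Poly_Mapping.lookup c q * coord i j (translate a (pbw q)))"
        by (simp add: linear_extension_def finsum_base_algebra)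
      also have "\<dots> = (\<Sum>q\<in>(\<lambda>l. (i, j, l)) ` {..<p}. Poly_Mapping.lookup c q * coord i j (translate a (pbw q)))"
      proof (rule sum.mono_neutral_cong)
        fix q assume q: "q \<in> Poly_Mapping.keys c - (\<lambda>l. (i, j, l)) ` {..<p}"
        then have "q \<in> box" using c(1) by blast
        then obtain i' j' l' where "q = (i', j', l')" "i' < n" "j' < p" "l' < p" by auto
        then show "Poly_Mapping.lookup c q * coord i j (translate a (pbw q)) = 0"
          using q ij by (auto simp: coord_translate_pbw)
      qed (auto simp: in_keys_iff)
      also have "\<dots> = poly P (of_nat a)"
        using ij by (subst sum.reindex) (auto simp: inj_on_def P_def poly_sum poly_monom coord_translate_pbw)
      finally show ?thesis by simp
    qed
    moreover have "card (of_nat ` {..<p} :: 'k set) = p"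
    proof -
      have "a = b" if "of_nat a = (of_nat b :: 'k)" "a \<le> b" "b < p" for a b
      proof -
        have "of_nat (b - a) = (0 :: 'k)" using that by (simp add: of_nat_diff)
        then have "p dvd b - a" using p(1) by (simp add: of_nat_eq_0_iff_char_dvd)
        then show ?thesis using that by (auto dest: dvd_imp_le)
      qed
      then have "inj_on (of_nat :: nat \<Rightarrow> 'k) {..<p}"
        by (auto simp: inj_on_def) (metis linorder_le_cases)
      then show ?thesis by (simp add: card_image)
    qed
    moreover have "degree P < p"
      unfolding P_def using p(2) degree_monom_le
      by (intro degree_sum_less) (auto intro: le_less_trans)
    ultimately have "P = 0"
      using card_poly_roots_bound[of P] card_mono[OF poly_roots_finite[of P], of "of_nat ` {..<p}"]
      by force
    then have "coeff P l = 0" by simp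
    then show ?thesis using l by (simp add: P_def coeff_sum)
  qed
  then have lookup: "Poly_Mapping.lookup c q = 0" if "q \<in> box" for q
    using that by (cases q) auto
  have "c = 0"
  proof (rule poly_mapping_eqI)
    show "Poly_Mapping.lookup c q = Poly_Mapping.lookup 0 q" for q
      using lookup[of q] c(1) by (cases "q \<in> Poly_Mapping.keys c") (auto simp: in_keys_iff)
  qed
  then show ?thesis using c(2) by simp
qed

lemma \<Delta>_mono [simp]: "\<Delta> (mono i j) = pure_tensor E E (mono i j) (mono i j)"
proof -
  have pow: "pure_tensor E E a b [^]\<^bsub>EE\<^esub> (m::nat) = pure_tensor E E (a [^]\<^bsub>E\<^esub> m) (b [^]\<^bsub>E\<^esub> m)"
    if "a \<in> carrier E" "b \<in> carrier E" for a b m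
    by (induction m) (use that in \<open>simp_all add: EE.tensor_one EE.pure_tensor_mult\<close>)
  show ?thesis
    by (simp add: mono_def k_algebra_hom_pow[OF k_algebra_E T.k_algebra \<Delta>_hom] pow EE.pure_tensor_mult)
qed

lemma character_mono [simp]: "character a (mono i j) = 1"
  by (simp add: mono_def k_algebra_hom_pow[OF k_algebra_E k_algebra_base character_hom])

definition coord_pair :: "nat \<Rightarrow> nat \<Rightarrow> nat \<Rightarrow> nat \<Rightarrow>
    ((generator list \<Rightarrow>\<^sub>0 'k) set \<times> (generator list \<Rightarrow>\<^sub>0 'k) set \<Rightarrow>\<^sub>0 'k) set \<Rightarrow> 'k" where
  "coord_pair i j i' j' = induced base_algebra (\<lambda>(b, c). coord i j b * coord i' j' c)"

lemma coord_pair_pure: "b \<in> carrier E \<Longrightarrow> c \<in> carrier E \<Longrightarrow>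
      coord_pair i j i' j' (pure_tensor E E b c) = coord i j b * coord i' j' c"
  and coord_pair_linear: "linear_map EE base_algebra (coord_pair i j i' j')"
proof -
  have bil: "bilinear_map E E base_algebra (\<lambda>b c. coord i j b * coord i' j' c)"
    by (intro bilinear_mapI linear_mapI) (simp_all add: coord_simps algebra_simps)
  show "coord_pair i j i' j' (pure_tensor E E b c) = coord i j b * coord i' j' c"
    if "b \<in> carrier E" "c \<in> carrier E"
    unfolding coord_pair_def by (rule EE.induced_pure[OF k_algebra_base bil that])
  show "linear_map EE base_algebra (coord_pair i j i' j')"
    unfolding coord_pair_def by (rule EE.induced_bilinear_linear[OF k_algebra_base bil])
qed

lemmas coord_pair_simps = coord_pair_pure linear_mapD(2,3)[OF coord_pair_linear, simplified]

text \<open>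
  The linear forms \<open>coord\<close> vanish on \<open>E x\<close>, and so their tensor products vanish on right multiples
  of \<open>\<Delta> x = x \<otimes> 1 + g \<otimes> x\<close>. Only the grouplike monomials contribute, on which the claim is plain.
  In other words, the \<open>coord\<close> forms are orthogonal idempotents of the dual algebra.
\<close>

lemma coord_pair_\<Delta>:
  assumes "i < n" "j < p" "i' < n" "j' < p" "y \<in> carrier E"
  shows "coord_pair i j i' j' (\<Delta> y) = (if i = i' \<and> j = j' then coord i j y else 0)"
proof -
  let ?f = "\<lambda>y. coord_pair i j i' j' (\<Delta> y)" and ?f' = "\<lambda>y. if i = i' \<and> j = j' then coord i j y else 0"
  have lin: "linear_map E base_algebra ?f"
    by (rule linear_map_compose[OF k_algebra_hom_linear[OF \<Delta>_hom] coord_pair_linear])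
  have lin': "linear_map E base_algebra ?f'"
    by (rule linear_mapI) (simp_all add: coord_simps)
  have kill1: "coord_pair i j i' j' (t \<otimes>\<^bsub>EE\<^esub> pure_tensor E E xx \<one>\<^bsub>E\<^esub>) = 0" if "t \<in> carrier EE" for t
    using that
    by (induction rule: EE.tensor_induct)
       (simp_all add: T.l_distr EE.pure_tensor_mult coord_pair_simps coord_mult_x)
  have kill2: "coord_pair i j i' j' (t \<otimes>\<^bsub>EE\<^esub> pure_tensor E E gg xx) = 0" if "t \<in> carrier EE" for t
    using that
    by (induction rule: EE.tensor_induct)
       (simp_all add: T.l_distr EE.pure_tensor_mult coord_pair_simps coord_mult_x)
  have kill: "coord_pair i j i' j' (t \<otimes>\<^bsub>EE\<^esub> \<Delta> xx) = 0" if "t \<in> carrier EE" for t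
    using that by (simp add: T.r_distr coord_pair_simps kill1 kill2)
  have "?f (pbw q) = ?f' (pbw q)" if "q \<in> box" for q
  proof -
    obtain a b l where "q = (a, b, l)" by (rule prod_cases3)
    with that have q: "q = (a, b, l)" "a < n" "b < p" by auto
    show ?thesis
    proof (cases l)
      case 0
      then show ?thesis using assms q by (auto simp: pbw_def coord_pair_pure coord_mono)
    next
      case (Suc m)
      have "pbw q = (mono a b \<otimes>\<^bsub>E\<^esub> xx [^]\<^bsub>E\<^esub> m) \<otimes>\<^bsub>E\<^esub> xx"
        by (simp add: q Suc pbw_def E.m_assoc)
      then show ?thesis
        using kill[of "\<Delta> (mono a b \<otimes>\<^bsub>E\<^esub> xx [^]\<^bsub>E\<^esub> m)"]
        by (simp add: coord_mult_x del: \<Delta>_simps(3) \<Delta>_mono)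
    qed
  qed
  from linear_maps_pbw_eq[OF k_algebra_base lin lin' this assms(5)] show ?thesis .
qed

section \<open>Grouplike and skew primitive elements\<close>

lemma translate_twice:
  assumes "y \<in> carrier E"
  shows "character b (translate a y) = character (a + b) y"
proof (rule E_hom_unique[OF k_algebra_hom_compose[OF translate_hom character_hom] character_hom _ assms])
  show "character b (translate a (gen s)) = character (a + b) (gen s)" for s
    by (cases s) simp_all
qed

lemma character_0: "y \<in> carrier E \<Longrightarrow> character 0 y = \<epsilon> y"
  by (rule E_hom_unique[OF character_hom \<epsilon>_hom]) (case_tac s, simp_all)

lemma character_p: "character p = character 0"
  by (rule character_cong) (use p in simp)

text \<open>
  \<open>a \<mapsto> \<chi>\<^sub>a z\<close> is a homomorphism from the additive group of order \<open>p\<close> to the multiplicative group of \<open>k\<close>,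
  which has no element of order \<open>p\<close> in characteristic \<open>p\<close>.
\<close>

lemma translate_grouplike:
  assumes z: "z \<in> carrier E" and \<Delta>: "\<Delta> z = pure_tensor E E z z" and \<epsilon>: "\<epsilon> z = 1"
  shows "character a z = 1" "translate a z = z"
proof -
  have tr: "translate a z = character a z \<odot>\<^bsub>E\<^esub> z" for a
    using z by (simp add: translate_def \<Delta> translate_pure)
  have add: "character (a + b) z = character a z * character b z" for a b
    using translate_twice[OF z, of b a] z by (simp add: tr)
  have pow: "character a z = character 1 z ^ a" for a
  proof (induction a)
    case (Suc a)
    then show ?case using add[of 1 a] by simp
  qed (use z in \<open>simp add: character_0 \<epsilon>\<close>)
  have "character 1 z ^ p = 1"
    using pow[of p] z by (simp add: character_p character_0 \<epsilon>)
  then have "(character 1 z - 1) ^ p = 0"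
    using freshman_diff[OF prime_p, of "character 1 z" 1] p by simp
  then have "character 1 z = 1" by simp
  then show "character a z = 1" using pow[of a] by simp
  then show "translate a z = z" using z by (simp add: tr)
qed

lemma coord_one: "i < n \<Longrightarrow> j < p \<Longrightarrow> coord i j \<one>\<^bsub>E\<^esub> = (if i = 0 \<and> j = 0 then 1 else 0)"
  using coord_mono[of i j 0 0] n p(2) by simp

text \<open>
  Pairing \<open>\<Delta> z = z \<otimes> z\<close> with two coordinate forms shows that products of distinct coordinates of \<open>z\<close>
  are zero and that each coordinate is idempotent. Translations fix \<open>z\<close>, so by \<open>coords_determine\<close> some
  coordinate is nonzero; it is the only one, and \<open>z\<close> has the coordinates of a monomial.
\<close>

theorem grouplike_is_monomial:
  assumes z: "z \<in> carrier E" and \<Delta>: "\<Delta> z = pure_tensor E E z z" and \<epsilon>: "\<epsilon> z = 1"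
  obtains i j where "i < n" "j < p" "z = mono i j"
proof -
  note tr = translate_grouplike[OF assms]
  have prod: "coord i j z * coord i' j' z = (if i = i' \<and> j = j' then coord i j z else 0)"
    if "i < n" "j < p" "i' < n" "j' < p" for i j i' j'
    using coord_pair_\<Delta>[OF that z] z by (simp add: \<Delta> coord_pair_pure)
  have "\<exists>i j. i < n \<and> j < p \<and> coord i j z \<noteq> 0"
  proof (rule ccontr)
    assume "\<not> ?thesis"
    then have "z = \<zero>\<^bsub>E\<^esub>" by (intro coords_determine[OF z]) (auto simp: tr)
    then have "\<epsilon> z = 0"
      using linear_map_zero[OF k_algebra_E k_algebra_base k_algebra_hom_linear[OF \<epsilon>_hom]] by simp
    then show False using \<epsilon> by simp
  qed
  then obtain i j where ij: "i < n" "j < p" "coord i j z \<noteq> 0" by blast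
  then have one: "coord i j z = 1" using prod[of i j i j] by simp
  have "z \<ominus>\<^bsub>E\<^esub> mono i j = \<zero>\<^bsub>E\<^esub>"
  proof (rule coords_determine)
    fix a i' j' assume ij': "i' < n" "j' < p"
    have "translate a (z \<ominus>\<^bsub>E\<^esub> mono i j) = z \<ominus>\<^bsub>E\<^esub> mono i j"
      using z linear_map_minus[OF k_algebra_E k_algebra_E k_algebra_hom_linear[OF translate_hom], of z "mono i j" a]
      by (simp add: tr)
    moreover have "coord i' j' z = (if i = i' \<and> j = j' then 1 else 0)"
      using prod[OF ij(1,2) ij'] by (simp only: one mult_1_left)
    ultimately show "coord i' j' (translate a (z \<ominus>\<^bsub>E\<^esub> mono i j)) = 0"
      using z ij ij' by (simp add: coord_simps coord_mono)
  qed (use z in simp)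
  then have "z = mono i j" using E.r_right_minus_eq[OF z mono_closed] by blast
  with ij show ?thesis using that by blast
qed

text \<open>
  Translating \<open>y\<close> by \<open>a\<close> adds \<open>\<chi>\<^sub>a y\<close>, which is additive in \<open>a\<close> and hence equal to \<open>a c\<close>. Pairing the
  equation for \<open>\<Delta> y\<close> with coordinate forms expresses all coordinates of \<open>y\<close> through the one at \<open>1\<close>,
  namely as those of \<open>d (1 - m)\<close>, where \<open>m\<close> is the given monomial. So \<open>y\<close> and the right hand side have
  the same coordinates after every translation.
\<close>

theorem skew_primitive_form:
  assumes y: "y \<in> carrier E" and ij: "i < n" "j < p" "(i, j) \<noteq> (0, 0)"
    and \<Delta>: "\<Delta> y = pure_tensor E E y \<one>\<^bsub>E\<^esub> \<oplus>\<^bsub>EE\<^esub> pure_tensor E E (mono i j) y"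
  obtains c d where "y = c \<odot>\<^bsub>E\<^esub> xx \<oplus>\<^bsub>E\<^esub> d \<odot>\<^bsub>E\<^esub> (\<one>\<^bsub>E\<^esub> \<ominus>\<^bsub>E\<^esub> mono i j)"
proof -
  define c where "c = character 1 y"
  define d where "d = coord 0 0 y"
  have sum: "(if a = a' \<and> b = b' then coord a b y else 0) =
      coord a b y * (if a' = 0 \<and> b' = 0 then 1 else 0) + (if a = i \<and> b = j then 1 else 0) * coord a' b' y"
    if "a < n" "b < p" "a' < n" "b' < p" for a b a' b'
    using coord_pair_\<Delta>[OF that y] y that ij by (simp add: \<Delta> coord_pair_simps coord_one coord_mono)
  have coord: "coord a b y = d * ((if a = 0 \<and> b = 0 then 1 else 0) - (if a = i \<and> b = j then 1 else 0))"
    if "a < n" "b < p" for a b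
    using sum[OF that that] sum[OF ij(1,2) n p(2)] ij(3)
    by (auto simp: d_def eq_neg_iff_add_eq_0 split: if_splits)
  have tr: "translate a y = character a y \<odot>\<^bsub>E\<^esub> \<one>\<^bsub>E\<^esub> \<oplus>\<^bsub>E\<^esub> y" for a
    using y by (simp add: translate_def \<Delta> translate_sum translate_pure)
  have add: "character (a + b) y = character a y + character b y" for a b
    using translate_twice[OF y, of b a] y by (simp add: tr)
  have "character 0 y = 0" using add[of 0 0] by (metis add_cancel_left_right add_0)
  have ch: "character a y = of_nat a * c" for a
  proof (induction a)
    case (Suc a)
    then show ?case using add[of 1 a] by (simp add: c_def algebra_simps)
  qed (use \<open>character 0 y = 0\<close> in simp)
  define r where "r = c \<odot>\<^bsub>E\<^esub> xx \<oplus>\<^bsub>E\<^esub> d \<odot>\<^bsub>E\<^esub> (\<one>\<^bsub>E\<^esub> \<ominus>\<^bsub>E\<^esub> mono i j)"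
  have r: "r \<in> carrier E" by (simp add: r_def)
  have "y \<ominus>\<^bsub>E\<^esub> r = \<zero>\<^bsub>E\<^esub>"
  proof (rule coords_determine)
    fix a i' j' assume ij': "i' < n" "j' < p"
    note minus = linear_map_minus[OF k_algebra_E k_algebra_E k_algebra_hom_linear[OF translate_hom]]
    have "coord i' j' xx = 0" using coord_mult_x[of "\<one>\<^bsub>E\<^esub>"] by simp
    then show "coord i' j' (translate a (y \<ominus>\<^bsub>E\<^esub> r)) = 0"
      using y r ij ij' by (simp add: minus tr ch r_def coord_simps coord_one coord_mono coord[OF ij'] algebra_simps)
  qed (use y r in simp)
  then have "y = r" using E.r_right_minus_eq[OF y r] by blast
  then show ?thesis using that by (simp add: r_def)
qed

end

section \<open>Isomorphisms\<close>

lemma bialgebra_homI_generators: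
  fixes \<alpha> \<beta> :: "'k::field"
  assumes p: "p = CHAR('k)" "p > 0" and n: "n > 0" "p dvd n"
    and hom: "\<phi> \<in> k_algebra_hom (E_algebra p n \<alpha>) (E_algebra p n \<beta>)"
    and \<Delta>: "\<And>s. E_hopf_context.\<Delta> p n \<beta> (\<phi> (E_gen p n \<alpha> s)) =
      tensor_map (E_algebra p n \<beta>) (E_algebra p n \<beta>) \<phi> \<phi> (E_hopf_context.\<Delta> p n \<alpha> (E_gen p n \<alpha> s))"
    and \<epsilon>: "\<And>s. E_hopf_context.\<epsilon> (\<phi> (E_gen p n \<alpha> s)) = E_hopf_context.\<epsilon> (E_gen p n \<alpha> s)"
  shows "\<phi> \<in> bialgebra_hom (E_hopf p n \<alpha>) (E_hopf p n \<beta>)"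
proof -
  interpret A: E_hopf_context p n \<alpha> by unfold_locales (fact p n)+
  interpret B: E_hopf_context p n \<beta> by unfold_locales (fact p n)+
  note tm = tensor_map_hom[OF A.k_algebra_E A.k_algebra_E B.k_algebra_E B.k_algebra_E hom hom]
  have "B.\<Delta> (\<phi> a) = tensor_map B.E B.E \<phi> \<phi> (A.\<Delta> a)" if "a \<in> carrier A.E" for a
    by (rule A.E_hom_unique[OF k_algebra_hom_compose[OF hom B.\<Delta>_hom] k_algebra_hom_compose[OF A.\<Delta>_hom tm] \<Delta> that])
  moreover have "B.\<epsilon> (\<phi> a) = A.\<epsilon> a" if "a \<in> carrier A.E" for a
    by (rule A.E_hom_unique[OF k_algebra_hom_compose[OF hom B.\<epsilon>_hom] A.\<epsilon>_hom \<epsilon> that])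
  ultimately show ?thesis
    unfolding bialgebra_hom_def A.E_hopf_eq B.E_hopf_eq using hom by simp
qed

text \<open>
  The image of \<open>h\<close> is again grouplike, so compatibility with the comultiplication is immediate.
\<close>

lemma (in E_hopf_context) change_h_hom:
  assumes \<beta>: "\<beta> = of_nat i * \<alpha> - of_nat j"
  obtains \<phi> where "\<phi> \<in> k_algebra_hom (E_algebra p n \<beta>) E" "\<phi> \<in> bialgebra_hom (E_hopf p n \<beta>) (E_hopf p n \<alpha>)"
    "\<phi> (E_gen p n \<beta> Gen_g) = gg" "\<phi> (E_gen p n \<beta> Gen_h) = mono i j" "\<phi> (E_gen p n \<beta> Gen_x) = xx"
proof -
  interpret B: E_hopf_context p n \<beta> by unfold_locales (fact p n p_dvd)+
  let ?f = "\<lambda>s. case s of Gen_g \<Rightarrow> gg | Gen_h \<Rightarrow> mono i j | Gen_x \<Rightarrow> xx"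
  have t: "E_triple E p n \<beta> (?f Gen_g) (?f Gen_h) (?f Gen_x)"
    using E_triple_change_h[OF k_algebra_E p p_dvd E_triple_gens, of i j] by (simp add: \<beta> mono_def)
  define \<phi> where "\<phi> = induced E (eval_word E ?f)"
  note hom = B.E_hom_exists[of _ ?f, OF k_algebra_E t, folded \<phi>_def]
  have gens: "\<phi> B.gg = gg" "\<phi> B.hh = mono i j" "\<phi> B.xx = xx"
    using hom(2)[of Gen_g] hom(2)[of Gen_h] hom(2)[of Gen_x] by simp_all
  have lin: "linear_map B.E E \<phi>" by (rule k_algebra_hom_linear[OF hom(1)])
  note tm = tensor_map_pure[OF B.k_algebra_E B.k_algebra_E k_algebra_E k_algebra_E lin lin]
    linear_mapD(2)[OF tensor_map_linear[OF B.k_algebra_E B.k_algebra_E k_algebra_E k_algebra_E lin lin]]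
  have "\<phi> \<in> bialgebra_hom (E_hopf p n \<beta>) (E_hopf p n \<alpha>)"
  proof (rule bialgebra_homI_generators[OF p n p_dvd hom(1)])
    show "\<Delta> (\<phi> (B.gen s)) = tensor_map E E \<phi> \<phi> (B.\<Delta> (B.gen s))" for s
      by (cases s) (simp_all add: gens tm k_algebra_homD(5)[OF hom(1)])
    show "\<epsilon> (\<phi> (B.gen s)) = B.\<epsilon> (B.gen s)" for s
      using character_0[of "mono i j"] by (cases s) (simp_all add: gens)
  qed
  with hom(1) gens show ?thesis using that by blast
qed

text \<open>
  The two maps compose to \<open>h \<mapsto> h\<^sup>i\<^sup>i\<^sup>' g\<^sup>e\<close>, with \<open>e = j i' + j'\<close> or \<open>e = j' i + j\<close>; the
  congruences say that this is \<open>h\<close>.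
\<close>

lemma hopf_isomorphicI:
  fixes \<alpha> \<beta> :: "'k::field"
  assumes p: "p = CHAR('k)" "p > 0" and n: "n > 0" "p dvd n"
    and \<alpha>: "\<alpha> = of_nat i * \<beta> - of_nat j" and \<beta>: "\<beta> = of_nat i' * \<alpha> - of_nat j'"
    and inv: "(i * i') mod n = 1 mod n" "p dvd j * i' + j'" "p dvd j' * i + j"
  shows "hopf_isomorphic (E_hopf p n \<alpha>) (E_hopf p n \<beta>)"
proof -
  interpret A: E_hopf_context p n \<alpha> by unfold_locales (fact p n)+
  interpret B: E_hopf_context p n \<beta> by unfold_locales (fact p n)+
  obtain \<phi> where \<phi>: "\<phi> \<in> k_algebra_hom A.E B.E" "\<phi> \<in> bialgebra_hom (E_hopf p n \<alpha>) (E_hopf p n \<beta>)"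
    "\<phi> A.gg = B.gg" "\<phi> A.hh = B.mono i j" "\<phi> A.xx = B.xx"
    using B.change_h_hom[OF \<alpha>] by blast
  obtain \<psi> where \<psi>: "\<psi> \<in> k_algebra_hom B.E A.E" "\<psi> \<in> bialgebra_hom (E_hopf p n \<beta>) (E_hopf p n \<alpha>)"
    "\<psi> B.gg = A.gg" "\<psi> B.hh = A.mono i' j'" "\<psi> B.xx = A.xx"
    using A.change_h_hom[OF \<beta>] by blast
  have \<phi>m: "\<phi> (A.mono a b) = B.mono (i * a) (j * a + b)" for a b
    using B.mono_mult[of "i * a" "j * a" 0 b]
    by (simp add: A.mono_def \<phi> k_algebra_homD[OF \<phi>(1)] B.mono_power
        k_algebra_hom_pow[OF A.k_algebra_E B.k_algebra_E \<phi>(1)])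
       (simp add: B.mono_def)
  have \<psi>m: "\<psi> (B.mono a b) = A.mono (i' * a) (j' * a + b)" for a b
    using A.mono_mult[of "i' * a" "j' * a" 0 b]
    by (simp add: B.mono_def \<psi> k_algebra_homD[OF \<psi>(1)] A.mono_power
        k_algebra_hom_pow[OF B.k_algebra_E A.k_algebra_E \<psi>(1)])
       (simp add: A.mono_def)
  have "\<psi> (\<phi> A.hh) = A.mono 1 0" "\<phi> (\<psi> B.hh) = B.mono 1 0"
    using inv A.mono_mod[of "i' * i"] A.mono_mod[of 1 0] B.mono_mod[of "i * i'"] B.mono_mod[of 1 0]
    by (simp_all add: \<phi> \<psi> \<phi>m \<psi>m mult.commute)
  then have hh: "\<psi> (\<phi> A.hh) = A.hh" "\<phi> (\<psi> B.hh) = B.hh"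
    by (simp_all add: A.hh_mono B.hh_mono)
  have "\<psi> (\<phi> a) = a" if "a \<in> carrier A.E" for a
    by (rule A.E_hom_unique[OF k_algebra_hom_compose[OF \<phi>(1) \<psi>(1)] k_algebra_hom_id _ that])
       (case_tac s; simp add: hh(1); simp add: \<phi> \<psi>)
  moreover have "\<phi> (\<psi> b) = b" if "b \<in> carrier B.E" for b
    by (rule B.E_hom_unique[OF k_algebra_hom_compose[OF \<psi>(1) \<phi>(1)] k_algebra_hom_id _ that])
       (case_tac s; simp add: hh(2); simp add: \<phi> \<psi>)
  ultimately have "bij_betw \<phi> (carrier A.E) (carrier B.E)"
    using k_algebra_homD(1)[OF \<phi>(1)] k_algebra_homD(1)[OF \<psi>(1)]
    by (intro bij_betw_byWitness[where f' = \<psi>]) auto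
  then have "bij_betw \<phi> (carrier (E_hopf p n \<alpha>)) (carrier (E_hopf p n \<beta>))"
    by (simp add: A.E_hopf_eq B.E_hopf_eq)
  then show ?thesis
    unfolding hopf_isomorphic_def using \<phi>(2) A.hopf_algebra_E B.hopf_algebra_E by blast
qed

text \<open>
  The images of the generators are known up to parameters by the classification of grouplike and skew
  primitive elements; the relations of \<open>E\<^sub>\<alpha>\<close> and injectivity then pin the parameters down.
\<close>

lemma injective_hom_parameters:
  fixes \<alpha> \<beta> :: "'k::field"
  assumes p: "p = CHAR('k)" "p > 0" and n: "n > 0" "p dvd n"
    and f: "f \<in> bialgebra_hom (E_hopf p n \<alpha>) (E_hopf p n \<beta>)"
    and inj: "inj_on f (carrier (E_hopf p n \<alpha>))"
  obtains i j where "of_nat i \<noteq> (0 :: 'k)" "\<alpha> = of_nat i * \<beta> - of_nat j"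
proof -
  interpret A: E_hopf_context p n \<alpha> by unfold_locales (fact p n)+
  interpret B: E_hopf_context p n \<beta> by unfold_locales (fact p n)+
  have hom: "f \<in> k_algebra_hom A.E B.E"
    and \<Delta>: "\<And>a. a \<in> carrier A.E \<Longrightarrow> B.\<Delta> (f a) = tensor_map B.E B.E f f (A.\<Delta> a)"
    and \<epsilon>: "\<And>a. a \<in> carrier A.E \<Longrightarrow> B.\<epsilon> (f a) = A.\<epsilon> a"
    using f unfolding bialgebra_hom_def A.E_hopf_eq B.E_hopf_eq by auto
  have inj: "inj_on f (carrier A.E)" using inj by (simp add: A.E_hopf_eq)
  have lin: "linear_map A.E B.E f" by (rule k_algebra_hom_linear[OF hom])
  note tm = tensor_map_pure[OF A.k_algebra_E A.k_algebra_E B.k_algebra_E B.k_algebra_E lin lin]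
    linear_mapD(2)[OF tensor_map_linear[OF A.k_algebra_E A.k_algebra_E B.k_algebra_E B.k_algebra_E lin lin]]
  note fh = k_algebra_homD[OF hom]
  note fpow = k_algebra_hom_pow[OF A.k_algebra_E B.k_algebra_E hom]
  have p1: "p > 1" by (rule prime_gt_1_nat[OF A.prime_p])
  obtain i0 j0 where g0: "i0 < n" "j0 < p" "f A.gg = B.mono i0 j0"
    by (rule B.grouplike_is_monomial[of "f A.gg"]) (simp_all add: fh \<Delta> \<epsilon> tm)
  obtain i j where h: "i < n" "j < p" "f A.hh = B.mono i j"
    by (rule B.grouplike_is_monomial[of "f A.hh"]) (simp_all add: fh \<Delta> \<epsilon> tm)
  have "A.gg \<noteq> \<one>\<^bsub>A.E\<^esub>"
    using A.coord_mono[of 0 1 0 1] A.coord_mono[of 0 1 0 0] p1 A.n by (auto simp: A.gg_mono)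
  have ne: "(i0, j0) \<noteq> (0, 0)"
  proof
    assume "(i0, j0) = (0, 0)"
    then have "f A.gg = f \<one>\<^bsub>A.E\<^esub>" using g0(3) fh(5) by simp
    from inj_onD[OF inj this] \<open>A.gg \<noteq> \<one>\<^bsub>A.E\<^esub>\<close> show False by simp
  qed
  have \<Delta>x: "B.\<Delta> (f A.xx) = pure_tensor B.E B.E (f A.xx) \<one>\<^bsub>B.E\<^esub> \<oplus>\<^bsub>B.EE\<^esub> pure_tensor B.E B.E (B.mono i0 j0) (f A.xx)"
    using \<Delta>[of A.xx] by (simp add: tm fh(5) g0(3))
  obtain c d where x: "f A.xx = c \<odot>\<^bsub>B.E\<^esub> B.xx \<oplus>\<^bsub>B.E\<^esub> d \<odot>\<^bsub>B.E\<^esub> (\<one>\<^bsub>B.E\<^esub> \<ominus>\<^bsub>B.E\<^esub> B.mono i0 j0)"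
    by (rule B.skew_primitive_form[OF fh(1) g0(1,2) ne \<Delta>x]) simp_all
  (* The summand of f(x) in the group algebra of the commuting elements g and h drops out. *)
  have comm: "f A.xx \<otimes>\<^bsub>B.E\<^esub> B.mono a b \<ominus>\<^bsub>B.E\<^esub> B.mono a b \<otimes>\<^bsub>B.E\<^esub> f A.xx =
      (c * (of_nat a * \<beta> - of_nat b)) \<odot>\<^bsub>B.E\<^esub> (B.mono a b \<ominus>\<^bsub>B.E\<^esub> B.mono a (Suc b))" for a b
  proof -
    let ?m = "B.mono a b" and ?\<gamma> = "B.mono i0 j0"
    define R where "R = d \<odot>\<^bsub>B.E\<^esub> (?m \<ominus>\<^bsub>B.E\<^esub> ?\<gamma> \<otimes>\<^bsub>B.E\<^esub> ?m)"
    have R: "R \<in> carrier B.E" by (simp add: R_def)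
    have \<gamma>m: "?m \<otimes>\<^bsub>B.E\<^esub> ?\<gamma> = ?\<gamma> \<otimes>\<^bsub>B.E\<^esub> ?m"
      by (simp add: B.mono_mult add.commute)
    have l: "f A.xx \<otimes>\<^bsub>B.E\<^esub> ?m = c \<odot>\<^bsub>B.E\<^esub> (B.xx \<otimes>\<^bsub>B.E\<^esub> ?m) \<oplus>\<^bsub>B.E\<^esub> R"
      by (simp add: x R_def B.E.l_distr B.E.smult_mult_left B.E.minus_eq B.E.l_minus)
    have r: "?m \<otimes>\<^bsub>B.E\<^esub> f A.xx = c \<odot>\<^bsub>B.E\<^esub> (?m \<otimes>\<^bsub>B.E\<^esub> B.xx) \<oplus>\<^bsub>B.E\<^esub> R"
      by (simp add: x R_def \<gamma>m[symmetric] B.E.r_distr B.E.smult_mult_right B.E.minus_eq B.E.r_minus)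
    have cancel: "(u \<oplus>\<^bsub>B.E\<^esub> v \<oplus>\<^bsub>B.E\<^esub> w) \<ominus>\<^bsub>B.E\<^esub> (u \<oplus>\<^bsub>B.E\<^esub> w) = v"
      if "u \<in> carrier B.E" "v \<in> carrier B.E" "w \<in> carrier B.E" for u v w
    proof -
      have "u \<oplus>\<^bsub>B.E\<^esub> v \<oplus>\<^bsub>B.E\<^esub> w = v \<oplus>\<^bsub>B.E\<^esub> (u \<oplus>\<^bsub>B.E\<^esub> w)"
        using that by (simp add: B.E.a_ac)
      then show ?thesis using that by (simp add: B.E.minus_eq B.E.a_assoc B.E.r_neg)
    qed
    show ?thesis
      unfolding l r B.xx_mono using R cancel by (simp add: B.E.smult_add_right B.E.smult_smult)
  qed
  have t: "E_triple B.E p n \<alpha> (f A.gg) (f A.hh) (f A.xx)"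
    by (rule E_triple_hom[OF A.k_algebra_E B.k_algebra_E hom A.E_triple_gens])
  have m1: "B.mono a b \<otimes>\<^bsub>B.E\<^esub> (\<one>\<^bsub>B.E\<^esub> \<ominus>\<^bsub>B.E\<^esub> B.mono a' b') = B.mono a b \<ominus>\<^bsub>B.E\<^esub> B.mono (a + a') (b + b')" for a b a' b'
    by (simp add: B.E.minus_eq B.E.r_distr B.E.r_minus B.mono_mult)
  have coord: "B.coord a b (B.mono a' b') = (if a = a' mod n \<and> b = b' mod p then 1 else 0)"
    if "a < n" "b < p" for a b a' b'
    using B.coord_mono[OF that, of "a' mod n" "b' mod p"] B.n B.p(2) B.mono_mod[of a' b'] by simp
  define \<kappa> where "\<kappa> = c * (of_nat i0 * \<beta> - of_nat j0)"
  have "f A.gg \<otimes>\<^bsub>B.E\<^esub> f A.xx \<ominus>\<^bsub>B.E\<^esub> f A.xx \<otimes>\<^bsub>B.E\<^esub> f A.gg = f A.gg \<otimes>\<^bsub>B.E\<^esub> (\<one>\<^bsub>B.E\<^esub> \<ominus>\<^bsub>B.E\<^esub> f A.gg)"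
    using t by (simp add: E_triple_def)
  (* With m = f(g), the relation reads m - m^2 = -kappa (m - m g). As m differs from 1, the
     coordinate at m^2 vanishes on m, so it must be matched by m g. Hence m^2 = m g, that is m = g. *)
  then have eq: "B.mono i0 j0 \<otimes>\<^bsub>B.E\<^esub> f A.xx \<ominus>\<^bsub>B.E\<^esub> f A.xx \<otimes>\<^bsub>B.E\<^esub> B.mono i0 j0 =
      B.mono i0 j0 \<ominus>\<^bsub>B.E\<^esub> B.mono (i0 + i0) (j0 + j0)"
    by (simp only: g0(3) m1)
  define a b where "a = (i0 + i0) mod n" and "b = (j0 + j0) mod p"
  have ab: "a < n" "b < p" using B.n B.p(2) by (simp_all add: a_def b_def)
  have s1: "B.coord a b (B.mono i0 j0 \<otimes>\<^bsub>B.E\<^esub> f A.xx) - B.coord a b (f A.xx \<otimes>\<^bsub>B.E\<^esub> B.mono i0 j0) =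
      B.coord a b (B.mono i0 j0) - B.coord a b (B.mono (i0 + i0) (j0 + j0))"
    using eq[THEN arg_cong, of "B.coord a b"] by (simp add: B.coord_simps fh)
  have s2: "B.coord a b (f A.xx \<otimes>\<^bsub>B.E\<^esub> B.mono i0 j0) - B.coord a b (B.mono i0 j0 \<otimes>\<^bsub>B.E\<^esub> f A.xx) =
      \<kappa> * (B.coord a b (B.mono i0 j0) - B.coord a b (B.mono i0 (Suc j0)))"
    using comm[of i0 j0, THEN arg_cong, of "B.coord a b"] by (simp add: B.coord_simps fh \<kappa>_def)
  have key: "B.coord a b (B.mono i0 j0) - B.coord a b (B.mono (i0 + i0) (j0 + j0)) =
      - \<kappa> * (B.coord a b (B.mono i0 j0) - B.coord a b (B.mono i0 (Suc j0)))"
    unfolding s1[symmetric] mult_minus_left s2[symmetric] by simp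
  have double: "(k + k) mod q = k \<Longrightarrow> k = 0" if "k < q" for k q :: nat
    using that by (cases "k + k < q") (auto simp: le_mod_geq not_less)
  have "\<not> (a = i0 \<and> b = j0)"
    using double[OF g0(1)] double[OF g0(2)] ne by (auto simp: a_def b_def)
  then have "B.coord a b (B.mono i0 j0) = 0"
    using g0(1,2) by (simp add: coord[OF ab])
  moreover have "B.coord a b (B.mono (i0 + i0) (j0 + j0)) = 1"
    using coord[OF ab, of "i0 + i0" "j0 + j0"] unfolding a_def b_def by simp
  ultimately have "\<kappa> * B.coord a b (B.mono i0 (Suc j0)) = - 1"
    using key by simp
  then have "1 = - \<kappa> * B.coord a b (B.mono i0 (Suc j0))"
    by simp
  then have "1 = - \<kappa> * (if a = i0 \<and> b = Suc j0 mod p then 1 else 0)"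
    using g0(1) by (simp add: coord[OF ab])
  then have a: "a = i0" and b: "b = Suc j0 mod p" and \<kappa>: "- \<kappa> = 1" by (auto split: if_splits)
  have i0: "i0 = 0" using double[OF g0(1)] a by (simp add: a_def)
  have j0: "j0 = 1"
  proof (cases "Suc j0 = p")
    case True
    then have "p dvd j0 + j0" using b by (simp add: b_def mod_eq_0_iff_dvd)
    moreover have "j0 + j0 = p + (p - 2)" using True p1 by simp
    ultimately have "p dvd p - 2" by (metis dvd_add_right_iff dvd_refl)
    then have "p - 2 = 0" using p1 by (metis dvd_imp_le diff_less gr0I not_le zero_less_numeral less_trans zero_less_one)
    then show ?thesis using True p1 by simp
  next
    case False
    then have "(j0 + j0) mod p = Suc j0" using b g0(2) by (simp add: b_def)
    then show ?thesis
      using g0(2) by (cases "j0 + j0 < p") (auto simp: le_mod_geq not_less)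
  qed
  have c: "c = 1" using \<kappa> by (simp add: \<kappa>_def i0 j0)
  have "f A.xx \<otimes>\<^bsub>B.E\<^esub> f A.hh \<ominus>\<^bsub>B.E\<^esub> f A.hh \<otimes>\<^bsub>B.E\<^esub> f A.xx = \<alpha> \<odot>\<^bsub>B.E\<^esub> (f A.hh \<otimes>\<^bsub>B.E\<^esub> (\<one>\<^bsub>B.E\<^esub> \<ominus>\<^bsub>B.E\<^esub> f A.gg))"
    using t by (simp add: E_triple_def)
  then have "(of_nat i * \<beta> - of_nat j) \<odot>\<^bsub>B.E\<^esub> (B.mono i j \<ominus>\<^bsub>B.E\<^esub> B.mono i (Suc j)) =
      \<alpha> \<odot>\<^bsub>B.E\<^esub> (B.mono i j \<ominus>\<^bsub>B.E\<^esub> B.mono i (Suc j))"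
    unfolding h(3) g0(3) m1 comm by (simp add: c i0 j0)
  from this[THEN arg_cong, of "B.coord i j"]
  have eq\<alpha>: "(of_nat i * \<beta> - of_nat j) * (1 - B.coord i j (B.mono i (Suc j))) = \<alpha> * (1 - B.coord i j (B.mono i (Suc j)))"
    using B.coord_mono[OF h(1,2) h(1,2)] by (simp add: B.coord_simps)
  have "j \<noteq> Suc j mod p"
    using h(2) p1 by (cases "Suc j = p") auto
  then have \<alpha>: "\<alpha> = of_nat i * \<beta> - of_nat j"
    using eq\<alpha> h by (simp add: coord)
  (* If p divides i, then f(h^(n/p)) is a power of g, which is also the image of a power of g. *)
  have "of_nat i \<noteq> (0 :: 'k)"
  proof
    assume "of_nat i = (0 :: 'k)"
    then obtain i1 where i1: "i = p * i1"
      using B.p(1) by (auto simp: of_nat_eq_0_iff_char_dvd elim: dvdE)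
    obtain r where r: "n = p * r" using B.p_dvd by (elim dvdE)
    have rn: "0 < r" "r < n" using r B.n p1 by (auto intro: Nat.gr0I)
    have "f (A.mono r 0) = B.mono (i * r) (j * r)"
      by (simp add: A.mono_def fh fpow h(3) B.mono_power)
    also have "\<dots> = B.mono 0 (j * r)"
      using B.mono_mod[of "i * r" "j * r"] B.mono_mod[of 0 "j * r"] by (simp add: i1 r mult.left_commute)
    also have "\<dots> = f (A.mono 0 (j * r))"
      by (simp add: A.mono_def fh fpow g0(3) i0 j0 B.mono_power)
    finally have "A.mono r 0 = A.mono 0 (j * r)"
      using inj by (meson A.mono_closed inj_onD)
    then have "A.mono r 0 = A.mono 0 (j * r mod p)"
      using A.mono_mod[of 0 "j * r"] by simp
    then show False
      using A.coord_mono[of r 0 r 0] A.coord_mono[of r 0 0 "j * r mod p"] rn A.n A.p(2) by simp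
  qed
  then show ?thesis using \<alpha> that by blast
qed

lemma of_int_eq_of_nat:
  assumes "CHAR('k::ring_1) > 0"
  obtains m where "(of_int a :: 'k) = of_nat m"
proof -
  let ?p = "CHAR('k)"
  have "a = (a mod int ?p) + int ?p * (a div int ?p)" by simp
  then have "(of_int a :: 'k) = of_int (a mod int ?p) + of_int (int ?p) * of_int (a div int ?p)"
    by (metis of_int_add of_int_mult)
  also have "\<dots> = of_nat (nat (a mod int ?p))"
    using assms by simp
  finally show ?thesis using that by blast
qed

lemma of_nat_in_prime_field: "of_nat m \<in> prime_field"
  unfolding prime_field_def by (metis of_int_of_nat_eq rangeI)

text \<open>
  Fermat's little theorem.
\<close>

lemma of_nat_inverse:
  assumes p: "p = CHAR('k::field)" "p > 0" and "(of_nat a :: 'k) \<noteq> 0"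
  shows "(of_nat (a ^ (p - 2)) :: 'k) * of_nat a = 1"
proof -
  (* An arbitrary instance of the context, for the identity a^p = a in the prime field. *)
  interpret E_hopf_context p p "0 :: 'k" by unfold_locales (use p in auto)
  have "p = Suc (Suc (p - 2))" using prime_ge_2_nat[OF prime_p] by simp
  then have "(of_nat a :: 'k) ^ (p - 2) * of_nat a * of_nat a = of_nat a"
    using of_nat_power_p[of a] by (metis power_Suc2)
  then show ?thesis using assms(3) by simp
qed

text \<open>
  Solving \<open>\<alpha> = i \<beta> - j\<close> for \<open>\<beta>\<close> gives the affine form. In the other direction \<open>i\<close> is prescribed modulo
  \<open>p\<close> only, as the inverse of \<open>u\<close>; the Chinese remainder theorem makes it \<open>1\<close> modulo the part of \<open>n\<close>
  that is prime to \<open>p\<close>, so that it becomes a unit modulo \<open>n\<close>.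
\<close>

theorem hopf_isomorphic_iff:
  fixes \<alpha> \<beta> :: "'k::field"
  assumes p: "p = CHAR('k)" "p > 0" and n: "n > 0" "p dvd n"
  shows "hopf_isomorphic (E_hopf p n \<alpha>) (E_hopf p n \<beta>) \<longleftrightarrow>
    (\<exists>u \<in> prime_field - {0}. \<exists>v \<in> prime_field. \<beta> = u * \<alpha> + v)"
proof
  interpret A: E_hopf_context p n \<alpha> by unfold_locales (fact p n)+
  {
    assume "hopf_isomorphic (E_hopf p n \<alpha>) (E_hopf p n \<beta>)"
    then obtain f where f: "f \<in> bialgebra_hom (E_hopf p n \<alpha>) (E_hopf p n \<beta>)" "inj_on f (carrier (E_hopf p n \<alpha>))"
      unfolding hopf_isomorphic_def bij_betw_def by blast
    obtain i j where ij: "of_nat i \<noteq> (0 :: 'k)" "\<alpha> = of_nat i * \<beta> - of_nat j"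
      by (rule injective_hom_parameters[OF p n f])
    define u where "u = (of_nat (i ^ (p - 2)) :: 'k)"
    have u: "u * of_nat i = 1" unfolding u_def by (rule of_nat_inverse[OF p ij(1)])
    have "u * \<alpha> + u * of_nat j = (u * of_nat i) * \<beta>" by (simp add: ij(2) algebra_simps)
    then have "\<beta> = u * \<alpha> + u * of_nat j" using u by simp
    moreover have "u \<in> prime_field" "u * of_nat j \<in> prime_field"
      unfolding u_def of_nat_mult[symmetric] by (rule of_nat_in_prime_field)+
    moreover have "u \<noteq> 0" using u by auto
    ultimately show "\<exists>u \<in> prime_field - {0}. \<exists>v \<in> prime_field. \<beta> = u * \<alpha> + v" by blast
  }
  assume "\<exists>u \<in> prime_field - {0}. \<exists>v \<in> prime_field. \<beta> = u * \<alpha> + v"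
  then obtain a b where ab: "(of_int a :: 'k) \<noteq> 0" "\<beta> = of_int a * \<alpha> + of_int b"
    by (auto simp: prime_field_def)
  obtain a' where a': "(of_int a :: 'k) = of_nat a'" using of_int_eq_of_nat p by metis
  obtain b' where b': "(of_int b :: 'k) = of_nat b'" using of_int_eq_of_nat p by metis
  define k where "k = a' ^ (p - 2)"
  have k: "(of_nat k :: 'k) * of_nat a' = 1"
    unfolding k_def by (rule of_nat_inverse[OF p]) (use ab a' in simp)
  have pk: "\<not> p dvd k"
    using k p(1) of_nat_eq_0_iff_char_dvd[of k, where 'a = 'k] by auto
  obtain e m where em: "n = p ^ e * m" "\<not> p dvd m"
    using n(1) A.prime_p by (metis multiplicity_decompose' not_prime_unit not_gr_zero)
  have cop: "coprime p m" using em(2) A.prime_p by (simp add: prime_imp_coprime)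
  obtain i q1 q2 where i: "i = k + q1 * p" "i = 1 + q2 * m"
    using chinese_remainder[OF cop, of k 1] p(2) em(1) n(1) by (metis mult_eq_0_iff not_gr_zero)
  have "coprime i p"
    using pk A.prime_p i(1) by (metis coprime_commute dvd_add_left_iff dvd_triv_right prime_imp_coprime)
  moreover have "coprime i m" unfolding i(2) by (rule coprimeI) (metis dvd_add_left_iff dvd_mult)
  ultimately have "coprime i n" by (simp add: em(1))
  moreover have "n \<noteq> 1" using n(2) prime_gt_1_nat[OF A.prime_p] by auto
  ultimately obtain i' y where i': "i * i' = n * y + 1"
    using coprime_bezout_strong by blast
  have of_nat_p: "(of_nat p :: 'k) = 0" "(of_nat n :: 'k) = 0"
    using p n by (auto simp: of_nat_eq_0_iff_char_dvd)
  have ik: "(of_nat i :: 'k) = of_nat k" by (simp add: i(1) of_nat_p(1))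
  have ii': "(of_nat i :: 'k) * of_nat i' = 1"
    using i' of_nat_p(2) by (metis add_0 mult_zero_left of_nat_1 of_nat_add of_nat_mult)
  (* j' is - j i' modulo p, written without subtraction. *)
  define j j' where "j = i * b'" and "j' = j * i' * (p - 1)"
  have pS: "p = Suc (p - 1)" using p(2) by simp
  have "j * i' + j' = j * i' * p" by (subst pS) (simp add: j'_def)
  then have dvd1: "p dvd j * i' + j'" by simp
  have "j' * i + j + j * (n * y) * 1 = j' * i + j * (i * i')" unfolding i' by (simp add: algebra_simps)
  also have "\<dots> = (j * i' + j') * i" by (simp add: algebra_simps)
  finally have "p dvd j' * i + j + j * (n * y) * 1" using dvd1 by simp
  then have dvd2: "p dvd j' * i + j"
    using n(2) by (metis dvd_add_left_iff dvd_mult dvd_mult2)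
  have \<alpha>: "\<alpha> = of_nat i * \<beta> - of_nat j"
    using k by (simp add: ab(2) a' b' j_def ik algebra_simps flip: mult.assoc)
  have "of_nat j * of_nat i' + of_nat j' = (0 :: 'k)"
    using dvd1 p(1) by (metis of_nat_add of_nat_mult of_nat_eq_0_iff_char_dvd)
  then have "of_nat i' * \<alpha> - of_nat j' = (of_nat i * of_nat i') * \<beta>"
    unfolding \<alpha> by (simp add: algebra_simps eq_neg_iff_add_eq_0)
  then have \<beta>: "\<beta> = of_nat i' * \<alpha> - of_nat j'" using ii' by simp
  show "hopf_isomorphic (E_hopf p n \<alpha>) (E_hopf p n \<beta>)"
    by (rule hopf_isomorphicI[OF p n \<alpha> \<beta> _ dvd1 dvd2]) (unfold i', rule mod_mult_self4)
qed

theorem theorem5p4: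
  fixes p n :: nat
  assumes "CHAR('k::alg_closed_field) = p" and "p > 0" and "n > 0" and "p dvd n"
  shows "(\<forall>\<alpha> \<alpha>' :: 'k.
            hopf_isomorphic (E_hopf p n \<alpha>) (E_hopf p n \<alpha>') \<longleftrightarrow>
            (\<exists>u \<in> prime_field - {0}. \<exists>v \<in> prime_field. \<alpha>' = u * \<alpha> + v)) \<and>
         bij_betw (\<lambda>T. E_hopf p n ` T)
           (orbits affine_group (UNIV :: 'k set) affine_action)
           (E_family p n // E_iso_rel p n)"
proof -
  have iff: "hopf_isomorphic (E_hopf p n \<alpha>) (E_hopf p n \<alpha>') \<longleftrightarrow>
      (\<exists>u \<in> prime_field - {0}. \<exists>v \<in> prime_field. \<alpha>' = u * \<alpha> + v)" for \<alpha> \<alpha>' :: 'k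
    using hopf_isomorphic_iff assms by blast
  have orbit: "orbit affine_group affine_action \<alpha> = {\<alpha>'. hopf_isomorphic (E_hopf p n \<alpha>) (E_hopf p n \<alpha>')}"
    for \<alpha> :: 'k
    unfolding iff by (auto simp: orbit_def affine_group_def affine_action_def)
  (* Distinct parameters might a priori give equal records. Orbits are still determined by their
     images, because membership in an orbit depends on the parameter only through the record. *)
  have recover: "orbit affine_group affine_action \<alpha> = {\<gamma>. E_hopf p n \<gamma> \<in> E_hopf p n ` orbit affine_group affine_action \<alpha>}"
    for \<alpha> :: 'k
    unfolding orbit by auto
  have "inj_on (\<lambda>T. E_hopf p n ` T) (orbits affine_group (UNIV :: 'k set) affine_action)"
  proof (rule inj_onI)
    fix T U assume "T \<in> orbits affine_group (UNIV :: 'k set) affine_action" "U \<in> orbits affine_group (UNIV :: 'k set) affine_action"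
      and eq: "E_hopf p n ` T = E_hopf p n ` U"
    then obtain \<alpha> \<beta> :: 'k where "T = orbit affine_group affine_action \<alpha>" "U = orbit affine_group affine_action \<beta>"
      by (auto simp: orbits_def)
    then show "T = U" using eq recover[of \<alpha>] recover[of \<beta>] by simp
  qed
  moreover have "(\<lambda>T. E_hopf p n ` T) ` orbits affine_group (UNIV :: 'k set) affine_action = E_family p n // E_iso_rel p n"
  proof -
    have "E_iso_rel p n `` {E_hopf p n \<alpha>} = E_hopf p n ` orbit affine_group affine_action \<alpha>" for \<alpha> :: 'k
      unfolding orbit by (auto simp: E_iso_rel_def E_family_def)
    then show ?thesis
      by (auto simp: quotient_def orbits_def E_family_def)
  qed
  ultimately show ?thesis
    using iff by (simp add: bij_betw_def)
qed

end
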